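(* Let $f=\frac1n\sum_{i=1}^n f_i$ on $\mathbb{R}^d$ satisfy A1 (each $f_i$ is differentiable, convex, and $f_i(x)-f_i(y)-\langle\nabla f_i(y),x-y\rangle\le\frac L2\|x-y\|_2^2$ for all $x,y$) and A2 ($f(x)-f(x^* )\ge\frac\mu2\|x-x^*\|_2^2$ for all $x$, for some $\mu\ge0$), and put $\kappa=L/\mu$ ($=\infty$ if $\mu=0$). Fix constants $\alpha>1$, $m_0>0$, $\xi\in(0,1)$ and run the SCSG algorithm (described in the context) with $\eta_j\equiv\eta$, $b_j\equiv b$, $m_j=m_0\alpha^j$, $B_j=\lceil B_0\alpha^{2j}\wedge n\rceil$, where, with $\Gamma=\frac1{4\alpha^{1/\xi}}$, $$m_0\ge b/\Gamma,\qquad 2\eta L\le\min\{1-\Gamma,\;2\Gamma b,\;\Gamma^2bB_0/m_0\},$$ and $B_0<n$. Then the expected cost $\mathbb{E}\,C_{\mathrm{comp}}(\epsilon)$ of reaching accuracy $\epsilon$ satisfies $$\mathbb{E}\,C_{\mathrm{comp}}(\epsilon)=O\Big(A(\epsilon)^2\wedge\big(A(\epsilon)+n\log A(\epsilon)\big)\Big)$$ for a quantity $A(\epsilon)$ with $$A(\epsilon)=\tilde O\left(\min\left\{\frac D\epsilon,\;\kappa\Big(\frac{D_x}{\epsilon\kappa}\Big)_*^{\xi}+\frac{D_H}\epsilon,\;\tilde\kappa\Big(\frac{D}{\epsilon\tilde\kappa}\Big)_*^{\xi}\right\}\right),\qquad\tilde\kappa=\sqrt n+\kappa .$$ In particular,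 $$\mathbb{E}\,C_{\mathrm{comp}}(\epsilon)=\tilde O\left(\min\left\{\frac{D^2}{\epsilon^2},\;\frac{D_H^2}{\epsilon^2}+\kappa^2\Big(\frac{D_x}{\epsilon\kappa}\Big)_*^{2\xi},\;n+\frac D\epsilon,\;n+\tilde\kappa\Big(\frac D{\epsilon\tilde\kappa}\Big)_*^{\xi}\right\}\right).$$
   Context: Notation: $a\wedge b=\min\{a,b\}$; $(a)_*^{\xi}=\max\{a,1\}^{\xi}$. $L\in(0,\infty)$; $x^*$ is a minimizer of $f$ (if several, one minimizing $\mathcal H$). $\mathcal H=\frac1n\sum_{i=1}^n\|\nabla f_i(x^* )\|_2^2$, $D_x=L\,\mathbb{E}\|\tilde x_0-x^*\|_2^2<\infty$, $D_H=\mathcal H/L$, $D=\max\{D_x,D_H\}$. For $\mathcal I\subset\{1,\dots,n\}$, $\nabla f_{\mathcal I}(x)=\frac1{|\mathcal I|}\sum_{i\in\mathcal I}\nabla f_i(x)$. $N\sim\mathrm{Geom}(\gamma)$ means $P(N=k)=(1-\gamma)\gamma^k$, $k=0,1,2,\dots$. SCSG algorithm. Inputs: initial (possibly random) iterate $\tilde x_0$, stepsizes $\eta_j>0$, batch sizes $B_j\in\{1,\dots,n\}$, inner loop sizes $m_j>0$, mini-batch sizes $b_j\in\{1,\dots,n\}$. For $j=1,2,\dots$: draw a uniformly random subset $\mathcal I_j\subset\{1,\dots,n\}$ of size $B_j$; set $\mu_j=\nabla f_{\mathcal I_j}(\tilde x_{j-1})$ and $x^{(j)}_0=\tilde x_{j-1}$;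 draw $N_j\sim\mathrm{Geom}\big(\frac{m_j}{m_j+b_j}\big)$; for $k=1,\dots,N_j$, draw a uniformly random subset $\tilde{\mathcal I}^{(j)}_{k-1}$ of size $b_j$, set $\nu^{(j)}_{k-1}=\nabla f_{\tilde{\mathcal I}^{(j)}_{k-1}}(x^{(j)}_{k-1})-\nabla f_{\tilde{\mathcal I}^{(j)}_{k-1}}(x^{(j)}_0)+\mu_j$ and $x^{(j)}_k=x^{(j)}_{k-1}-\eta_j\nu^{(j)}_{k-1}$; set $\tilde x_j=x^{(j)}_{N_j}$. All random draws are mutually independent and independent of $\tilde x_0$. Cost: $T(\epsilon)=\min\{T':\mathbb{E}(f(\tilde x_T)-f(x^* ))\le\epsilon\ \ \forall\,T\ge T'\}$ and $C_{\mathrm{comp}}(\epsilon)=\sum_{j=1}^{T(\epsilon)}(b_jN_j+B_j)$, so that $\mathbb{E}\,C_{\mathrm{comp}}(\epsilon)=\sum_{j=1}^{T(\epsilon)}(m_j+B_j)$. Asymptotic conventions: the bounds concern target accuracies $0<\epsilon\le D$. $O(\cdot)$ hides constants depending only on the algorithm parameters $\alpha,\xi,m_0,B_0,b$ and $\eta L$ (not on $n,\epsilon,\mu,D_x,D_H$); $\tilde O(\cdot)$ additionally hides factors polylogarithmic in $n$ and $D/\epsilon$. Terms containing $\kappa=\infty$ are read as $+\infty$. *)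

theory Defs
  imports "HOL-Probability.Probability"
begin

(*
  The constants hidden by O-notation must be uniform in the dimension d, so d has to be an
  ordinary number that can be quantified inside the statement, not a type.  Every R^d is therefore
  realised as the subspace  Rd d  of one fixed real inner product space: the finitely supported
  real sequences with the Euclidean inner product.  On  Rd d  the inherited norm, topology and
  Borel sets are the usual ones of R^d.
*)

typedef fsvec = "{x :: nat \<Rightarrow> real. finite {i. x i \<noteq> 0}}"
  morphisms coord Abs_fsvec
  by (rule exI[of _ "\<lambda>_. 0"]) simp

setup_lifting type_definition_fsvec

lemma finite_supp [simp]: "finite {i. coord x i \<noteq> 0}"
  using coord[of x] by simp

instantiation fsvec :: real_vector
begin

lift_definition zero_fsvec :: fsvec is "\<lambda>_. 0" by simp

lift_definition plus_fsvec :: "fsvec \<Rightarrow> fsvec \<Rightarrow> fsvec" is "\<lambda>x y i. x i + y i"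
  subgoal for x y by (rule finite_subset[of _ "{i. x i \<noteq> 0} \<union> {i. y i \<noteq> 0}"]) auto
  done

lift_definition minus_fsvec :: "fsvec \<Rightarrow> fsvec \<Rightarrow> fsvec" is "\<lambda>x y i. x i - y i"
  subgoal for x y by (rule finite_subset[of _ "{i. x i \<noteq> 0} \<union> {i. y i \<noteq> 0}"]) auto
  done

lift_definition uminus_fsvec :: "fsvec \<Rightarrow> fsvec" is "\<lambda>x i. - x i" by simp

lift_definition scaleR_fsvec :: "real \<Rightarrow> fsvec \<Rightarrow> fsvec" is "\<lambda>r x i. r * x i"
  subgoal for r x by (rule finite_subset[of _ "{i. x i \<noteq> 0}"]) auto
  done

instance
  by intro_classes (transfer; simp add: fun_eq_iff algebra_simps)+

end

instantiation fsvec :: real_inner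
begin

definition inner_fsvec :: "fsvec \<Rightarrow> fsvec \<Rightarrow> real" where
  "inner_fsvec x y = (\<Sum>i | coord x i \<noteq> 0. coord x i * coord y i)"

definition norm_fsvec :: "fsvec \<Rightarrow> real" where
  "norm_fsvec x = sqrt (inner x x)"

definition sgn_fsvec :: "fsvec \<Rightarrow> fsvec" where
  "sgn_fsvec x = x /\<^sub>R norm x"

definition dist_fsvec :: "fsvec \<Rightarrow> fsvec \<Rightarrow> real" where
  "dist_fsvec x y = norm (x - y)"

definition uniformity_fsvec :: "(fsvec \<times> fsvec) filter" where
  "uniformity_fsvec = (INF e\<in>{0<..}. principal {(x, y). dist x y < e})"

definition open_fsvec :: "fsvec set \<Rightarrow> bool" where
  "open_fsvec U \<longleftrightarrow> (\<forall>x\<in>U. \<forall>\<^sub>F (x', y) in uniformity. x' = x \<longrightarrow> y \<in> U)"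

instance
proof
  have inner_eq: "inner x y = (\<Sum>i\<in>S. coord x i * coord y i)"
    if "finite S" "{i. coord x i \<noteq> 0} \<subseteq> S" for S and x y :: fsvec
    unfolding inner_fsvec_def using that by (intro sum.mono_neutral_left) auto
  fix x y z :: fsvec and r :: real
  show "dist x y = norm (x - y)" by (simp add: dist_fsvec_def)
  show "sgn x = x /\<^sub>R norm x" by (simp add: sgn_fsvec_def)
  show "uniformity = (INF e\<in>{0<..}. principal {(x :: fsvec, y). dist x y < e})"
    by (simp add: uniformity_fsvec_def)
  show "open U \<longleftrightarrow> (\<forall>x\<in>U. \<forall>\<^sub>F (x', y) in uniformity. x' = x \<longrightarrow> y \<in> U)" for U :: "fsvec set"
    by (simp add: open_fsvec_def)
  let ?S = "{i. coord x i \<noteq> 0} \<union> {i. coord y i \<noteq> 0}"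
  have S: "finite ?S" by simp
  show "inner x y = inner y x"
    by (subst (1 2) inner_eq[OF S]) (auto simp: mult.commute)
  have "{i. coord (x + y) i \<noteq> 0} \<subseteq> ?S" by (auto simp: plus_fsvec.rep_eq)
  note xy = inner_eq[OF S this]
  show "inner (x + y) z = inner x z + inner y z"
    by (subst xy, subst (1 2) inner_eq[OF S])
       (auto simp: plus_fsvec.rep_eq distrib_right sum.distrib)
  have "{i. coord (r *\<^sub>R x) i \<noteq> 0} \<subseteq> ?S" by (auto simp: scaleR_fsvec.rep_eq)
  note rx = inner_eq[OF S this]
  show "inner (r *\<^sub>R x) y = r * inner x y"
    by (subst rx, subst inner_eq[OF S])
       (auto simp: scaleR_fsvec.rep_eq sum_distrib_left mult.assoc)
  show "0 \<le> inner x x" by (auto simp: inner_fsvec_def intro!: sum_nonneg)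
  show "inner x x = 0 \<longleftrightarrow> x = 0"
  proof
    assume "inner x x = 0"
    then have "\<forall>i\<in>{i. coord x i \<noteq> 0}. coord x i * coord x i = 0"
      unfolding inner_fsvec_def by (subst (asm) sum_nonneg_eq_0_iff) auto
    then show "x = 0" by transfer auto
  qed (simp add: inner_fsvec_def zero_fsvec.rep_eq)
  show "norm x = sqrt (inner x x)" by (simp add: norm_fsvec_def)
qed

end

definition Rd :: "nat \<Rightarrow> fsvec set" where
  "Rd d = {x. \<forall>i\<ge>d. coord x i = 0}"

lemma inner_Rd: "x \<in> Rd d \<Longrightarrow> inner x y = (\<Sum>i<d. coord x i * coord y i)"
  unfolding inner_fsvec_def Rd_def
  by (intro sum.mono_neutral_left) (auto simp: not_le[symmetric])


definition gradient :: "nat \<Rightarrow> (fsvec \<Rightarrow> real) \<Rightarrow> fsvec \<Rightarrow> fsvec" where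
  "gradient d g x = (THE v. v \<in> Rd d \<and> (g has_derivative (\<lambda>h. v \<bullet> h)) (at x within Rd d))"

(* The components f_1, ..., f_n are  fs 1, ..., fs n;  only their values on  Rd d  matter. *)

definition average :: "nat \<Rightarrow> (nat \<Rightarrow> fsvec \<Rightarrow> real) \<Rightarrow> fsvec \<Rightarrow> real" where
  "average n fs x = (1 / real n) * (\<Sum>i = 1..n. fs i x)"

definition batch_gradient :: "nat \<Rightarrow> (nat \<Rightarrow> fsvec \<Rightarrow> real) \<Rightarrow> nat set \<Rightarrow> fsvec \<Rightarrow> fsvec" where
  "batch_gradient d fs I x = (1 / real (card I)) *\<^sub>R (\<Sum>i\<in>I. gradient d (fs i) x)"

definition A1 :: "nat \<Rightarrow> nat \<Rightarrow> (nat \<Rightarrow> fsvec \<Rightarrow> real) \<Rightarrow> real \<Rightarrow> bool" where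
  "A1 d n fs L \<longleftrightarrow>
     (\<forall>i\<in>{1..n}. fs i differentiable_on Rd d \<and> convex_on (Rd d) (fs i) \<and>
        (\<forall>x\<in>Rd d. \<forall>y\<in>Rd d.
           fs i x - fs i y - gradient d (fs i) y \<bullet> (x - y) \<le> L / 2 * (norm (x - y))\<^sup>2))"

definition A2 :: "nat \<Rightarrow> nat \<Rightarrow> (nat \<Rightarrow> fsvec \<Rightarrow> real) \<Rightarrow> real \<Rightarrow> fsvec \<Rightarrow> bool" where
  "A2 d n fs \<mu> xs \<longleftrightarrow>
     0 \<le> \<mu> \<and> (\<forall>x\<in>Rd d. average n fs x - average n fs xs \<ge> \<mu> / 2 * (norm (x - xs))\<^sup>2)"

definition grad_variance :: "nat \<Rightarrow> nat \<Rightarrow> (nat \<Rightarrow> fsvec \<Rightarrow> real) \<Rightarrow> fsvec \<Rightarrow> real" where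
  "grad_variance d n fs x = (1 / real n) * (\<Sum>i = 1..n. (norm (gradient d (fs i) x))\<^sup>2)"

definition is_minimizer :: "nat \<Rightarrow> nat \<Rightarrow> (nat \<Rightarrow> fsvec \<Rightarrow> real) \<Rightarrow> fsvec \<Rightarrow> bool" where
  "is_minimizer d n fs x \<longleftrightarrow> x \<in> Rd d \<and> (\<forall>y\<in>Rd d. average n fs x \<le> average n fs y)"

definition is_reference_minimizer ::
  "nat \<Rightarrow> nat \<Rightarrow> (nat \<Rightarrow> fsvec \<Rightarrow> real) \<Rightarrow> fsvec \<Rightarrow> bool" where
  "is_reference_minimizer d n fs xs \<longleftrightarrow>
     is_minimizer d n fs xs \<and>
     (\<forall>y. is_minimizer d n fs y \<longrightarrow> grad_variance d n fs xs \<le> grad_variance d n fs y)"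


(*
  SCSG as a probabilistic program: every draw is a monadic bind, which makes it independent of
  everything before it.  Iterates are paired with the accumulated cost.
*)

definition subsets_of_size :: "nat \<Rightarrow> nat \<Rightarrow> nat set set" where
  "subsets_of_size n B = {I. I \<subseteq> {1..n} \<and> card I = B}"

(* x0 and mu are the start point and the anchor gradient of the epoch; the last argument is the
   number of inner steps. *)
primrec scsg_inner ::
  "nat \<Rightarrow> nat \<Rightarrow> (nat \<Rightarrow> fsvec \<Rightarrow> real) \<Rightarrow> real \<Rightarrow> nat \<Rightarrow> fsvec \<Rightarrow> fsvec \<Rightarrow> nat \<Rightarrow> fsvec pmf" where
  "scsg_inner d n fs \<eta> b x0 mu 0 = return_pmf x0"
| "scsg_inner d n fs \<eta> b x0 mu (Suc k) =
     do {
       x \<leftarrow> scsg_inner d n fs \<eta> b x0 mu k;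
       I \<leftarrow> pmf_of_set (subsets_of_size n b);
       return_pmf (x - \<eta> *\<^sub>R (batch_gradient d fs I x - batch_gradient d fs I x0 + mu))
     }"

(* The library's  geometric_pmf p  has mass (1 - p)^k * p at k, i.e. it is Geom(1 - p). *)
definition scsg_epoch ::
  "nat \<Rightarrow> nat \<Rightarrow> (nat \<Rightarrow> fsvec \<Rightarrow> real) \<Rightarrow> real \<Rightarrow> nat \<Rightarrow> real \<Rightarrow> nat \<Rightarrow> fsvec \<Rightarrow> (fsvec \<times> nat) pmf" where
  "scsg_epoch d n fs \<eta> b m B x0 =
     do {
       I \<leftarrow> pmf_of_set (subsets_of_size n B);
       N \<leftarrow> geometric_pmf (1 - m / (m + real b));
       x \<leftarrow> scsg_inner d n fs \<eta> b x0 (batch_gradient d fs I x0) N;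
       return_pmf (x, b * N + B)
     }"

primrec scsg ::
  "nat \<Rightarrow> nat \<Rightarrow> (nat \<Rightarrow> fsvec \<Rightarrow> real) \<Rightarrow> (nat \<Rightarrow> real) \<Rightarrow> (nat \<Rightarrow> nat) \<Rightarrow> (nat \<Rightarrow> real) \<Rightarrow> (nat \<Rightarrow> nat) \<Rightarrow>
   fsvec \<Rightarrow> nat \<Rightarrow> (fsvec \<times> nat) pmf" where
  "scsg d n fs \<eta> b m B x0 0 = return_pmf (x0, 0)"
| "scsg d n fs \<eta> b m B x0 (Suc j) =
     do {
       (x, c) \<leftarrow> scsg d n fs \<eta> b m B x0 j;
       (x', c') \<leftarrow> scsg_epoch d n fs (\<eta> (Suc j)) (b (Suc j)) (m (Suc j)) (B (Suc j)) x;
       return_pmf (x', c + c')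
     }"

(*
  Expectations over the initial law D0 (on  Rd d) and the run.  The integrands are nonnegative, and
  the nonnegative integral avoids the convention that a nonintegrable function has integral 0.
*)

definition expected_gap ::
  "nat \<Rightarrow> nat \<Rightarrow> (nat \<Rightarrow> fsvec \<Rightarrow> real) \<Rightarrow> fsvec \<Rightarrow> (nat \<Rightarrow> real) \<Rightarrow> (nat \<Rightarrow> nat) \<Rightarrow> (nat \<Rightarrow> real) \<Rightarrow> (nat \<Rightarrow> nat) \<Rightarrow>
   fsvec measure \<Rightarrow> nat \<Rightarrow> ennreal" where
  "expected_gap d n fs xs \<eta> b m B D0 T =
     (\<integral>\<^sup>+ x0. \<integral>\<^sup>+ (x, c). ennreal (average n fs x - average n fs xs)
        \<partial>measure_pmf (scsg d n fs \<eta> b m B x0 T) \<partial>D0)"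

definition expected_cost ::
  "nat \<Rightarrow> nat \<Rightarrow> (nat \<Rightarrow> fsvec \<Rightarrow> real) \<Rightarrow> (nat \<Rightarrow> real) \<Rightarrow> (nat \<Rightarrow> nat) \<Rightarrow> (nat \<Rightarrow> real) \<Rightarrow> (nat \<Rightarrow> nat) \<Rightarrow>
   fsvec measure \<Rightarrow> nat \<Rightarrow> ennreal" where
  "expected_cost d n fs \<eta> b m B D0 T =
     (\<integral>\<^sup>+ x0. \<integral>\<^sup>+ (x, c). ennreal (real c)
        \<partial>measure_pmf (scsg d n fs \<eta> b m B x0 T) \<partial>D0)"

(* E C_comp(eps); infinite if no T(eps) exists. *)
definition scsg_complexity ::
  "nat \<Rightarrow> nat \<Rightarrow> (nat \<Rightarrow> fsvec \<Rightarrow> real) \<Rightarrow> fsvec \<Rightarrow> (nat \<Rightarrow> real) \<Rightarrow> (nat \<Rightarrow> nat) \<Rightarrow> (nat \<Rightarrow> real) \<Rightarrow> (nat \<Rightarrow> nat) \<Rightarrow>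
   fsvec measure \<Rightarrow> real \<Rightarrow> ennreal" where
  "scsg_complexity d n fs xs \<eta> b m B D0 \<epsilon> =
     (let reached = (\<lambda>T'. \<forall>T\<ge>T'. expected_gap d n fs xs \<eta> b m B D0 T \<le> ennreal \<epsilon>)
      in if \<exists>T'. reached T' then expected_cost d n fs \<eta> b m B D0 (LEAST T'. reached T') else \<infinity>)"


definition Gam :: "real \<Rightarrow> real \<Rightarrow> real" where
  "Gam \<alpha> \<xi> = 1 / (4 * \<alpha> powr (1 / \<xi>))"

definition star_pow :: "real \<Rightarrow> real \<Rightarrow> real" where
  "star_pow a \<xi> = (max a 1) powr \<xi>"

(* The value of a term in the condition number kappa = L / mu, read as infinity if mu = 0. *)
definition at_kappa :: "real \<Rightarrow> real \<Rightarrow> (real \<Rightarrow> real) \<Rightarrow> ennreal" where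
  "at_kappa L \<mu> t = (if \<mu> = 0 then \<infinity> else ennreal (t (L / \<mu>)))"

definition kterm :: "nat \<Rightarrow> real \<Rightarrow> real \<Rightarrow> real \<Rightarrow> real \<Rightarrow> real" where
  "kterm n D \<epsilon> \<xi> \<kappa> =
     (let \<kappa>' = sqrt (real n) + \<kappa> in \<kappa>' * star_pow (D / (\<epsilon> * \<kappa>')) \<xi>)"

definition rate_A :: "nat \<Rightarrow> real \<Rightarrow> real \<Rightarrow> real \<Rightarrow> real \<Rightarrow> real \<Rightarrow> real \<Rightarrow> ennreal" where
  "rate_A n L \<mu> D\<^sub>x D\<^sub>H \<xi> \<epsilon> =
     (let D = max D\<^sub>x D\<^sub>H in
      Min {ennreal (D / \<epsilon>),
           at_kappa L \<mu> (\<lambda>\<kappa>. \<kappa> * star_pow (D\<^sub>x / (\<epsilon> * \<kappa>)) \<xi> + D\<^sub>H / \<epsilon>),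
           at_kappa L \<mu> (\<lambda>\<kappa>. kterm n D \<epsilon> \<xi> \<kappa>)})"

definition rate_comp :: "nat \<Rightarrow> real \<Rightarrow> real \<Rightarrow> real \<Rightarrow> real \<Rightarrow> real \<Rightarrow> real \<Rightarrow> ennreal" where
  "rate_comp n L \<mu> D\<^sub>x D\<^sub>H \<xi> \<epsilon> =
     (let D = max D\<^sub>x D\<^sub>H in
      Min {ennreal (D\<^sup>2 / \<epsilon>\<^sup>2),
           at_kappa L \<mu> (\<lambda>\<kappa>. D\<^sub>H\<^sup>2 / \<epsilon>\<^sup>2 + \<kappa>\<^sup>2 * star_pow (D\<^sub>x / (\<epsilon> * \<kappa>)) (2 * \<xi>)),
           ennreal (real n + D / \<epsilon>),
           at_kappa L \<mu> (\<lambda>\<kappa>. real n + kterm n D \<epsilon> \<xi> \<kappa>)})"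

(* Factor hidden by soft-O notation: polylogarithmic in n and r = D / eps, at least 1 for
   n \<ge> 1 and r \<ge> 1. *)
definition polylog :: "nat \<Rightarrow> nat \<Rightarrow> real \<Rightarrow> real" where
  "polylog p n r = (1 + ln (real n) + ln r) ^ p"

end

theory Submission
  imports Defs
begin

text \<open>Write \<open>F\<^sub>j\<close> and \<open>X\<^sub>j\<close> for the expected gap and \<open>L\<close> times the expected squared distance to
  the minimizer after epoch \<open>j\<close>. Co-coercivity of the component gradients bounds one inner step; at
  the geometric stopping time the steps telescope, and Young's inequality with a parameter
  \<open>c\<^sub>j\<close> decouples the error of the anchor gradient, giving
  \<open>4/5 \<rho> m\<^sub>j F\<^sub>j + b (1 - c\<^sub>j) X\<^sub>j \<le> b X\<^sub>j\<^sub>-\<^sub>1 + 8/3 \<Gamma> \<rho> m\<^sub>j F\<^sub>j\<^sub>-\<^sub>1 + (K / c\<^sub>j) (2 F\<^sub>j\<^sub>-\<^sub>1 + D\<^sub>H)\<close>,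
  where the last term is absent once \<open>B\<^sub>j = n\<close> and \<open>K\<close> is constant because \<open>m\<^sub>j\<^sup>2 / B\<^sub>j\<close> is.
  Taking \<open>c\<^sub>j = 1 / (j + 1)\<close> costs only polynomial factors in the number of epochs, which is
  logarithmic in \<open>D / \<epsilon>\<close>, and yields \<open>F\<^sub>T = O(T\<^sup>2 D / \<alpha>\<^sup>T)\<close>. Once \<open>\<alpha>\<^sup>j\<close> exceeds a multiple of
  \<open>\<kappa>\<close>, strong convexity turns the recursion into
  \<open>F\<^sub>j \<le> \<alpha>\<^sup>-\<^sup>1\<^sup>/\<^sup>\<xi> F\<^sub>j\<^sub>-\<^sub>1 + noise\<close>, so a further factor \<open>s\<close> in accuracy costs a factor
  \<open>s\<^sup>\<xi>\<close> in \<open>A = \<alpha>\<^sup>T\<close>; the noise is gone when \<open>\<alpha>\<^sup>j\<close> also exceeds a multiple of \<open>\<surd>n\<close>.\<close>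

section \<open>Gradients on finite-dimensional subspaces\<close>

text \<open>The error \<open>mu - full_gradient x0\<close> of the anchor gradient is drawn once per
  epoch, so it is correlated with every later iterate of that epoch and its cross term with the
  distance to the minimizer does not average out. Removing it by Young's inequality with a fixed
  weight would lose a constant factor per epoch, hence a power of \<alpha>^T overall; the weight
  therefore has to decrease. The constants leave a deliberate slack:
  \<open>8/3 * G = 5/6 * (4 * G) * 4/5\<close>, so relative to the contraction factor
  \<open>4 * Gam \<alpha> \<xi>\<close> one sixth stays free to absorb the distance term and the
  part of the noise proportional to the gap. Since \<xi> < 1 this factor is below 1/\<alpha>, so
  leftover noise of order 1/\<alpha>^j is never amplified. Finally, the number of epochs T occurs on
  both sides of each accuracy condition through (T + 1)^2. A dichotomy resolves this: either (T +
  1)^2 is polylogarithmic in D/\<epsilon>, or \<alpha>^T is already so large that the general bound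
  gives accuracy \<epsilon>.\<close>

lemma subspace_Rd: "subspace (Rd d)"
  by (rule subspaceI)
     (auto simp: Rd_def zero_fsvec.rep_eq plus_fsvec.rep_eq scaleR_fsvec.rep_eq)

lemma coord_sum: "coord (sum f A) i = (\<Sum>a\<in>A. coord (f a) i)"
  by (induction A rule: infinite_finite_induct) (simp_all add: zero_fsvec.rep_eq plus_fsvec.rep_eq)

lift_definition unit_vec :: "nat \<Rightarrow> fsvec" is "\<lambda>i j. if j = i then 1 else 0"
  by simp

lemma Rd_expansion: "h \<in> Rd d \<Longrightarrow> h = (\<Sum>i<d. coord h i *\<^sub>R unit_vec i)"
  by (rule coord_inject[THEN iffD1])
     (auto simp: fun_eq_iff coord_sum scaleR_fsvec.rep_eq unit_vec.rep_eq Rd_def if_distrib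
       cong: if_cong)

text \<open>A finite-dimensional Riesz representation: the coordinates of \<open>v\<close> are the
  values of \<open>D\<close> on the unit vectors. The ambient space is not complete, so in general a
  functional is represented only on \<open>Rd d\<close>.\<close>

lemma linear_on_Rd_representation:
  fixes D :: "fsvec \<Rightarrow> real"
  assumes "linear D"
  obtains v where "v \<in> Rd d" "\<And>h. h \<in> Rd d \<Longrightarrow> D h = v \<bullet> h"
proof
  let ?v = "\<Sum>i<d. D (unit_vec i) *\<^sub>R unit_vec i"
  have c: "coord ?v j = (if j < d then D (unit_vec j) else 0)" for j
    by (simp add: coord_sum scaleR_fsvec.rep_eq unit_vec.rep_eq if_distrib cong: if_cong)
  show v: "?v \<in> Rd d" by (simp add: Rd_def c)
  fix h assume h: "h \<in> Rd d"
  have "D h = (\<Sum>i<d. coord h i * D (unit_vec i))"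
    by (subst Rd_expansion[OF h]) (simp add: linear_sum[OF assms] linear_scale[OF assms])
  then show "D h = ?v \<bullet> h" by (simp add: inner_Rd[OF v] c mult.commute)
qed

text \<open>One-sided derivatives along rays in \<open>Rd d\<close> suffice both for uniqueness of
  the gradient and for the tangent inequality.\<close>

lemma directional_derivative:
  fixes f :: "fsvec \<Rightarrow> real"
  assumes f: "(f has_derivative (\<lambda>h. v \<bullet> h)) (at x within Rd d)" and "x \<in> Rd d" "h \<in> Rd d"
  shows "((\<lambda>t. (f (x + t *\<^sub>R h) - f x) / t) \<longlongrightarrow> v \<bullet> h) (at_right 0)"
proof -
  have "((\<lambda>t. x + t *\<^sub>R h) has_derivative (\<lambda>t. t *\<^sub>R h)) (at 0 within {0<..})"
    by (auto intro!: derivative_eq_intros)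
  moreover have "(\<lambda>t. x + t *\<^sub>R h) ` {0<..} \<subseteq> Rd d"
    using assms subspace_Rd[of d] by (auto intro!: subspace_add subspace_scale)
  ultimately have "((\<lambda>t. f (x + t *\<^sub>R h)) has_derivative (\<lambda>t. v \<bullet> (t *\<^sub>R h))) (at 0 within {0<..})"
    using has_derivative_in_compose[of "\<lambda>t. x + t *\<^sub>R h" "\<lambda>t. t *\<^sub>R h" 0 "{0<..}" f "\<lambda>h. v \<bullet> h"]
      has_derivative_subset[OF f] by simp
  then have "((\<lambda>t. f (x + t *\<^sub>R h)) has_field_derivative v \<bullet> h) (at 0 within {0<..})"
    by (rule has_derivative_imp_has_field_derivative) simp
  then show ?thesis by (simp add: has_field_derivative_iff)
qed

text \<open>Shows that the description in \<open>gradient\<close> is well-defined. A derivative may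
  be replaced by an inner product because the difference quotients only see \<open>y - x\<close> in
  \<open>Rd d\<close>; two candidates \<open>v\<close> and \<open>w\<close> agree in the direction
  \<open>w - v\<close>, which again lies in \<open>Rd d\<close>.\<close>

lemma gradient_on_Rd:
  assumes "f differentiable (at x within Rd d)" and x: "x \<in> Rd d"
  shows "gradient d f x \<in> Rd d"
    and "(f has_derivative (\<lambda>h. gradient d f x \<bullet> h)) (at x within Rd d)"
proof -
  obtain D where D: "(f has_derivative D) (at x within Rd d)"
    using assms unfolding differentiable_def by blast
  obtain v where v: "v \<in> Rd d" and Dv: "\<And>h. h \<in> Rd d \<Longrightarrow> D h = v \<bullet> h"
    using linear_on_Rd_representation[OF has_derivative_linear[OF D]] by metis
  have "\<forall>\<^sub>F y in at x within Rd d. (1 / norm (y - x)) *\<^sub>R (f y - (f x + D (y - x)))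
      = (1 / norm (y - x)) *\<^sub>R (f y - (f x + v \<bullet> (y - x)))"
    using Dv subspace_diff[OF subspace_Rd _ x] by (auto simp: eventually_at_filter)
  from tendsto_cong[OF this] have dv: "(f has_derivative (\<lambda>h. v \<bullet> h)) (at x within Rd d)"
    using D by (simp only: has_derivative_within bounded_linear_inner_right simp_thms)
  have "gradient d f x = v" unfolding gradient_def
  proof (rule the_equality)
    fix w assume w: "w \<in> Rd d \<and> (f has_derivative (\<lambda>h. w \<bullet> h)) (at x within Rd d)"
    then have h: "w - v \<in> Rd d" using v subspace_Rd by (auto intro: subspace_diff)
    have "w \<bullet> (w - v) = v \<bullet> (w - v)"
      using directional_derivative[OF _ x h] w dv tendsto_unique[OF trivial_limit_at_right_real]
      by blast
    then have "(w - v) \<bullet> (w - v) = 0" by (simp add: inner_diff_left)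
    then show "w = v" by simp
  qed (use v dv in blast)
  then show "gradient d f x \<in> Rd d"
    and "(f has_derivative (\<lambda>h. gradient d f x \<bullet> h)) (at x within Rd d)"
    using v dv by auto
qed

text \<open>By convexity the slopes from \<open>x\<close> towards \<open>y\<close> stay below
  \<open>f y - f x\<close>, and they converge to the directional derivative.\<close>

lemma convex_above_tangent_on_Rd:
  assumes f: "convex_on (Rd d) f" "(f has_derivative (\<lambda>h. v \<bullet> h)) (at x within Rd d)"
    and x: "x \<in> Rd d" and y: "y \<in> Rd d"
  shows "f x + v \<bullet> (y - x) \<le> f y"
proof -
  have "\<forall>\<^sub>F t in at_right (0::real). t \<in> {0<..<1}"
    by (rule eventually_at_right_real) simp
  then have "\<forall>\<^sub>F t in at_right 0. (f (x + t *\<^sub>R (y - x)) - f x) / t \<le> f y - f x"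
  proof eventually_elim
    case (elim t)
    then have "f ((1 - t) *\<^sub>R x + t *\<^sub>R y) \<le> (1 - t) * f x + t * f y"
      using convex_onD[OF f(1), of t x y] x y by simp
    moreover have "(1 - t) *\<^sub>R x + t *\<^sub>R y = x + t *\<^sub>R (y - x)"
      by (simp add: algebra_simps)
    ultimately show ?case using elim by (simp add: field_simps)
  qed
  then have "v \<bullet> (y - x) \<le> f y - f x"
    using directional_derivative[OF f(2) x subspace_diff[OF subspace_Rd y x]]
    by (intro tendsto_upperbound) auto
  then show ?thesis by simp
qed

text \<open>Two bounds on \<open>f\<close> are compared at one auxiliary point \<open>z\<close> of
  \<open>S\<close>: the tangent at \<open>y\<close> from below, the quadratic model at
  \<open>x\<close> from above.\<close>

lemma smooth_convex_cocoercive: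
  fixes f :: "'a::real_inner \<Rightarrow> real" and g :: "'a \<Rightarrow> 'a"
  assumes S: "subspace S" and L: "0 < L"
    and lower: "\<And>x y. x \<in> S \<Longrightarrow> y \<in> S \<Longrightarrow> f y + g y \<bullet> (x - y) \<le> f x"
    and upper: "\<And>x y. x \<in> S \<Longrightarrow> y \<in> S \<Longrightarrow> f x - f y - g y \<bullet> (x - y) \<le> L / 2 * (norm (x - y))\<^sup>2"
    and g: "\<And>x. x \<in> S \<Longrightarrow> g x \<in> S" and x: "x \<in> S" and y: "y \<in> S"
  shows "f y + g y \<bullet> (x - y) + (norm (g x - g y))\<^sup>2 / (2 * L) \<le> f x"
proof -
  define r where "r = g x - g y"
  \<comment> \<open>This \<open>z\<close> minimizes the quadratic upper model at \<open>x\<close> of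
    \<open>f\<close> with its tangent at \<open>y\<close> subtracted: a gradient step of length
    \<open>1 / L\<close> for that difference.\<close>
  define z where "z = x - (1 / L) *\<^sub>R r"
  have z: "z \<in> S" unfolding z_def r_def using S x y g by (intro subspace_diff subspace_scale) auto
  have zx: "z - x = - (1 / L) *\<^sub>R r" by (simp add: z_def)
  have "f y + g y \<bullet> (z - y) \<le> f z" by (rule lower[OF z y])
  moreover have "f z - f x - g x \<bullet> (z - x) \<le> L / 2 * (norm (z - x))\<^sup>2" by (rule upper[OF z x])
  moreover have "L / 2 * (norm (z - x))\<^sup>2 = (norm r)\<^sup>2 / (2 * L)"
    using L by (simp add: zx power_mult_distrib power_divide power2_eq_square field_simps)
  moreover have "g x \<bullet> (z - x) - g y \<bullet> (z - x) = - (norm r)\<^sup>2 / L"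
    unfolding inner_diff_left[symmetric] r_def[symmetric] zx by (simp add: power2_norm_eq_inner)
  moreover have "g y \<bullet> (z - y) = g y \<bullet> (z - x) + g y \<bullet> (x - y)" by (simp add: inner_diff_right)
  moreover have "(norm r)\<^sup>2 / L = 2 * ((norm r)\<^sup>2 / (2 * L))" by simp
  ultimately show ?thesis unfolding r_def[symmetric] by linarith
qed

section \<open>Sampling without replacement\<close>

lemma finite_subsets_of_size: "finite (subsets_of_size n B)"
  unfolding subsets_of_size_def by simp

lemma card_subsets_of_size: "card (subsets_of_size n B) = n choose B"
  unfolding subsets_of_size_def using n_subsets[of "{1..n}" B] by simp

lemma subsets_of_size_nonempty: "B \<le> n \<Longrightarrow> subsets_of_size n B \<noteq> {}"
  using card_subsets_of_size[of n B] by (auto simp: zero_less_binomial_iff)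

text \<open>Removing \<open>J\<close> is a bijection onto the subsets of the complement with
  \<open>B - card J\<close> elements. Singletons and pairs \<open>J\<close> serve the diagonal and
  off-diagonal terms of the variance.\<close>

lemma card_subsets_containing:
  assumes "J \<subseteq> {1..n}" "card J \<le> B"
  shows "card {I \<in> subsets_of_size n B. J \<subseteq> I} = (n - card J) choose (B - card J)"
proof -
  have J: "finite J" using assms finite_subset by blast
  have "bij_betw (\<lambda>I. I - J) {I \<in> subsets_of_size n B. J \<subseteq> I}
          {K. K \<subseteq> {1..n} - J \<and> card K = B - card J}"
  proof (rule bij_betw_byWitness[where f' = "\<lambda>K. K \<union> J"])
    show "(\<lambda>I. I - J) ` {I \<in> subsets_of_size n B. J \<subseteq> I} \<subseteq> {K. K \<subseteq> {1..n} - J \<and> card K = B - card J}"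
      using J by (auto simp: subsets_of_size_def card_Diff_subset)
    show "(\<lambda>K. K \<union> J) ` {K. K \<subseteq> {1..n} - J \<and> card K = B - card J}
        \<subseteq> {I \<in> subsets_of_size n B. J \<subseteq> I}"
    proof safe
      fix K assume K: "K \<subseteq> {1..n} - J" "card K = B - card J"
      then have "finite K" using finite_subset by blast
      then have "card (K \<union> J) = B" using K assms J by (subst card_Un_disjoint) auto
      then show "K \<union> J \<in> subsets_of_size n B" using K assms by (auto simp: subsets_of_size_def)
    qed
  qed auto
  then have "card {I \<in> subsets_of_size n B. J \<subseteq> I} = card {K. K \<subseteq> {1..n} - J \<and> card K = B - card J}"
    by (rule bij_betw_same_card)
  also have "\<dots> = card ({1..n} - J) choose (B - card J)" by (rule n_subsets) simp
  also have "card ({1..n} - J) = n - card J" using assms J by (simp add: card_Diff_subset)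
  finally show ?thesis .
qed

text \<open>Double counting: each index lies in \<open>(n - 1) choose (B - 1)\<close>
  samples.\<close>

lemma sum_subsets_of_size:
  fixes a :: "nat \<Rightarrow> 'a::real_vector"
  assumes "1 \<le> B"
  shows "(\<Sum>I\<in>subsets_of_size n B. \<Sum>i\<in>I. a i) = real ((n - 1) choose (B - 1)) *\<^sub>R (\<Sum>i=1..n. a i)"
proof -
  have "(\<Sum>I\<in>subsets_of_size n B. \<Sum>i\<in>I. a i) = (\<Sum>I\<in>subsets_of_size n B. \<Sum>i\<in>{i \<in> {1..n}. i \<in> I}. a i)"
    by (intro sum.cong) (auto simp: subsets_of_size_def)
  also have "\<dots> = (\<Sum>i=1..n. \<Sum>I\<in>{I \<in> subsets_of_size n B. i \<in> I}. a i)"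
    by (rule sum.swap_restrict) (simp_all add: finite_subsets_of_size)
  also have "\<dots> = (\<Sum>i=1..n. real ((n - 1) choose (B - 1)) *\<^sub>R a i)"
    using card_subsets_containing[of "{_}" n B] assms
    by (intro sum.cong refl) (simp add: sum_constant_scaleR del: sum_constant)
  finally show ?thesis by (simp add: scaleR_sum_right)
qed

lemma binomial_ratio:
  assumes "1 \<le> B" "B \<le> n"
  shows "real ((n - 1) choose (B - 1)) / real (n choose B) = real B / real n"
proof -
  have "B * (n choose B) = n * ((n - 1) choose (B - 1))"
    using assms binomial_absorption[of "B - 1" n] by simp
  then have "real B * real (n choose B) = real n * real ((n - 1) choose (B - 1))"
    by (metis of_nat_mult)
  moreover have "0 < n choose B" using assms by simp
  ultimately show ?thesis using assms by (simp add: field_simps)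
qed

lemma sample_mean_expectation:
  fixes a :: "nat \<Rightarrow> 'a::real_vector"
  assumes "1 \<le> B" "B \<le> n"
  shows "(1 / real (card (subsets_of_size n B))) *\<^sub>R
           (\<Sum>I\<in>subsets_of_size n B. (1 / real B) *\<^sub>R (\<Sum>i\<in>I. a i)) = (1 / real n) *\<^sub>R (\<Sum>i=1..n. a i)"
proof -
  have "real ((n - 1) choose (B - 1)) / real (n choose B) / real B = 1 / real n"
    using assms by (simp only: binomial_ratio) (simp add: field_simps)
  then show ?thesis
    by (simp add: scaleR_sum_right[symmetric] sum_subsets_of_size[OF assms(1)] card_subsets_of_size
        field_simps)
qed

text \<open>The bias-variance identity. It serves both to replace centred second moments by raw ones
  and to bound the squared norm of a mean by the mean of squared norms.\<close>

lemma sum_norm_sq_deviation: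
  fixes a :: "nat \<Rightarrow> 'a::real_inner"
  assumes "finite A" and m: "real (card A) *\<^sub>R m = (\<Sum>i\<in>A. a i)"
  shows "(\<Sum>i\<in>A. (norm (a i - m))\<^sup>2) = (\<Sum>i\<in>A. (norm (a i))\<^sup>2) - real (card A) * (norm m)\<^sup>2"
proof -
  have "(norm (a i - m))\<^sup>2 = (norm (a i))\<^sup>2 - 2 * (a i \<bullet> m) + (norm m)\<^sup>2" for i
    by (simp add: power2_norm_eq_inner inner_diff_left inner_diff_right inner_commute)
  then have "(\<Sum>i\<in>A. (norm (a i - m))\<^sup>2)
      = (\<Sum>i\<in>A. (norm (a i))\<^sup>2) - 2 * ((\<Sum>i\<in>A. a i) \<bullet> m) + real (card A) * (norm m)\<^sup>2"
    by (simp add: sum.distrib sum_subtractf sum_distrib_left inner_sum_left)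
  then show ?thesis unfolding m[symmetric] by (simp add: power2_norm_eq_inner)
qed

text \<open>Drawing without replacement is negatively correlated: for a centred family the cross terms
  sum to a negative multiple of the diagonal ones and can be dropped.\<close>

lemma sum_subsets_norm_sq_centred:
  fixes c :: "nat \<Rightarrow> 'a::real_inner"
  assumes B: "1 \<le> B" and c: "(\<Sum>i=1..n. c i) = 0"
  shows "(\<Sum>I\<in>subsets_of_size n B. (norm (\<Sum>i\<in>I. c i))\<^sup>2)
           \<le> real ((n - 1) choose (B - 1)) * (\<Sum>i=1..n. (norm (c i))\<^sup>2)"
proof -
  \<comment> \<open>\<open>p\<close> and \<open>q\<close> count the samples that contain a given
    index and a given pair. For \<open>B = 1\<close> truncated subtraction would give
    \<open>(n - 2) choose 0 = 1\<close>, although no sample contains a pair.\<close>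
  define q where "q = (if B = 1 then 0 else real ((n - 2) choose (B - 2)))"
  define p where "p = real ((n - 1) choose (B - 1))"
  have cnt: "real (card {I \<in> subsets_of_size n B. i \<in> I \<and> j \<in> I}) = (if i = j then p else q)"
    if "i \<in> {1..n}" "j \<in> {1..n}" for i j
  proof (cases "i = j")
    case True
    then show ?thesis using card_subsets_containing[of "{i}" n B] that B by (simp add: p_def)
  next
    case False
    show ?thesis
    proof (cases "B = 1")
      case True
      have "{I \<in> subsets_of_size n B. i \<in> I \<and> j \<in> I} = {}"
        using False True by (auto simp: subsets_of_size_def card_1_singleton_iff)
      then show ?thesis using True False by (simp only: q_def) simp
    next
      case B1: False
      then show ?thesis using card_subsets_containing[of "{i, j}" n B] that B False
        by (simp add: q_def numeral_2_eq_2)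
    qed
  qed
  have "(\<Sum>I\<in>subsets_of_size n B. (norm (\<Sum>i\<in>I. c i))\<^sup>2)
      = (\<Sum>I\<in>subsets_of_size n B. \<Sum>i=1..n. \<Sum>j=1..n. if i \<in> I \<and> j \<in> I then c i \<bullet> c j else 0)"
  proof (intro sum.cong refl)
    fix I assume "I \<in> subsets_of_size n B"
    then have I: "{1..n} \<inter> I = I" by (auto simp: subsets_of_size_def)
    have "(norm (\<Sum>i\<in>I. c i))\<^sup>2 = (\<Sum>i\<in>I. \<Sum>j\<in>I. c i \<bullet> c j)"
      unfolding power2_norm_eq_inner inner_sum_left inner_sum_right by (rule sum.swap)
    also have "\<dots> = (\<Sum>i=1..n. if i \<in> I then (\<Sum>j=1..n. if j \<in> I then c i \<bullet> c j else 0) else 0)"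
      by (simp add: sum.If_cases I[simplified])
    also have "\<dots> = (\<Sum>i=1..n. \<Sum>j=1..n. if i \<in> I \<and> j \<in> I then c i \<bullet> c j else 0)"
      by (intro sum.cong) auto
    finally show "(norm (\<Sum>i\<in>I. c i))\<^sup>2 = \<dots>" .
  qed
  also have "\<dots> = (\<Sum>i=1..n. \<Sum>j=1..n. \<Sum>I\<in>subsets_of_size n B. if i \<in> I \<and> j \<in> I then c i \<bullet> c j else 0)"
    by (subst sum.swap, rule sum.cong[OF refl], rule sum.swap)
  also have "\<dots> = (\<Sum>i=1..n. \<Sum>j=1..n. (if i = j then p else q) * (c i \<bullet> c j))"
    by (intro sum.cong refl)
       (subst sum.inter_filter[symmetric], simp_all add: finite_subsets_of_size cnt)
  \<comment> \<open>Weight \<open>q\<close> on all pairs and \<open>p - q\<close> on the diagonal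
    isolates the squared norm of the total, which is zero.\<close>
  also have "\<dots> = (\<Sum>i=1..n. \<Sum>j=1..n. q * (c i \<bullet> c j) + (if i = j then (p - q) * (c i \<bullet> c j) else 0))"
    by (intro sum.cong refl) (auto simp: algebra_simps)
  also have "\<dots> = q * ((\<Sum>i=1..n. c i) \<bullet> (\<Sum>i=1..n. c i)) + (p - q) * (\<Sum>i=1..n. (norm (c i))\<^sup>2)"
    by (simp add: sum.distrib inner_sum_left inner_sum_right sum_distrib_left power2_norm_eq_inner)
       (rule sum.swap)
  also have "\<dots> \<le> p * (\<Sum>i=1..n. (norm (c i))\<^sup>2)"
    unfolding c by (simp add: q_def left_diff_distrib sum_nonneg)
  finally show ?thesis unfolding p_def .
qed

text \<open>The cross terms of the centred family are dropped, then its second moment is bounded by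
  the uncentred one; \<open>binomial_ratio\<close> divided by the square of \<open>B\<close> leaves
  the factor \<open>1 / real B\<close>.\<close>

lemma sample_mean_variance:
  fixes a :: "nat \<Rightarrow> 'a::real_inner"
  assumes B: "1 \<le> B" "B \<le> n" and m: "m = (1 / real n) *\<^sub>R (\<Sum>i=1..n. a i)"
  shows "(\<Sum>I\<in>subsets_of_size n B. (norm ((1 / real B) *\<^sub>R (\<Sum>i\<in>I. a i) - m))\<^sup>2)
           / real (card (subsets_of_size n B)) \<le> (1 / real B) * ((1 / real n) * (\<Sum>i=1..n. (norm (a i))\<^sup>2))"
proof -
  have nm: "real (card {1..n}) *\<^sub>R m = (\<Sum>i=1..n. a i)" using B m by simp
  have I: "(1 / real B) *\<^sub>R (\<Sum>i\<in>I. a i) - m = (1 / real B) *\<^sub>R (\<Sum>i\<in>I. a i - m)"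
    if "I \<in> subsets_of_size n B" for I
  proof -
    have "(\<Sum>i\<in>I. a i - m) = (\<Sum>i\<in>I. a i) - real B *\<^sub>R m"
      using that by (simp add: sum_subtractf subsets_of_size_def sum_constant_scaleR del: sum_constant)
    then show ?thesis using B by (simp add: scaleR_right_diff_distrib)
  qed
  have z: "(\<Sum>i=1..n. a i - m) = 0"
    using nm by (simp add: sum_subtractf sum_constant_scaleR del: sum_constant)
  have "(\<Sum>I\<in>subsets_of_size n B. (norm ((1 / real B) *\<^sub>R (\<Sum>i\<in>I. a i) - m))\<^sup>2)
      = (\<Sum>I\<in>subsets_of_size n B. (norm (\<Sum>i\<in>I. a i - m))\<^sup>2) / (real B)\<^sup>2"
    unfolding sum_divide_distrib by (intro sum.cong refl) (simp add: I power_divide)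
  also have "\<dots> \<le> real ((n - 1) choose (B - 1)) * (\<Sum>i=1..n. (norm (a i - m))\<^sup>2) / (real B)\<^sup>2"
    by (intro divide_right_mono sum_subsets_norm_sq_centred[OF B(1) z]) simp
  also have "\<dots> \<le> real ((n - 1) choose (B - 1)) * (\<Sum>i=1..n. (norm (a i))\<^sup>2) / (real B)\<^sup>2"
    using sum_norm_sq_deviation[OF _ nm] by (intro divide_right_mono mult_left_mono) auto
  finally have le: "(\<Sum>I\<in>subsets_of_size n B. (norm ((1 / real B) *\<^sub>R (\<Sum>i\<in>I. a i) - m))\<^sup>2)
      \<le> \<dots>" .
  have "(\<Sum>I\<in>subsets_of_size n B. (norm ((1 / real B) *\<^sub>R (\<Sum>i\<in>I. a i) - m))\<^sup>2)
      / real (card (subsets_of_size n B))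
    \<le> real ((n - 1) choose (B - 1)) / real (n choose B) * (\<Sum>i=1..n. (norm (a i))\<^sup>2) / (real B)\<^sup>2"
    using divide_right_mono[OF le, of "real (n choose B)"] by (simp add: card_subsets_of_size mult.commute)
  also have "\<dots> = (1 / real B) * ((1 / real n) * (\<Sum>i=1..n. (norm (a i))\<^sup>2))"
    unfolding binomial_ratio[OF B] using B by (simp add: power2_eq_square)
  finally show ?thesis .
qed

section \<open>One epoch\<close>

lemma norm_sq_Young:
  fixes x y :: "'a::real_inner"
  assumes "0 < t"
  shows "(norm (x + y))\<^sup>2 \<le> (1 + t) * (norm x)\<^sup>2 + (1 + 1 / t) * (norm y)\<^sup>2"
proof -
  have "0 \<le> (norm (sqrt t *\<^sub>R x - (1 / sqrt t) *\<^sub>R y))\<^sup>2" by simp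
  also have "\<dots> = t * (norm x)\<^sup>2 - 2 * (x \<bullet> y) + (norm y)\<^sup>2 / t"
    using assms by (simp add: power2_norm_eq_inner inner_diff_left inner_diff_right inner_commute
        power2_eq_square[symmetric] field_simps)
  finally show ?thesis
    by (simp add: power2_norm_eq_inner inner_add_left inner_add_right inner_commute algebra_simps)
qed

text \<open>Abel summation turns the one-step recursion into a bound at a geometric stopping time.
  Working with truncated sums, no integrability of \<open>U\<close> has to be known beforehand.\<close>

lemma geometric_stopping_bound:
  fixes U F :: "nat \<Rightarrow> real"
  assumes \<theta>: "0 < \<theta>" and c: "0 \<le> c" "c \<le> 1" and a: "0 \<le> a"
    and U: "\<And>k. 0 \<le> U k" and F: "\<And>k. 0 \<le> F k"
    and step: "\<And>k. U (Suc k) \<le> (1 + c * \<theta>) * U k - a * F k + W"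
  shows "(\<integral>\<^sup>+k. ennreal (a * F k + \<theta> * (1 - c) * U k) \<partial>measure_pmf (geometric_pmf (\<theta> / (1 + \<theta>))))
           \<le> ennreal (\<theta> * U 0 + W)"
proof -
  \<comment> \<open>The probability of taking another step. The identity
    \<open>\<gamma> * (1 + \<theta>) = 1\<close> makes consecutive terms of the weighted recursion
    cancel.\<close>
  define \<gamma> where "\<gamma> = 1 / (1 + \<theta>)"
  have g: "0 < \<gamma>" "\<gamma> < 1" using \<theta> by (auto simp: \<gamma>_def)
  have p: "\<theta> / (1 + \<theta>) = 1 - \<gamma>" using \<theta> by (simp add: \<gamma>_def field_simps)
  have gt: "\<gamma> * (1 + \<theta>) = 1" "1 - \<gamma> = \<gamma> * \<theta>" using \<theta> by (simp_all add: \<gamma>_def field_simps)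
  define h where "h k = a * F k + \<theta> * (1 - c) * U k" for k
  have h0: "0 \<le> h k" for k using \<theta> c a U F by (simp add: h_def)
  have part: "(\<Sum>k<K. \<gamma> ^ k * (1 - \<gamma>) * h k) \<le> \<theta> * U 0 - \<theta> * \<gamma> ^ K * U K + (1 - \<gamma> ^ K) * W" for K
  proof (induction K)
    case (Suc K)
    have "h K \<le> (1 + \<theta>) * U K - U (Suc K) + W" using step[of K] by (simp add: h_def algebra_simps)
    then have "\<gamma> ^ K * (1 - \<gamma>) * h K \<le> \<gamma> ^ K * (1 - \<gamma>) * ((1 + \<theta>) * U K - U (Suc K) + W)"
      using g by (intro mult_left_mono) auto
    also have "\<dots> = \<theta> * \<gamma> ^ K * (\<gamma> * (1 + \<theta>)) * U K - \<theta> * \<gamma> ^ Suc K * U (Suc K) + (\<gamma> ^ K - \<gamma> ^ Suc K) * W"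
    proof -
      have "\<gamma> ^ K * (1 - \<gamma>) * ((1 + \<theta>) * U K - U (Suc K))
          = \<gamma> ^ K * (\<gamma> * \<theta>) * ((1 + \<theta>) * U K - U (Suc K))"
        by (simp only: gt(2))
      then show ?thesis by (simp add: algebra_simps)
    qed
    also have "\<dots> = \<theta> * \<gamma> ^ K * U K - \<theta> * \<gamma> ^ Suc K * U (Suc K) + (\<gamma> ^ K * W - \<gamma> ^ Suc K * W)"
      by (simp only: gt(1) mult_1_right left_diff_distrib)
    finally show ?case using Suc.IH unfolding sum.lessThan_Suc left_diff_distrib by linarith
  qed simp
  \<comment> \<open>\<open>W\<close> may be negative, so \<open>(1 - \<gamma> ^ K) * W\<close> is
    not bounded by \<open>W\<close> directly. The partial sum up to \<open>K\<close> is instead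
    compared with later ones, and the limit is taken in those.\<close>
  have lim: "(\<lambda>K. \<theta> * U 0 + (1 - \<gamma> ^ K) * W) \<longlonglongrightarrow> \<theta> * U 0 + (1 - 0) * W"
    using g by (intro tendsto_intros LIMSEQ_power_zero) auto
  have part': "(\<Sum>k<K. \<gamma> ^ k * (1 - \<gamma>) * h k) \<le> \<theta> * U 0 + W" for K
  proof (rule tendsto_lowerbound[OF lim[simplified]])
    show "\<forall>\<^sub>F K' in sequentially. (\<Sum>k<K. \<gamma> ^ k * (1 - \<gamma>) * h k) \<le> \<theta> * U 0 + (1 - \<gamma> ^ K') * W"
      using eventually_ge_at_top[of K]
    proof eventually_elim
      case (elim K')
      have "(\<Sum>k<K. \<gamma> ^ k * (1 - \<gamma>) * h k) \<le> (\<Sum>k<K'. \<gamma> ^ k * (1 - \<gamma>) * h k)"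
        using elim g h0 by (intro sum_mono2) auto
      moreover have "0 \<le> \<theta> * \<gamma> ^ K' * U K'" using \<theta> g U by simp
      ultimately show ?case using part[of K'] by linarith
    qed
  qed simp
  have "(\<integral>\<^sup>+k. ennreal (h k) \<partial>measure_pmf (geometric_pmf (1 - \<gamma>)))
      = (\<Sum>k. ennreal (\<gamma> ^ k * (1 - \<gamma>) * h k))"
    using g h0 by (simp add: nn_integral_measure_pmf nn_integral_count_space_nat ennreal_mult')
  also have "\<dots> \<le> ennreal (\<theta> * U 0 + W)"
  proof (rule suminf_le_const)
    fix K
    have "(\<Sum>k<K. ennreal (\<gamma> ^ k * (1 - \<gamma>) * h k)) = ennreal (\<Sum>k<K. \<gamma> ^ k * (1 - \<gamma>) * h k)"
      using g h0 by (intro sum_ennreal) auto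
    then show "(\<Sum>k<K. ennreal (\<gamma> ^ k * (1 - \<gamma>) * h k)) \<le> ennreal (\<theta> * U 0 + W)"
      using part'[of K] by (simp add: ennreal_leI)
  qed simp
  finally show ?thesis unfolding h_def p .
qed

section \<open>Convexity and smoothness of the finite sum, and one inner step\<close>

locale finite_sum_problem =
  fixes d n :: nat and fs :: "nat \<Rightarrow> fsvec \<Rightarrow> real" and L :: real and xs :: fsvec
  assumes L: "0 < L" and n: "1 \<le> n" and A1: "A1 d n fs L" and minimizer: "is_minimizer d n fs xs"
begin

definition gap :: "fsvec \<Rightarrow> real" where
  "gap x = average n fs x - average n fs xs"

definition full_gradient :: "fsvec \<Rightarrow> fsvec" where
  "full_gradient x = (1 / real n) *\<^sub>R (\<Sum>i=1..n. gradient d (fs i) x)"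

text \<open>The quantity that co-coercivity bounds by the gap. The variances of the analysis reduce
  to it, up to \<open>grad_variance\<close> at the minimizer.\<close>

definition dispersion :: "fsvec \<Rightarrow> real" where
  "dispersion x = (1 / real n) * (\<Sum>i=1..n. (norm (gradient d (fs i) x - gradient d (fs i) xs))\<^sup>2)"

lemma xs: "xs \<in> Rd d"
  using minimizer by (simp add: is_minimizer_def)

lemma gap_nonneg: "x \<in> Rd d \<Longrightarrow> 0 \<le> gap x"
  using minimizer by (simp add: is_minimizer_def gap_def)

lemma gradient_Rd: "i \<in> {1..n} \<Longrightarrow> x \<in> Rd d \<Longrightarrow> gradient d (fs i) x \<in> Rd d"
  using A1 gradient_on_Rd(1) unfolding A1_def differentiable_on_def by blast

lemma full_gradient_Rd: "x \<in> Rd d \<Longrightarrow> full_gradient x \<in> Rd d"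
  unfolding full_gradient_def using subspace_Rd
  by (intro subspace_scale subspace_sum) (auto intro: gradient_Rd)

lemma batch_gradient_Rd: "x \<in> Rd d \<Longrightarrow> I \<subseteq> {1..n} \<Longrightarrow> batch_gradient d fs I x \<in> Rd d"
  unfolding batch_gradient_def using subspace_Rd
  by (intro subspace_scale subspace_sum) (auto intro!: gradient_Rd)

lemma component_lower:
  assumes "i \<in> {1..n}" "x \<in> Rd d" "y \<in> Rd d"
  shows "fs i y + gradient d (fs i) y \<bullet> (x - y) \<le> fs i x"
  using A1 assms convex_above_tangent_on_Rd[OF _ gradient_on_Rd(2)]
  unfolding A1_def differentiable_on_def by blast

lemma component_upper:
  assumes "i \<in> {1..n}" "x \<in> Rd d" "y \<in> Rd d"
  shows "fs i x - fs i y - gradient d (fs i) y \<bullet> (x - y) \<le> L / 2 * (norm (x - y))\<^sup>2"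
  using A1 assms unfolding A1_def by blast

lemma component_cocoercive:
  assumes "i \<in> {1..n}" "x \<in> Rd d" "y \<in> Rd d"
  shows "fs i y + gradient d (fs i) y \<bullet> (x - y)
      + (norm (gradient d (fs i) x - gradient d (fs i) y))\<^sup>2 / (2 * L) \<le> fs i x"
  by (rule smooth_convex_cocoercive[OF subspace_Rd L])
     (use assms component_lower component_upper gradient_Rd in blast)+

lemma average_upper:
  assumes "x \<in> Rd d" "y \<in> Rd d"
  shows "average n fs x \<le> average n fs y + full_gradient y \<bullet> (x - y) + L / 2 * (norm (x - y))\<^sup>2"
proof -
  have "(\<Sum>i=1..n. fs i x) \<le> (\<Sum>i=1..n. fs i y + gradient d (fs i) y \<bullet> (x - y) + L / 2 * (norm (x - y))\<^sup>2)"
  proof (rule sum_mono)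
    fix i assume "i \<in> {1..n}"
    from component_upper[OF this assms]
    show "fs i x \<le> fs i y + gradient d (fs i) y \<bullet> (x - y) + L / 2 * (norm (x - y))\<^sup>2" by linarith
  qed
  also have "\<dots> = (\<Sum>i=1..n. fs i y) + (\<Sum>i=1..n. gradient d (fs i) y) \<bullet> (x - y) + real n * (L / 2 * (norm (x - y))\<^sup>2)"
    by (simp add: sum.distrib inner_sum_left)
  finally show ?thesis using n unfolding average_def full_gradient_def by (simp add: field_simps)
qed

lemma average_cocoercive:
  assumes "x \<in> Rd d" "y \<in> Rd d"
  shows "average n fs y + full_gradient y \<bullet> (x - y)
    + (1 / real n) * (\<Sum>i=1..n. (norm (gradient d (fs i) x - gradient d (fs i) y))\<^sup>2) / (2 * L)
      \<le> average n fs x"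
proof -
  have "(\<Sum>i=1..n. fs i y + gradient d (fs i) y \<bullet> (x - y)
      + (norm (gradient d (fs i) x - gradient d (fs i) y))\<^sup>2 / (2 * L)) \<le> (\<Sum>i=1..n. fs i x)"
    by (intro sum_mono component_cocoercive assms)
  then have "(1 / real n) * ((\<Sum>i=1..n. fs i y) + (\<Sum>i=1..n. gradient d (fs i) y) \<bullet> (x - y)
      + (\<Sum>i=1..n. (norm (gradient d (fs i) x - gradient d (fs i) y))\<^sup>2) / (2 * L))
      \<le> (1 / real n) * (\<Sum>i=1..n. fs i x)"
    by (intro mult_left_mono) (simp_all add: sum.distrib inner_sum_left sum_divide_distrib)
  then show ?thesis unfolding average_def full_gradient_def by (simp add: distrib_left)
qed

text \<open>A gradient step of length \<open>1 / L\<close> from a minimizer would lower the average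
  by at least \<open>q / 2\<close>, so \<open>q\<close> cannot be positive.\<close>

lemma full_gradient_xs: "full_gradient xs = 0"
proof -
  let ?g = "full_gradient xs"
  define y where "y = xs - (1 / L) *\<^sub>R ?g"
  have y: "y \<in> Rd d" unfolding y_def
    using xs subspace_Rd by (intro subspace_diff subspace_scale full_gradient_Rd) auto
  define q where "q = (norm ?g)\<^sup>2 / L"
  have "?g \<bullet> (y - xs) = - q" by (simp add: q_def y_def power2_norm_eq_inner)
  moreover have "L / 2 * (norm (y - xs))\<^sup>2 = q / 2"
    using L by (simp add: q_def y_def power_divide power2_eq_square)
  ultimately have "q \<le> 0"
    using average_upper[OF y xs] gap_nonneg[OF y] unfolding gap_def by linarith
  then have "(norm ?g)\<^sup>2 \<le> 0" using L by (simp add: q_def divide_le_0_iff)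
  then show ?thesis by simp
qed

lemma gap_le: "x \<in> Rd d \<Longrightarrow> gap x \<le> L / 2 * (norm (x - xs))\<^sup>2"
  using average_upper[of x xs] xs full_gradient_xs by (simp add: gap_def)

text \<open>Co-coercivity with base point \<open>xs\<close>, where the linear term vanishes.\<close>

lemma dispersion_le:
  assumes "x \<in> Rd d"
  shows "dispersion x \<le> 2 * L * gap x"
proof -
  have "dispersion x / (2 * L) \<le> gap x"
    using average_cocoercive[OF assms xs] full_gradient_xs by (simp add: gap_def dispersion_def)
  then show ?thesis using L by (simp add: pos_divide_le_eq mult.commute)
qed

text \<open>Co-coercivity with base point \<open>x\<close>, evaluated at \<open>xs\<close>. The
  dispersion gained over plain convexity later cancels the sampling variance.\<close>

lemma gap_plus_dispersion_le:
  assumes "x \<in> Rd d"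
  shows "gap x + dispersion x / (2 * L) \<le> full_gradient x \<bullet> (x - xs)"
proof -
  have "full_gradient x \<bullet> (xs - x) = - (full_gradient x \<bullet> (x - xs))" by (simp add: inner_diff_right)
  then show ?thesis using average_cocoercive[OF xs assms]
    by (simp add: gap_def dispersion_def norm_minus_commute)
qed

text \<open>The component gradients at \<open>xs\<close> sum to zero, so
  \<open>full_gradient x\<close> is the mean of the differences \<open>?a\<close>, and the squared
  norm of a mean is at most the mean of the squared norms.\<close>

lemma norm_full_gradient_le: "(norm (full_gradient x))\<^sup>2 \<le> dispersion x"
proof -
  let ?a = "\<lambda>i. gradient d (fs i) x - gradient d (fs i) xs"
  have "(\<Sum>i=1..n. gradient d (fs i) xs) = 0"
    using full_gradient_xs n by (simp add: full_gradient_def)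
  then have m: "real (card {1..n}) *\<^sub>R full_gradient x = (\<Sum>i=1..n. ?a i)"
    using n by (simp add: sum_subtractf full_gradient_def)
  have "0 \<le> (\<Sum>i=1..n. (norm (?a i - full_gradient x))\<^sup>2)" by (simp add: sum_nonneg)
  then have "real n * (norm (full_gradient x))\<^sup>2 \<le> (\<Sum>i=1..n. (norm (?a i))\<^sup>2)"
    using sum_norm_sq_deviation[OF _ m] by simp
  then show ?thesis using n by (simp add: dispersion_def field_simps)
qed

text \<open>The budget of a step: co-coercivity yields \<open>- 2 * \<eta> * gap x\<close> and
  \<open>- \<eta> / L * dispersion x\<close>. The dispersion pays for the part of the sampling
  variance due to \<open>x\<close>, and the squared mean direction takes back
  \<open>6 / 5 * \<eta> * gap x\<close>, which leaves \<open>4 / 5\<close>. The sampling fluctuation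
  \<open>D I\<close> has mean zero; the anchor error \<open>e\<close> is fixed here, so its cross
  term must be split by Young's inequality with weight \<delta>.\<close>

lemma inner_step:
  assumes x: "x \<in> Rd d" and x0: "x0 \<in> Rd d" and b: "1 \<le> b" "b \<le> n" and \<eta>: "0 < \<eta>"
    and small: "4 * (\<eta> * L) \<le> real b" "2 * (\<eta> * L) \<le> 1" and \<delta>: "0 < \<delta>"
  shows "(\<Sum>I\<in>subsets_of_size n b.
            (norm (x - \<eta> *\<^sub>R (batch_gradient d fs I x - batch_gradient d fs I x0 + mu) - xs))\<^sup>2)
            / real (card (subsets_of_size n b))
    \<le> (1 + \<delta>) * (norm (x - xs))\<^sup>2 - (4 / 5 * \<eta>) * gap x
       + ((\<eta>\<^sup>2 / \<delta> + 6 * \<eta>\<^sup>2) * (norm (mu - full_gradient x0))\<^sup>2 + 8 / 3 * \<eta> * (\<eta> * L / real b) * gap x0)"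
proof -
  let ?S = "subsets_of_size n b"
  let ?N = "real (card ?S)"
  have N: "0 < ?N" using subsets_of_size_nonempty[OF b(2)] finite_subsets_of_size by (simp add: card_gt_0_iff)
  define a where "a i = gradient d (fs i) x - gradient d (fs i) x0" for i
  define m where "m = full_gradient x - full_gradient x0"
  have ma: "m = (1 / real n) *\<^sub>R (\<Sum>i=1..n. a i)"
    by (simp add: m_def a_def full_gradient_def sum_subtractf scaleR_right_diff_distrib)
  define D where "D I = (1 / real b) *\<^sub>R (\<Sum>i\<in>I. a i) - m" for I
  define e where "e = mu - full_gradient x0"
  define y where "y = x - xs"
  define w where "w = full_gradient x + e"
  have D: "batch_gradient d fs I x - batch_gradient d fs I x0 + mu = D I + w" if "I \<in> ?S" for I
    using that by (simp add: batch_gradient_def subsets_of_size_def D_def w_def e_def m_def a_def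
        sum_subtractf scaleR_right_diff_distrib)
  have mean: "(\<Sum>I\<in>?S. D I) = 0"
  proof -
    have "(1 / ?N) *\<^sub>R (\<Sum>I\<in>?S. D I) = (1 / ?N) *\<^sub>R (\<Sum>I\<in>?S. (1 / real b) *\<^sub>R (\<Sum>i\<in>I. a i)) - m"
      using N by (simp add: D_def sum_subtractf scaleR_right_diff_distrib sum_constant_scaleR del: sum_constant)
    also have "\<dots> = 0" unfolding sample_mean_expectation[OF b] ma by simp
    finally show ?thesis using N by simp
  qed
  have "(\<Sum>I\<in>?S. (norm (x - \<eta> *\<^sub>R (batch_gradient d fs I x - batch_gradient d fs I x0 + mu) - xs))\<^sup>2)
      = (\<Sum>I\<in>?S. (norm (y - \<eta> *\<^sub>R w))\<^sup>2 - 2 * \<eta> * ((y - \<eta> *\<^sub>R w) \<bullet> D I) + \<eta>\<^sup>2 * (norm (D I))\<^sup>2)"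
  proof (intro sum.cong refl)
    fix I assume I: "I \<in> ?S"
    have "x - \<eta> *\<^sub>R (D I + w) - xs = (y - \<eta> *\<^sub>R w) - \<eta> *\<^sub>R D I" by (simp add: y_def algebra_simps)
    then show "(norm (x - \<eta> *\<^sub>R (batch_gradient d fs I x - batch_gradient d fs I x0 + mu) - xs))\<^sup>2
       = (norm (y - \<eta> *\<^sub>R w))\<^sup>2 - 2 * \<eta> * ((y - \<eta> *\<^sub>R w) \<bullet> D I) + \<eta>\<^sup>2 * (norm (D I))\<^sup>2"
      unfolding D[OF I]
      by (simp add: power2_norm_eq_inner power2_eq_square[of \<eta>] inner_diff_left inner_diff_right
          inner_commute algebra_simps)
  qed
  also have "\<dots> = ?N * (norm (y - \<eta> *\<^sub>R w))\<^sup>2 + \<eta>\<^sup>2 * (\<Sum>I\<in>?S. (norm (D I))\<^sup>2)"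
    unfolding sum.distrib sum_subtractf sum_distrib_left[symmetric] inner_sum_right[symmetric] mean
    by simp
  finally have "(\<Sum>I\<in>?S. (norm (x - \<eta> *\<^sub>R (batch_gradient d fs I x - batch_gradient d fs I x0 + mu) - xs))\<^sup>2) / ?N
      = (norm (y - \<eta> *\<^sub>R w))\<^sup>2 + \<eta>\<^sup>2 * ((\<Sum>I\<in>?S. (norm (D I))\<^sup>2) / ?N)"
    using N by (simp add: field_simps)
  moreover have "\<eta>\<^sup>2 * ((\<Sum>I\<in>?S. (norm (D I))\<^sup>2) / ?N)
      \<le> \<eta> / L * dispersion x + 8 / 3 * \<eta> * (\<eta> * L / real b) * gap x0"
  proof -
    have "(\<Sum>I\<in>?S. (norm (D I))\<^sup>2) / ?N \<le> (1 / real b) * ((1 / real n) * (\<Sum>i=1..n. (norm (a i))\<^sup>2))"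
      unfolding D_def by (rule sample_mean_variance[OF b ma])
    \<comment> \<open>Young's inequality with parameter 3 puts weight 4 on \<open>x\<close>, which
      \<open>4 * (\<eta> * L) \<le> real b\<close> pays for, and only 4/3 on \<open>x0\<close>,
      whose coefficient later determines the contraction factor.\<close>
    also have "\<dots> \<le> (1 / real b) * ((1 / real n) * (\<Sum>i=1..n. 4 * (norm (gradient d (fs i) x - gradient d (fs i) xs))\<^sup>2
         + 4 / 3 * (norm (gradient d (fs i) x0 - gradient d (fs i) xs))\<^sup>2))"
    proof (intro mult_left_mono sum_mono)
      fix i
      show "(norm (a i))\<^sup>2 \<le> 4 * (norm (gradient d (fs i) x - gradient d (fs i) xs))\<^sup>2
         + 4 / 3 * (norm (gradient d (fs i) x0 - gradient d (fs i) xs))\<^sup>2"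
        using norm_sq_Young[of 3 "gradient d (fs i) x - gradient d (fs i) xs"
            "gradient d (fs i) xs - gradient d (fs i) x0"]
        by (simp add: a_def norm_minus_commute)
    qed auto
    also have "\<dots> = (1 / real b) * (4 * dispersion x + 4 / 3 * dispersion x0)"
      unfolding dispersion_def sum.distrib sum_distrib_left[symmetric] by (simp add: algebra_simps)
    also have "\<dots> \<le> (1 / real b) * (4 * dispersion x + 4 / 3 * (2 * L * gap x0))"
      using dispersion_le[OF x0] by (intro mult_left_mono) auto
    finally have "\<eta>\<^sup>2 * ((\<Sum>I\<in>?S. (norm (D I))\<^sup>2) / ?N)
        \<le> \<eta>\<^sup>2 * ((1 / real b) * (4 * dispersion x + 4 / 3 * (2 * L * gap x0)))"
      by (intro mult_left_mono) auto
    also have "\<dots> = \<eta> / L * dispersion x * (4 * (\<eta> * L) / real b) + 8 / 3 * \<eta> * (\<eta> * L / real b) * gap x0"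
      using L b by (simp add: power2_eq_square field_simps)
    also have "\<eta> / L * dispersion x * (4 * (\<eta> * L) / real b) \<le> \<eta> / L * dispersion x * 1"
      using small b L \<eta> by (intro mult_left_mono) (auto simp: dispersion_def sum_nonneg)
    finally show ?thesis by simp
  qed
  moreover have "(norm (y - \<eta> *\<^sub>R w))\<^sup>2
    = (norm y)\<^sup>2 - 2 * \<eta> * (full_gradient x \<bullet> y) - 2 * \<eta> * (e \<bullet> y) + \<eta>\<^sup>2 * (norm (full_gradient x + e))\<^sup>2"
    by (simp add: power2_norm_eq_inner power2_eq_square[of \<eta>] w_def inner_diff_left inner_diff_right inner_commute inner_add_left inner_add_right algebra_simps)
  moreover have "2 * \<eta> * (gap x + dispersion x / (2 * L)) \<le> 2 * \<eta> * (full_gradient x \<bullet> y)"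
    using gap_plus_dispersion_le[OF x] \<eta> by (intro mult_left_mono) (auto simp: y_def)
  moreover have "2 * \<eta> * (gap x + dispersion x / (2 * L)) = 2 * \<eta> * gap x + \<eta> / L * dispersion x"
    using L by (simp add: field_simps)
  moreover have "- 2 * \<eta> * (e \<bullet> y) \<le> \<delta> * (norm y)\<^sup>2 + \<eta>\<^sup>2 / \<delta> * (norm e)\<^sup>2"
  proof -
    have "0 \<le> (norm (y + (\<eta> / \<delta>) *\<^sub>R e))\<^sup>2 * \<delta>" using \<delta> by simp
    also have "\<dots> = \<delta> * (norm y)\<^sup>2 + 2 * \<eta> * (e \<bullet> y) + \<eta>\<^sup>2 / \<delta> * (norm e)\<^sup>2"
      using \<delta> by (simp add: power2_norm_eq_inner power2_eq_square[of \<eta>] inner_add_left inner_add_right inner_commute field_simps)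
    finally show ?thesis by simp
  qed
  moreover have "\<eta>\<^sup>2 * (norm (full_gradient x + e))\<^sup>2 \<le> 6 / 5 * \<eta> * gap x + 6 * \<eta>\<^sup>2 * (norm e)\<^sup>2"
  proof -
    have "\<eta>\<^sup>2 * (norm (full_gradient x + e))\<^sup>2 \<le> \<eta>\<^sup>2 * (6 / 5 * (norm (full_gradient x))\<^sup>2 + 6 * (norm e)\<^sup>2)"
      using norm_sq_Young[of "1/5" "full_gradient x" e] by (intro mult_left_mono) auto
    moreover have "\<eta>\<^sup>2 * (norm (full_gradient x))\<^sup>2 \<le> \<eta>\<^sup>2 * (2 * L * gap x)"
      using norm_full_gradient_le[of x] dispersion_le[OF x] by (intro mult_left_mono) auto
    moreover have "\<eta>\<^sup>2 * (2 * L * gap x) \<le> \<eta> * gap x"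
    proof -
      have "\<eta>\<^sup>2 * (2 * L * gap x) = (2 * (\<eta> * L)) * (\<eta> * gap x)" by (simp add: power2_eq_square)
      also have "\<dots> \<le> 1 * (\<eta> * gap x)" using small \<eta> gap_nonneg[OF x] by (intro mult_right_mono) auto
      finally show ?thesis by simp
    qed
    ultimately show ?thesis by (simp add: distrib_left)
  qed
  ultimately show ?thesis unfolding y_def[symmetric] e_def[symmetric]
    by (simp add: distrib_right)
qed

end

section \<open>Expectations over the inner loop, one epoch and the whole run\<close>

context finite_sum_problem
begin

text \<open>For a fixed number of steps the support is finite, which makes every function of the
  iterate integrable; only the geometric step count needs care.\<close>

lemma finite_set_scsg_inner:
  "b \<le> n \<Longrightarrow> finite (set_pmf (scsg_inner d n fs \<eta> b x0 mu k))"
  by (induction k)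
     (simp_all add: finite_subsets_of_size subsets_of_size_nonempty)

lemma set_scsg_inner:
  assumes "x0 \<in> Rd d" "mu \<in> Rd d" "b \<le> n"
  shows "set_pmf (scsg_inner d n fs \<eta> b x0 mu k) \<subseteq> Rd d"
proof (induction k)
  case (Suc k)
  then show ?case
    using assms subspace_Rd finite_subsets_of_size subsets_of_size_nonempty[OF assms(3)]
    by (auto simp: subsets_of_size_def intro!: subspace_diff subspace_add subspace_scale batch_gradient_Rd)
qed (use assms in simp)

lemma expectation_scsg_inner_Suc:
  fixes h :: "fsvec \<Rightarrow> real"
  assumes "b \<le> n"
  shows "measure_pmf.expectation (scsg_inner d n fs \<eta> b x0 mu (Suc k)) h
    = measure_pmf.expectation (scsg_inner d n fs \<eta> b x0 mu k) (\<lambda>x.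
        (\<Sum>I\<in>subsets_of_size n b. h (x - \<eta> *\<^sub>R (batch_gradient d fs I x - batch_gradient d fs I x0 + mu)))
          / real (card (subsets_of_size n b)))"
proof -
  let ?p = "scsg_inner d n fs \<eta> b x0 mu k"
  let ?S = "subsets_of_size n b"
  have S: "?S \<noteq> {}" "finite ?S" using subsets_of_size_nonempty[OF assms] finite_subsets_of_size by auto
  have "measure_pmf.expectation (scsg_inner d n fs \<eta> b x0 mu (Suc k)) h
    = (\<Sum>x\<in>set_pmf ?p. pmf ?p x *\<^sub>R measure_pmf.expectation (pmf_of_set ?S \<bind> (\<lambda>I.
       return_pmf (x - \<eta> *\<^sub>R (batch_gradient d fs I x - batch_gradient d fs I x0 + mu)))) h)"
    unfolding scsg_inner.simps
    by (rule pmf_expectation_bind) (use S finite_set_scsg_inner[OF assms] in auto)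
  also have "\<dots> = measure_pmf.expectation ?p (\<lambda>x. measure_pmf.expectation (pmf_of_set ?S \<bind> (\<lambda>I.
       return_pmf (x - \<eta> *\<^sub>R (batch_gradient d fs I x - batch_gradient d fs I x0 + mu)))) h)"
    by (rule integral_measure_pmf[symmetric]) (auto simp: finite_set_scsg_inner[OF assms])
  finally show ?thesis
    by (simp add: map_pmf_def[symmetric] integral_pmf_of_set[OF S])
qed

text \<open>For \<open>B = n\<close> the only sample is the whole index set, which is what ends the
  noise. Otherwise the raw second moment at \<open>x0\<close> is split around the gradients at
  \<open>xs\<close> into a dispersion and the fixed part \<open>grad_variance\<close>.\<close>

lemma anchor_error:
  assumes x0: "x0 \<in> Rd d" and B: "1 \<le> B" "B \<le> n"
  shows "(\<Sum>I\<in>subsets_of_size n B. (norm (batch_gradient d fs I x0 - full_gradient x0))\<^sup>2)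
           / real (card (subsets_of_size n B))
    \<le> (if B = n then 0 else (4 * L * gap x0 + 2 * grad_variance d n fs xs) / real B)"
proof (cases "B = n")
  case True
  have "subsets_of_size n n = {{1..n}}"
    by (auto simp: subsets_of_size_def dest: card_subset_eq[rotated])
  then show ?thesis using True by (simp add: batch_gradient_def full_gradient_def)
next
  case False
  have "(\<Sum>I\<in>subsets_of_size n B. (norm (batch_gradient d fs I x0 - full_gradient x0))\<^sup>2)
      = (\<Sum>I\<in>subsets_of_size n B. (norm ((1 / real B) *\<^sub>R (\<Sum>i\<in>I. gradient d (fs i) x0) - full_gradient x0))\<^sup>2)"
    by (intro sum.cong) (auto simp: batch_gradient_def subsets_of_size_def)
  then have "(\<Sum>I\<in>subsets_of_size n B. (norm (batch_gradient d fs I x0 - full_gradient x0))\<^sup>2)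
           / real (card (subsets_of_size n B))
      \<le> (1 / real B) * ((1 / real n) * (\<Sum>i=1..n. (norm (gradient d (fs i) x0))\<^sup>2))"
    using sample_mean_variance[OF B full_gradient_def] by simp
  also have "\<dots> \<le> (1 / real B) * ((1 / real n) * (\<Sum>i=1..n.
      2 * (norm (gradient d (fs i) x0 - gradient d (fs i) xs))\<^sup>2 + 2 * (norm (gradient d (fs i) xs))\<^sup>2))"
  proof (intro mult_left_mono sum_mono)
    fix i
    show "(norm (gradient d (fs i) x0))\<^sup>2 \<le>
      2 * (norm (gradient d (fs i) x0 - gradient d (fs i) xs))\<^sup>2 + 2 * (norm (gradient d (fs i) xs))\<^sup>2"
      using norm_sq_Young[of 1 "gradient d (fs i) x0 - gradient d (fs i) xs" "gradient d (fs i) xs"] by simp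
  qed auto
  also have "\<dots> = (1 / real B) * (2 * dispersion x0 + 2 * grad_variance d n fs xs)"
    unfolding dispersion_def grad_variance_def sum.distrib sum_distrib_left[symmetric]
    by (simp add: algebra_simps)
  also have "\<dots> \<le> (1 / real B) * (4 * L * gap x0 + 2 * grad_variance d n fs xs)"
    using dispersion_le[OF x0] by (intro mult_left_mono) auto
  finally show ?thesis using False by simp
qed

text \<open>The one-step bound is used with \<open>\<delta> = c * \<theta>\<close>, so
  \<open>c\<close> is the fraction of the distance term spent on Young's inequality. The odds of
  stopping are \<open>\<theta> = real b / m\<close>, which puts the stopping probability into the
  form \<open>\<theta> / (1 + \<theta>)\<close>.\<close>

lemma epoch_bound_unscaled:
  assumes x0: "x0 \<in> Rd d" and b: "1 \<le> b" "b \<le> n" and B: "1 \<le> B" "B \<le> n" and \<eta>: "0 < \<eta>"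
    and small: "4 * (\<eta> * L) \<le> real b" "2 * (\<eta> * L) \<le> 1" and m: "0 < m" and c: "0 < c" "c \<le> 1"
    and \<theta>: "\<theta> = real b / m"
  shows "(\<integral>\<^sup>+p. ennreal (4 / 5 * \<eta> * gap (fst p) + \<theta> * (1 - c) * (norm (fst p - xs))\<^sup>2)
            \<partial>measure_pmf (scsg_epoch d n fs \<eta> b m B x0))
    \<le> ennreal (\<theta> * (norm (x0 - xs))\<^sup>2 + 8 / 3 * \<eta> * (\<eta> * L / real b) * gap x0
         + (\<eta>\<^sup>2 / (c * \<theta>) + 6 * \<eta>\<^sup>2)
           * (if B = n then 0 else (4 * L * gap x0 + 2 * grad_variance d n fs xs) / real B))"
proof -
  let ?S = "subsets_of_size n B"
  have S: "?S \<noteq> {}" "finite ?S" using subsets_of_size_nonempty[OF B(2)] finite_subsets_of_size by auto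
  have \<theta>0: "0 < \<theta>" using \<theta> b m by simp
  have "m + real b \<noteq> 0" using m by simp
  then have p: "1 - m / (m + real b) = \<theta> / (1 + \<theta>)" unfolding \<theta> using m by (simp add: field_simps)
  \<comment> \<open>Everything in the one-step bound that stays constant once the batch
    \<open>I\<close> is drawn. It is averaged over \<open>I\<close> only after the geometric
    stopping.\<close>
  define W where "W I = (\<eta>\<^sup>2 / (c * \<theta>) + 6 * \<eta>\<^sup>2) * (norm (batch_gradient d fs I x0 - full_gradient x0))\<^sup>2
    + 8 / 3 * \<eta> * (\<eta> * L / real b) * gap x0" for I
  let ?h = "\<lambda>x. 4 / 5 * \<eta> * gap x + \<theta> * (1 - c) * (norm (x - xs))\<^sup>2"
  have inner: "(\<integral>\<^sup>+N. \<integral>\<^sup>+x. ennreal (?h x)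
      \<partial>measure_pmf (scsg_inner d n fs \<eta> b x0 (batch_gradient d fs I x0) N) \<partial>measure_pmf (geometric_pmf (\<theta> / (1 + \<theta>))))
      \<le> ennreal (\<theta> * (norm (x0 - xs))\<^sup>2 + W I)" if I: "I \<in> ?S" for I
  proof -
    let ?mu = "batch_gradient d fs I x0"
    have mu: "?mu \<in> Rd d" using I x0 by (intro batch_gradient_Rd) (auto simp: subsets_of_size_def)
    let ?q = "scsg_inner d n fs \<eta> b x0 ?mu"
    have Rdq: "x \<in> Rd d" if "x \<in> set_pmf (?q k)" for x k
      using set_scsg_inner[OF x0 mu b(2)] that by blast
    have int: "integrable (measure_pmf (?q k)) (h :: fsvec \<Rightarrow> real)" for h k
      by (rule integrable_measure_pmf_finite) (rule finite_set_scsg_inner[OF b(2)])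
    define U where "U k = measure_pmf.expectation (?q k) (\<lambda>x. (norm (x - xs))\<^sup>2)" for k
    define F where "F k = measure_pmf.expectation (?q k) gap" for k
    have U0: "0 \<le> U k" for k unfolding U_def by (intro integral_nonneg_AE) simp
    have F0: "0 \<le> F k" for k unfolding F_def
      by (intro integral_nonneg_AE) (auto simp: AE_measure_pmf_iff gap_nonneg Rdq)
    have step: "U (Suc k) \<le> (1 + c * \<theta>) * U k - (4 / 5 * \<eta>) * F k + W I" for k
    proof -
      have "U (Suc k) \<le> measure_pmf.expectation (?q k)
          (\<lambda>x. (1 + c * \<theta>) * (norm (x - xs))\<^sup>2 - (4 / 5 * \<eta>) * gap x + W I)"
        unfolding U_def expectation_scsg_inner_Suc[OF b(2)] W_def
        using c \<theta>0
        by (intro integral_mono_AE int, unfold AE_measure_pmf_iff, intro ballI inner_step x0 b \<eta> small Rdq)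
           simp_all
      also have "\<dots> = (1 + c * \<theta>) * U k - (4 / 5 * \<eta>) * F k + W I"
        unfolding U_def F_def by (simp add: int)
      finally show ?thesis .
    qed
    have "(\<integral>\<^sup>+x. ennreal (?h x) \<partial>measure_pmf (?q N)) = ennreal (4 / 5 * \<eta> * F N + \<theta> * (1 - c) * U N)" for N
    proof -
      have "(\<integral>\<^sup>+x. ennreal (?h x) \<partial>measure_pmf (?q N)) = ennreal (measure_pmf.expectation (?q N) ?h)"
        using \<eta> \<theta>0 c by (intro nn_integral_eq_integral int)
          (auto simp: AE_measure_pmf_iff gap_nonneg Rdq)
      then show ?thesis unfolding U_def F_def by (simp add: int)
    qed
    moreover have "U 0 = (norm (x0 - xs))\<^sup>2" by (simp add: U_def)
    ultimately show ?thesis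
      using geometric_stopping_bound[OF \<theta>0, of c "4/5 * \<eta>" U F "W I"] c \<eta> U0 F0 step by simp
  qed
  have "(\<integral>\<^sup>+p. ennreal (4 / 5 * \<eta> * gap (fst p) + \<theta> * (1 - c) * (norm (fst p - xs))\<^sup>2)
            \<partial>measure_pmf (scsg_epoch d n fs \<eta> b m B x0))
    = (\<integral>\<^sup>+I. \<integral>\<^sup>+N. \<integral>\<^sup>+x. ennreal (?h x)
      \<partial>measure_pmf (scsg_inner d n fs \<eta> b x0 (batch_gradient d fs I x0) N) \<partial>measure_pmf (geometric_pmf (\<theta> / (1 + \<theta>)))
      \<partial>measure_pmf (pmf_of_set ?S))"
    unfolding scsg_epoch_def p by simp
  also have "\<dots> \<le> (\<integral>\<^sup>+I. ennreal (\<theta> * (norm (x0 - xs))\<^sup>2 + W I) \<partial>measure_pmf (pmf_of_set ?S))"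
    using inner S by (intro nn_integral_mono_AE) (auto simp: AE_measure_pmf_iff)
  also have "\<dots> = ennreal (measure_pmf.expectation (pmf_of_set ?S) (\<lambda>I. \<theta> * (norm (x0 - xs))\<^sup>2 + W I))"
    using S \<theta>0 c \<eta> L gap_nonneg[OF x0]
    by (intro nn_integral_eq_integral integrable_measure_pmf_finite) (auto simp: W_def)
  also have "measure_pmf.expectation (pmf_of_set ?S) (\<lambda>I. \<theta> * (norm (x0 - xs))\<^sup>2 + W I)
     = \<theta> * (norm (x0 - xs))\<^sup>2 + 8 / 3 * \<eta> * (\<eta> * L / real b) * gap x0
       + (\<eta>\<^sup>2 / (c * \<theta>) + 6 * \<eta>\<^sup>2) * ((\<Sum>I\<in>?S. (norm (batch_gradient d fs I x0 - full_gradient x0))\<^sup>2) / real (card ?S))"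
    (is "?E = ?R")
  proof -
    have N: "0 < real (card ?S)" using S by (simp add: card_gt_0_iff)
    have "?E = (\<Sum>I\<in>?S. \<theta> * (norm (x0 - xs))\<^sup>2 + W I) / real (card ?S)"
      by (rule integral_pmf_of_set[OF S])
    also have "(\<Sum>I\<in>?S. \<theta> * (norm (x0 - xs))\<^sup>2 + W I)
      = real (card ?S) * (\<theta> * (norm (x0 - xs))\<^sup>2 + 8 / 3 * \<eta> * (\<eta> * L / real b) * gap x0)
       + (\<eta>\<^sup>2 / (c * \<theta>) + 6 * \<eta>\<^sup>2) * (\<Sum>I\<in>?S. (norm (batch_gradient d fs I x0 - full_gradient x0))\<^sup>2)"
      unfolding W_def sum.distrib sum_distrib_left[symmetric] by (simp add: distrib_left)
    finally show ?thesis using N by (simp add: add_divide_distrib)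
  qed
  also have "ennreal \<dots> \<le> ennreal (\<theta> * (norm (x0 - xs))\<^sup>2 + 8 / 3 * \<eta> * (\<eta> * L / real b) * gap x0
         + (\<eta>\<^sup>2 / (c * \<theta>) + 6 * \<eta>\<^sup>2)
           * (if B = n then 0 else (4 * L * gap x0 + 2 * grad_variance d n fs xs) / real B))"
    using \<theta>0 c by (intro ennreal_leI add_left_mono mult_left_mono anchor_error[OF x0 B]) auto
  finally show ?thesis .
qed

lemma grad_variance_nonneg: "0 \<le> grad_variance d n fs x"
  by (simp add: grad_variance_def sum_nonneg)

text \<open>Multiplying by \<open>L * m\<close> expresses the bound through \<open>\<rho>\<close>
  and the scaled distance. The noise then carries the ratio of the square of \<open>m\<close> to
  \<open>B\<close>, and this ratio is what \<open>Q\<close> bounds.\<close>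

lemma epoch_bound:
  assumes x0: "x0 \<in> Rd d" and b: "1 \<le> b" "b \<le> n" and B: "1 \<le> B" "B \<le> n" and \<eta>: "0 < \<eta>"
    and \<rho>: "\<rho> = \<eta> * L" and small: "\<rho> \<le> G * real b" "4 * G \<le> 1" "2 * \<rho> \<le> 1"
    and m: "4 * real b \<le> m" "B < n \<Longrightarrow> m\<^sup>2 \<le> Q * real B" and c: "0 < c" "c \<le> 1"
  shows "(\<integral>\<^sup>+p. ennreal (4 / 5 * \<rho> * m * gap (fst p) + real b * (1 - c) * (L * (norm (fst p - xs))\<^sup>2))
            \<partial>measure_pmf (scsg_epoch d n fs \<eta> b m B x0))
    \<le> ennreal (real b * (L * (norm (x0 - xs))\<^sup>2) + 8 / 3 * G * \<rho> * m * gap x0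
         + (if B = n then 0 else
              5 * \<rho>\<^sup>2 * Q / real b / c * (2 * gap x0 + grad_variance d n fs xs / L)))"
proof -
  have m0: "0 < m" using m b by simp
  have \<rho>0: "0 < \<rho>" using \<rho> \<eta> L by simp
  define \<theta> where "\<theta> = real b / m"
  define g where "g = gap x0"
  define H where "H = grad_variance d n fs xs"
  have g0: "0 \<le> g" "0 \<le> H" using gap_nonneg[OF x0] grad_variance_nonneg by (auto simp: g_def H_def)
  have "4 * G * real b \<le> 1 * real b" using small by (intro mult_right_mono) auto
  then have "4 * (\<eta> * L) \<le> real b" using small(1) \<rho> by linarith
  note eb = epoch_bound_unscaled[OF x0 b B \<eta> this small(3)[unfolded \<rho>] m0 c \<theta>_def, folded g_def H_def]
  have "(\<integral>\<^sup>+p. ennreal (4 / 5 * \<rho> * m * gap (fst p) + real b * (1 - c) * (L * (norm (fst p - xs))\<^sup>2))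
            \<partial>measure_pmf (scsg_epoch d n fs \<eta> b m B x0))
    = (\<integral>\<^sup>+p. ennreal (L * m) * ennreal (4 / 5 * \<eta> * gap (fst p) + \<theta> * (1 - c) * (norm (fst p - xs))\<^sup>2)
            \<partial>measure_pmf (scsg_epoch d n fs \<eta> b m B x0))"
  proof (intro nn_integral_cong)
    fix p :: "fsvec \<times> nat"
    have b\<theta>: "real b = \<theta> * m" using m0 by (simp add: \<theta>_def)
    have "4 / 5 * \<rho> * m * gap (fst p) + real b * (1 - c) * (L * (norm (fst p - xs))\<^sup>2)
        = L * m * (4 / 5 * \<eta> * gap (fst p) + \<theta> * (1 - c) * (norm (fst p - xs))\<^sup>2)"
      unfolding b\<theta> \<rho> by (simp add: algebra_simps)
    then show "ennreal (4 / 5 * \<rho> * m * gap (fst p) + real b * (1 - c) * (L * (norm (fst p - xs))\<^sup>2))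
        = ennreal (L * m) * ennreal (4 / 5 * \<eta> * gap (fst p) + \<theta> * (1 - c) * (norm (fst p - xs))\<^sup>2)"
      using L m0 by (simp add: ennreal_mult')
  qed
  also have "\<dots> = ennreal (L * m) * (\<integral>\<^sup>+p. ennreal (4 / 5 * \<eta> * gap (fst p) + \<theta> * (1 - c) * (norm (fst p - xs))\<^sup>2)
            \<partial>measure_pmf (scsg_epoch d n fs \<eta> b m B x0))"
    by (rule nn_integral_cmult) simp
  also have "\<dots> \<le> ennreal (L * m) * ennreal (\<theta> * (norm (x0 - xs))\<^sup>2 + 8 / 3 * \<eta> * (\<eta> * L / real b) * g
         + (\<eta>\<^sup>2 / (c * \<theta>) + 6 * \<eta>\<^sup>2) * (if B = n then 0 else (4 * L * g + 2 * H) / real B))"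
    by (intro mult_left_mono eb) simp
  also have "\<dots> = ennreal (L * m * (\<theta> * (norm (x0 - xs))\<^sup>2 + 8 / 3 * \<eta> * (\<eta> * L / real b) * g
         + (\<eta>\<^sup>2 / (c * \<theta>) + 6 * \<eta>\<^sup>2) * (if B = n then 0 else (4 * L * g + 2 * H) / real B)))"
    using L m0 by (simp add: ennreal_mult')
  also have "\<dots> \<le> ennreal (real b * (L * (norm (x0 - xs))\<^sup>2) + 8 / 3 * G * \<rho> * m * g
         + (if B = n then 0 else 5 * \<rho>\<^sup>2 * Q / real b / c * (2 * g + H / L)))"
  proof (rule ennreal_leI)
    have "L * m * (\<theta> * (norm (x0 - xs))\<^sup>2) = real b * (L * (norm (x0 - xs))\<^sup>2)"
      using m0 by (simp add: \<theta>_def)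
    moreover have "L * m * (8 / 3 * \<eta> * (\<eta> * L / real b) * g) \<le> 8 / 3 * G * \<rho> * m * g"
    proof -
      have "\<rho> / real b \<le> G" using small b by (simp add: field_simps)
      then have "(\<rho> / real b) * (8 / 3 * \<rho> * m * g) \<le> G * (8 / 3 * \<rho> * m * g)"
        using \<rho>0 m0 g0 by (intro mult_right_mono) auto
      then show ?thesis by (simp add: \<rho> algebra_simps)
    qed
    moreover have "L * m * ((\<eta>\<^sup>2 / (c * \<theta>) + 6 * \<eta>\<^sup>2) * (if B = n then 0 else (4 * L * g + 2 * H) / real B))
        \<le> (if B = n then 0 else 5 * \<rho>\<^sup>2 * Q / real b / c * (2 * g + H / L))"
    proof (cases "B = n")
      case False
      \<comment> \<open>As \<open>m / (c * real b)\<close> is at least 4, the term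
        \<open>6 * \<eta>\<^sup>2\<close> costs at most 3/2 of the main one. The resulting 5/2,
        times the 2 in the anchor error, is the constant 5.\<close>
      have "\<eta>\<^sup>2 / (c * \<theta>) + 6 * \<eta>\<^sup>2 \<le> 5 / 2 * (\<eta>\<^sup>2 * m / (c * real b))"
      proof -
        have "4 * (c * real b) \<le> 4 * (1 * real b)" using c by (intro mult_left_mono mult_right_mono) auto
        then have "4 * (c * real b) \<le> m" using m by simp
        then have "4 \<le> m / (c * real b)" using c b by (simp add: field_simps)
        then have "\<eta>\<^sup>2 * 4 \<le> \<eta>\<^sup>2 * (m / (c * real b))" by (intro mult_left_mono) auto
        then show ?thesis using m0 by (simp add: \<theta>_def)
      qed
      then have "L * m * ((\<eta>\<^sup>2 / (c * \<theta>) + 6 * \<eta>\<^sup>2) * ((4 * L * g + 2 * H) / real B))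
        \<le> L * m * (5 / 2 * (\<eta>\<^sup>2 * m / (c * real b)) * ((4 * L * g + 2 * H) / real B))"
        using L m0 g0 by (intro mult_left_mono mult_right_mono) auto
      also have "\<dots> = 5 * \<rho>\<^sup>2 / real b / c * (2 * g + H / L) * (m\<^sup>2 / real B)"
        using L c b B by (simp add: \<rho> power2_eq_square field_simps)
      also have "\<dots> \<le> 5 * \<rho>\<^sup>2 / real b / c * (2 * g + H / L) * Q"
        using m(2) False B c g0 L by (intro mult_left_mono) (auto simp: field_simps)
      finally show ?thesis using False by (simp add: mult_ac)
    qed simp
    ultimately show "L * m * (\<theta> * (norm (x0 - xs))\<^sup>2 + 8 / 3 * \<eta> * (\<eta> * L / real b) * g
         + (\<eta>\<^sup>2 / (c * \<theta>) + 6 * \<eta>\<^sup>2) * (if B = n then 0 else (4 * L * g + 2 * H) / real B))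
      \<le> real b * (L * (norm (x0 - xs))\<^sup>2) + 8 / 3 * G * \<rho> * m * g
         + (if B = n then 0 else 5 * \<rho>\<^sup>2 * Q / real b / c * (2 * g + H / L))"
      unfolding distrib_left by linarith
  qed
  finally show ?thesis unfolding g_def H_def .
qed

lemma set_scsg_epoch:
  assumes x0: "x0 \<in> Rd d" and b: "b \<le> n" and B: "B \<le> n"
    and p: "p \<in> set_pmf (scsg_epoch d n fs \<eta> b m B x0)"
  shows "fst p \<in> Rd d"
proof -
  obtain I N where I: "I \<in> subsets_of_size n B"
    and "fst p \<in> set_pmf (scsg_inner d n fs \<eta> b x0 (batch_gradient d fs I x0) N)"
    using p finite_subsets_of_size[of n B] subsets_of_size_nonempty[OF B]
    by (auto simp: scsg_epoch_def)
  moreover have "batch_gradient d fs I x0 \<in> Rd d"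
    using I by (intro batch_gradient_Rd x0) (simp add: subsets_of_size_def)
  ultimately show ?thesis using set_scsg_inner[OF x0 _ b] by blast
qed

lemma set_scsg:
  assumes "x0 \<in> Rd d" "b \<le> n" "\<And>j. B j \<le> n"
  shows "p \<in> set_pmf (scsg d n fs (\<lambda>_. \<eta>) (\<lambda>_. b) m B x0 T) \<Longrightarrow> fst p \<in> Rd d"
proof (induction T arbitrary: p)
  case (Suc T)
  then obtain q r where q: "q \<in> set_pmf (scsg d n fs (\<lambda>_. \<eta>) (\<lambda>_. b) m B x0 T)"
    and "r \<in> set_pmf (scsg_epoch d n fs \<eta> b (m (Suc T)) (B (Suc T)) (fst q))" "fst p = fst r"
    by (auto simp: split_beta)
  then show ?case using set_scsg_epoch[OF Suc.IH[OF q] assms(2,3)] by metis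
qed (use assms in simp)

text \<open>The epoch bound integrated over the past. The recursion is carried in
  \<open>ennreal\<close> until finiteness is known by induction, and only then read off in the
  reals.\<close>

lemma run_recursion:
  assumes x0: "x0 \<in> Rd d" and b: "1 \<le> b" "b \<le> n" and B: "\<And>j. 1 \<le> B j" "\<And>j. B j \<le> n" and \<eta>: "0 < \<eta>"
    and \<rho>: "\<rho> = \<eta> * L" and small: "0 < G" "\<rho> \<le> G * real b" "4 * G \<le> 1" "2 * \<rho> \<le> 1"
    and m: "\<And>j. 4 * real b \<le> m j" "\<And>j. B j < n \<Longrightarrow> (m j)\<^sup>2 \<le> Q * real (B j)" and Q: "0 \<le> Q"
  obtains F X :: "nat \<Rightarrow> real"
  where "\<And>j. 0 \<le> F j" "\<And>j. 0 \<le> X j"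
    "\<And>j. (\<integral>\<^sup>+p. ennreal (gap (fst p)) \<partial>measure_pmf (scsg d n fs (\<lambda>_. \<eta>) (\<lambda>_. b) m B x0 j)) = ennreal (F j)"
    "\<And>j. (\<integral>\<^sup>+p. ennreal (L * (norm (fst p - xs))\<^sup>2) \<partial>measure_pmf (scsg d n fs (\<lambda>_. \<eta>) (\<lambda>_. b) m B x0 j)) = ennreal (X j)"
    "X 0 = L * (norm (x0 - xs))\<^sup>2" "F 0 = gap x0"
    "\<And>j c. 0 < c \<Longrightarrow> c \<le> 1 \<Longrightarrow>
      4 / 5 * \<rho> * m (Suc j) * F (Suc j) + real b * (1 - c) * X (Suc j)
      \<le> real b * X j + 8 / 3 * G * \<rho> * m (Suc j) * F j + (if B (Suc j) = n then 0 else
              5 * \<rho>\<^sup>2 * Q / real b / c * (2 * F j + grad_variance d n fs xs / L))"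
proof -
  let ?P = "scsg d n fs (\<lambda>_. \<eta>) (\<lambda>_. b) m B x0"
  define F' where "F' j = (\<integral>\<^sup>+p. ennreal (gap (fst p)) \<partial>measure_pmf (?P j))" for j
  define X' where "X' j = (\<integral>\<^sup>+p. ennreal (L * (norm (fst p - xs))\<^sup>2) \<partial>measure_pmf (?P j))" for j
  define H where "H = grad_variance d n fs xs / L"
  have H0: "0 \<le> H" using grad_variance_nonneg L by (simp add: H_def)
  have \<rho>0: "0 < \<rho>" using \<rho> \<eta> L by simp
  have m0: "0 < m j" for j using m(1)[of j] b by simp
  have Rdp: "fst p \<in> Rd d" if "p \<in> set_pmf (?P j)" for p j
    using set_scsg[where B=B, OF x0 b(2) B(2) that] .
  have lin: "(\<integral>\<^sup>+p. ennreal (u * gap (fst p) + v * (L * (norm (fst p - xs))\<^sup>2) + w) \<partial>measure_pmf (?P j))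
     = ennreal u * F' j + ennreal v * X' j + ennreal w" if "0 \<le> u" "0 \<le> v" "0 \<le> w" for u v w j
  proof -
    have "(\<integral>\<^sup>+p. ennreal (u * gap (fst p) + v * (L * (norm (fst p - xs))\<^sup>2) + w) \<partial>measure_pmf (?P j))
      = (\<integral>\<^sup>+p. ennreal u * ennreal (gap (fst p)) + ennreal v * ennreal (L * (norm (fst p - xs))\<^sup>2) + ennreal w \<partial>measure_pmf (?P j))"
      using that L by (intro nn_integral_cong_AE)
        (auto simp: AE_measure_pmf_iff ennreal_plus ennreal_mult' gap_nonneg Rdp)
    then show ?thesis
      by (simp add: F'_def X'_def nn_integral_add nn_integral_cmult)
  qed
  define R where "R j c = (if B (Suc j) = n then 0 else 5 * \<rho>\<^sup>2 * Q / real b / c)" for j c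
  have R0: "0 \<le> R j c" if "0 < c" for j c using that Q by (simp add: R_def)
  have rec': "ennreal (4 / 5 * \<rho> * m (Suc j)) * F' (Suc j) + ennreal (real b * (1 - c)) * X' (Suc j)
      \<le> ennreal (8 / 3 * G * \<rho> * m (Suc j) + 2 * R j c) * F' j + ennreal (real b) * X' j + ennreal (R j c * H)"
    if c: "0 < c" "c \<le> 1" for j c
  proof -
    have "ennreal (4 / 5 * \<rho> * m (Suc j)) * F' (Suc j) + ennreal (real b * (1 - c)) * X' (Suc j)
      = (\<integral>\<^sup>+p. ennreal (4 / 5 * \<rho> * m (Suc j) * gap (fst p) + real b * (1 - c) * (L * (norm (fst p - xs))\<^sup>2))
          \<partial>measure_pmf (?P (Suc j)))"
      using lin[of "4 / 5 * \<rho> * m (Suc j)" "real b * (1 - c)" 0 "Suc j"] \<rho>0 m0[of "Suc j"] c by simp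
    also have "\<dots> = (\<integral>\<^sup>+q. \<integral>\<^sup>+p. ennreal (4 / 5 * \<rho> * m (Suc j) * gap (fst p) + real b * (1 - c) * (L * (norm (fst p - xs))\<^sup>2))
          \<partial>measure_pmf (scsg_epoch d n fs \<eta> b (m (Suc j)) (B (Suc j)) (fst q)) \<partial>measure_pmf (?P j))"
      by (simp add: split_beta)
    also have "\<dots> \<le> (\<integral>\<^sup>+q. ennreal ((8 / 3 * G * \<rho> * m (Suc j) + 2 * R j c) * gap (fst q)
        + real b * (L * (norm (fst q - xs))\<^sup>2) + R j c * H) \<partial>measure_pmf (?P j))"
    proof (intro nn_integral_mono_AE, unfold AE_measure_pmf_iff, intro ballI)
      fix q assume q: "q \<in> set_pmf (?P j)"
      have "real b * (L * (norm (fst q - xs))\<^sup>2) + 8 / 3 * G * \<rho> * m (Suc j) * gap (fst q)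
         + (if B (Suc j) = n then 0 else
              5 * \<rho>\<^sup>2 * Q / real b / c * (2 * gap (fst q) + H))
        = (8 / 3 * G * \<rho> * m (Suc j) + 2 * R j c) * gap (fst q)
        + real b * (L * (norm (fst q - xs))\<^sup>2) + R j c * H" by (simp add: R_def algebra_simps add_divide_distrib)
      then show "(\<integral>\<^sup>+p. ennreal (4 / 5 * \<rho> * m (Suc j) * gap (fst p) + real b * (1 - c) * (L * (norm (fst p - xs))\<^sup>2))
          \<partial>measure_pmf (scsg_epoch d n fs \<eta> b (m (Suc j)) (B (Suc j)) (fst q)))
        \<le> ennreal ((8 / 3 * G * \<rho> * m (Suc j) + 2 * R j c) * gap (fst q)
        + real b * (L * (norm (fst q - xs))\<^sup>2) + R j c * H)"
        using epoch_bound[OF Rdp[OF q] b B \<eta> \<rho> small(2-4) m(1) m(2) c, of "Suc j", folded H_def]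
        by (simp only: )
    qed
    also have "\<dots> = ennreal (8 / 3 * G * \<rho> * m (Suc j) + 2 * R j c) * F' j + ennreal (real b) * X' j + ennreal (R j c * H)"
      using small(1) \<rho>0 m0[of "Suc j"] R0[OF c(1)] H0 by (intro lin) auto
    finally show ?thesis .
  qed
  \<comment> \<open>Any weight \<open>c\<close> strictly below 1 would do: the coefficient of the
    distance must be positive for its finiteness to follow.\<close>
  have fin: "F' j < \<top> \<and> X' j < \<top>" for j
  proof (induction j)
    case 0
    then show ?case by (simp add: F'_def X'_def nn_integral_return)
  next
    case (Suc j)
    have "ennreal (8 / 3 * G * \<rho> * m (Suc j) + 2 * R j (1/2)) * F' j + ennreal (real b) * X' j + ennreal (R j (1/2) * H) < \<top>"
      using Suc by (simp add: ennreal_mult_less_top)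
    from le_less_trans[OF rec' this]
    have "ennreal (4 / 5 * \<rho> * m (Suc j)) * F' (Suc j) + ennreal (real b * (1 - 1/2)) * X' (Suc j) < \<top>"
      by simp
    then show ?case using \<rho>0 m0[of "Suc j"] b
      by (auto simp: ennreal_mult_less_top)
  qed
  define F where "F j = enn2real (F' j)" for j
  define X where "X j = enn2real (X' j)" for j
  have F: "F' j = ennreal (F j)" and X: "X' j = ennreal (X j)" for j
    using fin by (simp_all add: F_def X_def)
  have FX0: "0 \<le> F j" "0 \<le> X j" for j by (simp_all add: F_def X_def)
  show ?thesis
  proof (rule that[of F X])
    show "X 0 = L * (norm (x0 - xs))\<^sup>2" using L by (simp add: X_def X'_def nn_integral_return)
    show "F 0 = gap x0" using gap_nonneg[OF x0] by (simp add: F_def F'_def nn_integral_return)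
    fix j and c :: real assume c: "0 < c" "c \<le> 1"
    have "ennreal (4 / 5 * \<rho> * m (Suc j) * F (Suc j) + real b * (1 - c) * X (Suc j))
       = ennreal (4 / 5 * \<rho> * m (Suc j)) * F' (Suc j) + ennreal (real b * (1 - c)) * X' (Suc j)"
      unfolding F X using \<rho>0 m0[of "Suc j"] c FX0
      by (subst (1 2) ennreal_mult'[symmetric], simp, simp, subst ennreal_plus[symmetric], simp_all)
    also have "\<dots> \<le> ennreal (8 / 3 * G * \<rho> * m (Suc j) + 2 * R j c) * F' j + ennreal (real b) * X' j + ennreal (R j c * H)"
      by (rule rec'[OF c])
    also have "\<dots> = ennreal ((8 / 3 * G * \<rho> * m (Suc j) + 2 * R j c) * F j + real b * X j + R j c * H)"
      using small(1) \<rho>0 m0[of "Suc j"] R0[OF c(1)] H0 FX0 by (simp add: F X ennreal_mult')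
    finally have "4 / 5 * \<rho> * m (Suc j) * F (Suc j) + real b * (1 - c) * X (Suc j)
        \<le> (8 / 3 * G * \<rho> * m (Suc j) + 2 * R j c) * F j + real b * X j + R j c * H"
      using small(1) \<rho>0 m0[of "Suc j"] R0[OF c(1)] H0 FX0 by (subst (asm) ennreal_le_iff) auto
    moreover have "(if B (Suc j) = n then 0 else 5 * \<rho>\<^sup>2 * Q / real b / c * (2 * F j + H)) = R j c * (2 * F j + H)"
      by (simp add: R_def)
    ultimately show "4 / 5 * \<rho> * m (Suc j) * F (Suc j) + real b * (1 - c) * X (Suc j)
      \<le> real b * X j + 8 / 3 * G * \<rho> * m (Suc j) * F j + (if B (Suc j) = n then 0 else
              5 * \<rho>\<^sup>2 * Q / real b / c * (2 * F j + grad_variance d n fs xs / L))"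
      unfolding H_def[symmetric] by (simp add: algebra_simps)
  qed (use F X FX0 in \<open>simp_all add: F'_def X'_def\<close>)
qed

end

section \<open>Cost\<close>

text \<open>The mean number of inner steps is \<open>(1 - p) / p = m / b\<close>, and each step
  costs \<open>b\<close>.\<close>

lemma expected_epoch_cost:
  assumes m: "0 < m" and "1 \<le> b"
  shows "(\<integral>\<^sup>+p. ennreal (real (snd p)) \<partial>measure_pmf (scsg_epoch d n fs \<eta> b m B x0)) = ennreal (m + real B)"
proof -
  define p where "p = 1 - m / (m + real b)"
  have p: "p \<in> {0<..1}" "p = real b / (m + real b)" using assms by (auto simp: p_def field_simps)
  have "(\<integral>\<^sup>+N. ennreal (real b * real N + real B) \<partial>measure_pmf (geometric_pmf p))
      = ennreal (measure_pmf.expectation (geometric_pmf p) (\<lambda>N. real b * real N + real B))"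
    using integrable_real_geometric_pmf[OF p(1)] by (intro nn_integral_eq_integral) auto
  also have "\<dots> = ennreal (real b * ((1 - p) / p) + real B)"
    using integrable_real_geometric_pmf[OF p(1)] expectation_geometric_pmf[OF p(1)] by simp
  also have "real b * ((1 - p) / p) = m"
  proof -
    have "1 - p = m / (m + real b)" by (simp add: p_def)
    then have "(1 - p) / p = (m / (m + real b)) / (real b / (m + real b))" using p(2) by simp
    also have "\<dots> = m / real b" using assms by simp
    finally show ?thesis using assms by simp
  qed
  finally show ?thesis unfolding scsg_epoch_def p_def by simp
qed

lemma expected_cost_run:
  assumes "\<And>j. 0 < m j" and "1 \<le> b"
  shows "(\<integral>\<^sup>+p. ennreal (real (snd p)) \<partial>measure_pmf (scsg d n fs (\<lambda>_. \<eta>) (\<lambda>_. b) m B x0 T))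
    = ennreal (\<Sum>j<T. m (Suc j) + real (B (Suc j)))"
proof (induction T)
  case (Suc T)
  have pos: "0 \<le> (\<Sum>j<T. m (Suc j) + real (B (Suc j)))"
    using assms(1) by (intro sum_nonneg add_nonneg_nonneg) (auto intro: less_imp_le)
  have "(\<integral>\<^sup>+p. ennreal (real (snd p)) \<partial>measure_pmf (scsg d n fs (\<lambda>_. \<eta>) (\<lambda>_. b) m B x0 (Suc T)))
    = (\<integral>\<^sup>+q. (\<integral>\<^sup>+p. ennreal (real (snd q)) + ennreal (real (snd p))
         \<partial>measure_pmf (scsg_epoch d n fs \<eta> b (m (Suc T)) (B (Suc T)) (fst q)))
         \<partial>measure_pmf (scsg d n fs (\<lambda>_. \<eta>) (\<lambda>_. b) m B x0 T))"
    by (simp add: split_beta)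
  also have "\<dots> = (\<integral>\<^sup>+q. ennreal (real (snd q)) + ennreal (m (Suc T) + real (B (Suc T)))
         \<partial>measure_pmf (scsg d n fs (\<lambda>_. \<eta>) (\<lambda>_. b) m B x0 T))"
    by (subst nn_integral_add) (simp_all only: expected_epoch_cost[OF assms], simp_all)
  also have "\<dots> = ennreal (\<Sum>j<T. m (Suc j) + real (B (Suc j))) + ennreal (m (Suc T) + real (B (Suc T)))"
    by (simp add: nn_integral_add Suc.IH del: ennreal_plus)
  also have "\<dots> = ennreal (\<Sum>j<Suc T. m (Suc j) + real (B (Suc j)))"
    using pos assms(1)[of "Suc T"] by (subst ennreal_plus[symmetric]) auto
  finally show ?case .
qed simp

section \<open>The scalar recursion\<close>

text \<open>\<open>F j\<close> and \<open>X j\<close> are the expected gap and the scaled expected squared distance after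
  \<open>j\<close> epochs; the Young parameter of epoch \<open>j + 1\<close> is \<open>1 / (j + 2)\<close>, so that the losses
  \<open>(j + 1) / (j + 2)\<close> telescope to a factor that is only polynomial in the number of epochs.\<close>

definition descent ::
  "real \<Rightarrow> real \<Rightarrow> real \<Rightarrow> real \<Rightarrow> real \<Rightarrow> real \<Rightarrow> (nat \<Rightarrow> bool) \<Rightarrow> (nat \<Rightarrow> real) \<Rightarrow> (nat \<Rightarrow> real) \<Rightarrow> bool" where
  "descent \<alpha> a w b K H noisy F X \<longleftrightarrow> 0 \<le> H \<and> (\<forall>j. 0 \<le> F j \<and> 0 \<le> X j \<and>
     w * \<alpha> ^ Suc j * F (Suc j) + b * (real (j + 1) / real (j + 2)) * X (Suc j)
       \<le> b * X j + 5 / 6 * a * w * \<alpha> ^ Suc j * F j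
          + (if noisy j then K * real (j + 2) * (2 * F j + H) else 0))"

text \<open>Bernoulli's inequality; the minimum with 1 pays for the additional 1 in
  \<open>T + 1\<close>.\<close>

lemma linear_le_exponential:
  fixes q :: real
  assumes "1 < q"
  shows "real (T + 1) \<le> q ^ T / min 1 (q - 1)"
proof -
  have "min 1 (q - 1) * real (T + 1) = min 1 (q - 1) * real T + min 1 (q - 1)" by (simp add: algebra_simps)
  also have "\<dots> \<le> (q - 1) * real T + 1" by (intro add_mono mult_right_mono) auto
  also have "\<dots> \<le> q ^ T" using Bernoulli_inequality[of "q - 1" T] assms by (simp add: mult.commute)
  finally show ?thesis using assms by (simp add: pos_le_divide_eq mult.commute)
qed

lemma eventually_linear_le_exponential:
  fixes \<alpha> e :: real
  assumes "1 < \<alpha>" "0 < e"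
  obtains j0 where "\<And>j. j0 \<le> j \<Longrightarrow> real (j + 2) \<le> e * \<alpha> ^ j"
proof -
  have "(\<lambda>j. real j * (1 / \<alpha>) ^ j + 2 * (1 / \<alpha>) ^ j) \<longlonglongrightarrow> 0 + 2 * 0"
    using assms by (intro tendsto_intros LIMSEQ_power_zero powser_times_n_limit_0) auto
  then have "\<forall>\<^sub>F j in sequentially. real j * (1 / \<alpha>) ^ j + 2 * (1 / \<alpha>) ^ j < e"
    using assms by (intro order_tendstoD) auto
  then obtain j0 where j0: "\<And>j. j0 \<le> j \<Longrightarrow> real j * (1 / \<alpha>) ^ j + 2 * (1 / \<alpha>) ^ j < e"
    by (auto simp: eventually_sequentially)
  show ?thesis
  proof (rule that)
    fix j assume "j0 \<le> j"
    from j0[OF this] show "real (j + 2) \<le> e * \<alpha> ^ j"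
      using assms by (simp add: power_one_over field_simps)
  qed
qed

text \<open>\<open>Z\<close> combines gap and distance and divides by \<open>j + 1\<close>, so that
  the losses in the distance telescope. As \<open>a * \<alpha> \<le> 1\<close>, the old gap enters
  with at most 5/6 of its weight, and the remaining sixth absorbs the gap part of the noise once
  \<alpha>^j beats \<open>j\<close>; the finitely many earlier epochs cost a factor \<open>R\<close>
  each. The noise \<open>H\<close> adds at most a constant per epoch, so \<open>Z\<close> grows
  linearly from then on, and undoing the division gives the square.\<close>

lemma descent_growth:
  fixes \<alpha> a w b K :: real
  assumes \<alpha>: "1 < \<alpha>" and a: "0 < a" "a * \<alpha> \<le> 1" and w: "0 < w" and b: "0 \<le> b" and K: "0 \<le> K"
  obtains C where "1 \<le> C"
    "\<And>H N F X T. descent \<alpha> a w b K H N F X \<Longrightarrow> F 0 \<le> X 0 / 2 \<Longrightarrow>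
       F T \<le> C * (real (T + 1))\<^sup>2 * (X 0 + H) / \<alpha> ^ T"
proof -
  \<comment> \<open>The 12 makes \<open>2 * K * real (j + 2)\<close> at most a sixth of
    \<open>w * \<alpha> ^ j\<close> from \<open>j0\<close> on.\<close>
  obtain j0 where j0: "\<And>j. j0 \<le> j \<Longrightarrow> real (j + 2) \<le> w / (12 * (K + 1)) * \<alpha> ^ j"
    using eventually_linear_le_exponential[OF \<alpha>, of "w / (12 * (K + 1))"] w K by auto
  define R where "R = 1 + 2 * K * real (j0 + 2) / w"
  have R1: "1 \<le> R" using K w by (simp add: R_def)
  have r: "2 * K * real (j + 2) \<le> ((if j < j0 then R else 1) - 5 / 6) * (w * \<alpha> ^ j)" for j
  proof (cases "j < j0")
    case True
    have "2 * K * real (j + 2) \<le> 2 * K * real (j0 + 2)" using True K by (intro mult_left_mono) auto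
    also have "\<dots> = (R - 1) * (w * 1)" using w by (simp add: R_def)
    also have "\<dots> \<le> (R - 5 / 6) * (w * \<alpha> ^ j)"
      using R1 w \<alpha> by (intro mult_mono mult_left_mono) auto
    finally show ?thesis using True by simp
  next
    case False
    have "2 * K * real (j + 2) \<le> 2 * (K + 1) * (w / (12 * (K + 1)) * \<alpha> ^ j)"
      using j0[of j] False K by (intro mult_mono) auto
    also have "\<dots> = (1 - 5 / 6) * (w * \<alpha> ^ j)" using K by (simp add: field_simps)
    finally show ?thesis using False by simp
  qed
  define C where "C = max 1 (R ^ j0 * (w / 2 + b + 2 * K) / w)"
  show ?thesis
  proof (rule that[of C])
    show "1 \<le> C" by (simp add: C_def)
    fix H N F X T
    assume D: "descent \<alpha> a w b K H N F X" and F0: "F 0 \<le> X 0 / 2"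
    have H: "0 \<le> H" and FX: "\<And>j. 0 \<le> F j" "\<And>j. 0 \<le> X j" using D by (auto simp: descent_def)
    define Z where "Z j = (w * \<alpha> ^ j * F j + b * X j) / real (j + 1)" for j
    have Z0: "0 \<le> Z j" for j unfolding Z_def using w b \<alpha> FX by simp
    have step: "Z (Suc j) \<le> (if j < j0 then R else 1) * Z j + 2 * K * H" for j
    proof -
      let ?r = "if j < j0 then R else 1"
      have "real (j + 1) * Z (Suc j) = real (j + 1) / real (j + 2) * (w * \<alpha> ^ Suc j * F (Suc j) + b * X (Suc j))"
        by (simp add: Z_def)
      also have "\<dots> \<le> w * \<alpha> ^ Suc j * F (Suc j) + b * (real (j + 1) / real (j + 2)) * X (Suc j)"
      proof -
        have "real (j + 1) / real (j + 2) * (w * \<alpha> ^ Suc j * F (Suc j)) \<le> 1 * (w * \<alpha> ^ Suc j * F (Suc j))"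
          using w \<alpha> FX by (intro mult_right_mono) auto
        then show ?thesis by (simp add: distrib_left mult_ac)
      qed
      also have "\<dots> \<le> b * X j + 5 / 6 * a * w * \<alpha> ^ Suc j * F j + K * real (j + 2) * (2 * F j + H)"
      proof -
        have "(if N j then K * real (j + 2) * (2 * F j + H) else 0) \<le> K * real (j + 2) * (2 * F j + H)"
          using K FX H by simp
        then show ?thesis using D unfolding descent_def by (smt (verit))
      qed
      also have "\<dots> \<le> b * X j + 5 / 6 * (w * \<alpha> ^ j * F j) + 2 * K * real (j + 2) * F j + K * real (j + 2) * H"
      proof -
        have "(a * \<alpha>) * (w * \<alpha> ^ j * F j) \<le> 1 * (w * \<alpha> ^ j * F j)"
          using a w \<alpha> FX by (intro mult_right_mono) auto
        then show ?thesis by (simp add: algebra_simps)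
      qed
      also have "\<dots> \<le> ?r * (w * \<alpha> ^ j * F j + b * X j) + K * real (j + 2) * H"
      proof -
        have "2 * K * real (j + 2) * F j \<le> (?r - 5 / 6) * (w * \<alpha> ^ j) * F j"
          by (intro mult_right_mono r FX)
        moreover have "1 * (b * X j) \<le> ?r * (b * X j)" using R1 b FX by (intro mult_right_mono) auto
        ultimately show ?thesis by (simp only: left_diff_distrib distrib_left mult.assoc)
      qed
      also have "?r * (w * \<alpha> ^ j * F j + b * X j) + K * real (j + 2) * H
          \<le> real (j + 1) * (?r * Z j + 2 * K * H)"
      proof -
        have "w * \<alpha> ^ j * F j + b * X j = real (j + 1) * Z j" by (simp add: Z_def)
        moreover have "K * real (j + 2) * H \<le> K * (2 * real (j + 1)) * H"
          using K H by (intro mult_right_mono mult_left_mono) auto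
        ultimately show ?thesis by (simp add: distrib_left mult_ac)
      qed
      finally show ?thesis by (rule mult_left_le_imp_le) simp
    qed
    have Z: "Z j \<le> R ^ min j j0 * (Z 0 + 2 * K * real j * H)" for j
    proof (induction j)
      case (Suc j)
      let ?r = "if j < j0 then R else 1"
      have "Z (Suc j) \<le> ?r * Z j + 2 * K * H" by (rule step)
      also have "\<dots> \<le> ?r * (R ^ min j j0 * (Z 0 + 2 * K * real j * H)) + R ^ min (Suc j) j0 * (2 * K * H)"
        using Suc.IH R1 K H mult_right_mono[of 1 "R ^ min (Suc j) j0" "2 * K * H"] one_le_power[OF R1]
        by (intro add_mono mult_left_mono) auto
      also have "?r * (R ^ min j j0 * (Z 0 + 2 * K * real j * H)) = R ^ min (Suc j) j0 * (Z 0 + 2 * K * real j * H)"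
        by (cases "j < j0") (simp_all add: min_absorb1 min_absorb2 Suc_le_eq not_less mult.assoc)
      finally show ?case by (simp add: algebra_simps)
    qed simp
    have "w * \<alpha> ^ T * F T \<le> real (T + 1) * Z T" using b FX by (simp add: Z_def)
    also have "\<dots> \<le> real (T + 1) * (R ^ j0 * (Z 0 + 2 * K * real T * H))"
    proof (intro mult_left_mono order_trans[OF Z])
      show "R ^ min T j0 * (Z 0 + 2 * K * real T * H) \<le> R ^ j0 * (Z 0 + 2 * K * real T * H)"
        using Z0[of 0] K H R1 by (intro mult_right_mono power_increasing) auto
    qed simp
    also have "\<dots> \<le> real (T + 1) * (R ^ j0 * ((w / 2 + b + 2 * K) * (real (T + 1) * (X 0 + H))))"
    proof (intro mult_left_mono)
      have "Z 0 \<le> (w / 2 + b) * X 0" using F0 w by (simp add: Z_def algebra_simps)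
      also have "\<dots> \<le> (w / 2 + b + 2 * K) * (real (T + 1) * X 0)"
        using w b K FX(2)[of 0] mult_right_mono[of 1 "real (T + 1)" "X 0"] by (intro mult_mono) auto
      finally have "Z 0 \<le> (w / 2 + b + 2 * K) * (real (T + 1) * X 0)" .
      moreover have "2 * K * (real T * H) \<le> (w / 2 + b + 2 * K) * (real (T + 1) * H)"
        using w b K H by (intro mult_mono) auto
      ultimately show "Z 0 + 2 * K * real T * H \<le> (w / 2 + b + 2 * K) * (real (T + 1) * (X 0 + H))"
        by (simp add: distrib_left mult.assoc)
    qed (use R1 in auto)
    finally have "F T \<le> (R ^ j0 * (w / 2 + b + 2 * K) / w) * ((real (T + 1))\<^sup>2 * (X 0 + H) / \<alpha> ^ T)"
      using w \<alpha> by (simp add: power2_eq_square field_simps)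
    also have "\<dots> \<le> C * ((real (T + 1))\<^sup>2 * (X 0 + H) / \<alpha> ^ T)"
      using \<alpha> H FX(2)[of 0] by (intro mult_right_mono) (auto simp: C_def)
    finally show "F T \<le> C * (real (T + 1))\<^sup>2 * (X 0 + H) / \<alpha> ^ T" by (simp add: mult.assoc)
  qed
qed

text \<open>Under \<open>X j \<le> 2 * \<kappa> * F j\<close> the distance is a multiple of the gap,
  small against \<open>a * w * \<alpha> ^ Suc j\<close> once \<open>\<alpha> ^ J\<close> reaches
  \<open>C0 * \<kappa>\<close>. The free sixth of the factor \<open>a\<close> is shared equally
  between this term and the gap part of the noise. The noise from \<open>H\<close> decays like
  1/\<alpha>^j up to a linear factor and is not amplified later because
  \<open>a * \<alpha> \<le> 1\<close>, so it adds up to a quadratic factor only.\<close>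

lemma descent_contraction:
  fixes \<alpha> a w b K :: real
  assumes \<alpha>: "1 < \<alpha>" and a: "0 < a" "a * \<alpha> \<le> 1" and w: "0 < w" and b: "0 \<le> b" and K: "0 \<le> K"
  obtains C0 C1 where "1 \<le> C0" "0 \<le> C1"
    "\<And>H N F X \<kappa> J T. descent \<alpha> a w b K H N F X \<Longrightarrow> 1 \<le> \<kappa> \<Longrightarrow> (\<And>j. X j \<le> 2 * \<kappa> * F j) \<Longrightarrow>
       C0 * \<kappa> \<le> \<alpha> ^ J \<Longrightarrow> J \<le> T \<Longrightarrow>
       F T \<le> a ^ (T - J) * F J + (if \<forall>j\<ge>J. \<not> N j then 0 else C1 * (real (T + 1))\<^sup>2 * H / \<alpha> ^ T)"
proof -
  obtain j1 where j1: "\<And>j. j1 \<le> j \<Longrightarrow> real (j + 2) \<le> a * w / (24 * (K + 1)) * \<alpha> ^ j"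
    using eventually_linear_le_exponential[OF \<alpha>, of "a * w / (24 * (K + 1))"] a w K by auto
  \<comment> \<open>The first entry makes \<open>2 * b * \<kappa>\<close> at most a twelfth of
    \<open>a * w * \<alpha> ^ J\<close>; the second forces \<open>j1 \<le> J\<close>, since
    \<open>1 \<le> \<kappa>\<close>.\<close>
  define C0 where "C0 = max (24 * b / (a * w)) (\<alpha> ^ j1)"
  have C0: "24 * b / (a * w) \<le> C0" "\<alpha> ^ j1 \<le> C0" by (auto simp: C0_def)
  define C1 where "C1 = K / w"
  show ?thesis
  proof (rule that[of C0 C1])
    show "1 \<le> C0" using C0(2) one_le_power[of \<alpha> j1] \<alpha> by linarith
    then have C01: "1 \<le> C0" .
    show "0 \<le> C1" using K w by (simp add: C1_def)
    then have C10: "0 \<le> C1" .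
    fix H N F X \<kappa> J T
    assume D: "descent \<alpha> a w b K H N F X" and \<kappa>: "1 \<le> \<kappa>" and X: "\<And>j. X j \<le> 2 * \<kappa> * F j"
      and J: "C0 * \<kappa> \<le> \<alpha> ^ J" and T: "J \<le> T"
    have H: "0 \<le> H" and FX: "\<And>j. 0 \<le> F j" "\<And>j. 0 \<le> X j" using D by (auto simp: descent_def)
    have "\<alpha> ^ j1 \<le> C0 * 1" using C0 by simp
    also have "\<dots> \<le> C0 * \<kappa>" using C01 \<kappa> by (intro mult_left_mono) auto
    finally have "\<alpha> ^ j1 \<le> \<alpha> ^ J" using J by simp
    then have j1J: "j1 \<le> J" using \<alpha> power_increasing_iff by blast
    have step: "F (Suc j) \<le> a * F j + (if N j then C1 * real (j + 2) * H / \<alpha> ^ Suc j else 0)" if "J \<le> j" for j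
    proof -
      let ?E = "if N j then K * real (j + 2) * H else 0"
      have pj: "\<alpha> ^ J \<le> \<alpha> ^ j" using that \<alpha> by (intro power_increasing) auto
      have pS: "\<alpha> ^ j \<le> \<alpha> ^ Suc j" using \<alpha> by (intro power_increasing) auto
      have "w * \<alpha> ^ Suc j * F (Suc j)
          \<le> w * \<alpha> ^ Suc j * F (Suc j) + b * (real (j + 1) / real (j + 2)) * X (Suc j)"
        using b FX by simp
      also have "\<dots> \<le> b * X j + 5 / 6 * a * w * \<alpha> ^ Suc j * F j
          + (if N j then K * real (j + 2) * (2 * F j + H) else 0)"
        using D unfolding descent_def by blast
      also have "\<dots> \<le> b * X j + 5 / 6 * a * w * \<alpha> ^ Suc j * F j + (2 * K * real (j + 2) * F j + ?E)"
        using K FX by (simp add: algebra_simps)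
      also have "b * X j \<le> (1 / 12 * a * w * \<alpha> ^ Suc j) * F j"
      proof -
        have "b * X j \<le> b * (2 * \<kappa> * F j)" by (intro mult_left_mono X b)
        also have "\<dots> = (24 * b / (a * w) * \<kappa>) * (1 / 12 * a * w * F j)" using a w by simp
        also have "\<dots> \<le> \<alpha> ^ Suc j * (1 / 12 * a * w * F j)"
        proof (intro mult_right_mono)
          have "24 * b / (a * w) * \<kappa> \<le> C0 * \<kappa>" using C0 \<kappa> by (intro mult_right_mono) auto
          then show "24 * b / (a * w) * \<kappa> \<le> \<alpha> ^ Suc j" using J pj pS by linarith
        qed (use a w FX in simp)
        finally show ?thesis by (simp add: mult_ac)
      qed
      also have "2 * K * real (j + 2) * F j \<le> (1 / 12 * a * w * \<alpha> ^ Suc j) * F j"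
      proof (intro mult_right_mono FX)
        have "2 * K * real (j + 2) \<le> 2 * (K + 1) * (a * w / (24 * (K + 1)) * \<alpha> ^ Suc j)"
        proof (intro mult_mono)
          have "a * w / (24 * (K + 1)) * \<alpha> ^ j \<le> a * w / (24 * (K + 1)) * \<alpha> ^ Suc j"
            using a w K by (intro mult_left_mono pS) auto
          then show "real (j + 2) \<le> a * w / (24 * (K + 1)) * \<alpha> ^ Suc j"
            using j1[of j] that j1J by linarith
        qed (use K in auto)
        also have "\<dots> = 1 / 12 * a * w * \<alpha> ^ Suc j" using K by (simp add: field_simps)
        finally show "2 * K * real (j + 2) \<le> 1 / 12 * a * w * \<alpha> ^ Suc j" .
      qed
      finally have "w * \<alpha> ^ Suc j * F (Suc j) \<le> w * \<alpha> ^ Suc j * (a * F j) + ?E"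
        by (simp add: field_simps)
      also have "\<dots> = w * \<alpha> ^ Suc j * (a * F j + (if N j then C1 * real (j + 2) * H / \<alpha> ^ Suc j else 0))"
        using w \<alpha> by (simp add: C1_def distrib_left)
      finally show ?thesis using w \<alpha> by (simp only: mult_le_cancel_left_pos mult_pos_pos zero_less_power less_trans[OF zero_less_one])
    qed
    let ?noise = "\<lambda>T. if \<forall>j\<ge>J. \<not> N j then 0 else C1 * (real (T + 1))\<^sup>2 * H / \<alpha> ^ T"
    have "F (J + t) \<le> a ^ t * F J + ?noise (J + t)" for t
    proof (induction t)
      case 0
      then show ?case using C10 H \<alpha> by simp
    next
      case (Suc t)
      have "F (J + Suc t) \<le> a * F (J + t) + (if N (J + t) then C1 * real (J + t + 2) * H / \<alpha> ^ Suc (J + t) else 0)"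
        using step[of "J + t"] by simp
      also have "\<dots> \<le> a * (a ^ t * F J + ?noise (J + t))
          + (if N (J + t) then C1 * real (J + t + 2) * H / \<alpha> ^ Suc (J + t) else 0)"
        using Suc.IH a by (intro add_right_mono mult_left_mono) auto
      also have "\<dots> = a ^ Suc t * F J + (a * ?noise (J + t)
          + (if N (J + t) then C1 * real (J + t + 2) * H / \<alpha> ^ Suc (J + t) else 0))"
        by (simp add: distrib_left)
      also have "a * ?noise (J + t) + (if N (J + t) then C1 * real (J + t + 2) * H / \<alpha> ^ Suc (J + t) else 0)
          \<le> ?noise (J + Suc t)"
      proof (cases "\<forall>j\<ge>J. \<not> N j")
        case True
        then show ?thesis by simp
      next
        case False
        let ?k = "J + t"
        let ?c = "C1 * H / \<alpha> ^ Suc ?k"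
        have c0: "0 \<le> ?c" using C10 H \<alpha> by simp
        have "a * (C1 * (real (?k + 1))\<^sup>2 * H / \<alpha> ^ ?k) = (a * \<alpha>) * ((real (?k + 1))\<^sup>2 * ?c)"
          using \<alpha> by simp
        also have "\<dots> \<le> 1 * ((real (?k + 1))\<^sup>2 * ?c)"
          by (rule mult_right_mono[OF a(2) mult_nonneg_nonneg[OF zero_le_power2 c0]])
        finally have 1: "a * ?noise ?k \<le> (real (?k + 1))\<^sup>2 * ?c" unfolding if_not_P[OF False] by simp
        have "(if N ?k then C1 * real (?k + 2) * H / \<alpha> ^ Suc ?k else 0) \<le> real (?k + 2) * ?c"
          using mult_nonneg_nonneg[OF of_nat_0_le_iff c0, of "?k + 2"] by (simp add: mult_ac)
        with 1 have "a * ?noise ?k + (if N ?k then C1 * real (?k + 2) * H / \<alpha> ^ Suc ?k else 0)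
            \<le> (real (?k + 1))\<^sup>2 * ?c + real (?k + 2) * ?c"
          by (rule add_mono)
        also have "\<dots> = ((real (?k + 1))\<^sup>2 + real (?k + 2)) * ?c" by (simp only: distrib_right)
        \<comment> \<open>The new linear noise term fits into the gap between consecutive squares,
          so the quadratic factor reproduces itself.\<close>
        also have "\<dots> \<le> (real (?k + 2))\<^sup>2 * ?c"
          using c0 by (intro mult_right_mono) (auto simp: power2_eq_square algebra_simps)
        finally show ?thesis unfolding if_not_P[OF False] by (simp add: mult_ac)
      qed
      finally show ?case by simp
    qed
    from this[of "T - J"] T show "F T \<le> a ^ (T - J) * F J + ?noise T"
      by (simp only: le_add_diff_inverse)
  qed
qed

section \<open>Accuracy thresholds\<close>

lemma geometric_sum_le:
  fixes q :: real
  assumes "1 < q"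
  shows "(\<Sum>j<T. q ^ Suc j) \<le> q / (q - 1) * q ^ T"
proof (induction T)
  case (Suc T)
  have "(\<Sum>j<Suc T. q ^ Suc j) \<le> q / (q - 1) * q ^ T + q ^ Suc T" using Suc by simp
  also have "\<dots> = q / (q - 1) * q ^ Suc T" using assms by (simp add: field_simps)
  finally show ?case .
qed (use assms in simp)

text \<open>Removes the epoch count from the accuracy conditions: if \<open>T\<close> is not
  logarithmic in \<open>r\<close>, then \<alpha>^T already dominates the given multiple of (T + 1)^2
  r. Splitting \<alpha> into four factors \<open>q\<close> lets two of them beat the square and the
  other two beat \<open>r\<close>.\<close>

lemma quadratic_or_exponential:
  fixes \<alpha> C :: real
  assumes \<alpha>: "1 < \<alpha>" and C: "1 \<le> C"
  obtains C2 where "1 \<le> C2"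
    "\<And>r T. 1 \<le> r \<Longrightarrow> (real (T + 1))\<^sup>2 \<le> C2 * (1 + ln r)\<^sup>2 \<or> 2 * C * (real (T + 1))\<^sup>2 * r \<le> \<alpha> ^ T"
proof -
  define q where "q = \<alpha> powr (1 / 4)"
  have q: "1 < q" using \<alpha> by (simp add: q_def)
  have q4: "q ^ 4 = \<alpha>" using \<alpha> by (simp add: q_def powr_powr flip: powr_numeral)
  define \<delta> where "\<delta> = min 1 (q - 1)"
  have \<delta>: "0 < \<delta>" "\<delta> \<le> 1" using q by (auto simp: \<delta>_def)
  define M where "M = 2 * C / \<delta>\<^sup>2"
  have "\<delta>\<^sup>2 \<le> 1" using \<delta> by (simp add: power_le_one)
  then have M: "1 \<le> M" using C \<delta> by (simp add: M_def field_simps)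
  define c where "c = 1 + (ln M + 1) / (2 * ln q)"
  have lnq: "0 < ln q" using q by simp
  have lnM: "0 \<le> ln M" using M by simp
  have c: "1 \<le> c" using lnq lnM by (simp add: c_def)
  show ?thesis
  proof (rule that[of "c\<^sup>2"])
    show "1 \<le> c\<^sup>2" using c by (simp add: one_le_power)
    fix r :: real and T :: nat assume r: "1 \<le> r"
    have lnr: "0 \<le> ln r" using r by simp
    show "(real (T + 1))\<^sup>2 \<le> c\<^sup>2 * (1 + ln r)\<^sup>2 \<or> 2 * C * (real (T + 1))\<^sup>2 * r \<le> \<alpha> ^ T"
    proof (cases "M * r \<le> (q ^ T)\<^sup>2")
      case True
      have "(real (T + 1))\<^sup>2 \<le> (q ^ T / \<delta>)\<^sup>2"
        using linear_le_exponential[OF q, of T] by (intro power_mono) (auto simp: \<delta>_def)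
      then have "2 * C * r * (real (T + 1))\<^sup>2 \<le> 2 * C * r * (q ^ T / \<delta>)\<^sup>2"
        using C r by (intro mult_left_mono) auto
      also have "\<dots> = (M * r) * (q ^ T)\<^sup>2" by (simp add: M_def power_divide)
      also have "\<dots> \<le> (q ^ T)\<^sup>2 * (q ^ T)\<^sup>2" using True by (intro mult_right_mono) auto
      also have "\<dots> = (q ^ 4) ^ T" by (simp flip: power_mult power_add add: mult.commute)
      finally show ?thesis by (simp add: q4 mult_ac)
    next
      case False
      moreover have "0 < (q ^ T)\<^sup>2" using q by simp
      ultimately have "ln ((q ^ T)\<^sup>2) < ln (M * r)" by (subst ln_less_cancel_iff) linarith+
      then have "2 * (real T * ln q) < ln M + ln r"
        using q M r by (simp add: ln_mult ln_realpow)
      also have "\<dots> \<le> (ln M + 1) * (1 + ln r)" using lnM lnr by (simp add: algebra_simps)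
      finally have "real T \<le> (ln M + 1) / (2 * ln q) * (1 + ln r)"
        using lnq by (simp add: field_simps)
      then have "real (T + 1) \<le> c * (1 + ln r)" using lnr by (simp add: c_def algebra_simps)
      then have "(real (T + 1))\<^sup>2 \<le> (c * (1 + ln r))\<^sup>2" by (intro power_mono) auto
      then show ?thesis by (simp add: power_mult_distrib)
    qed
  qed
qed

text \<open>The origin of the exponent \<xi>: each epoch after \<open>J\<close> multiplies
  \<open>\<alpha> ^ T\<close> by \<alpha> and the gap by
  \<open>\<alpha> powr (- (1 / \<xi>))\<close>, so a factor \<open>s\<close> in accuracy costs a
  factor \<open>s powr \<xi>\<close>. \<open>J\<close> is the least admissible epoch and overshoots
  \<open>C0 * k\<close> by at most the factor \<alpha>, which the hypothesis on \<open>T\<close>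
  provides. For \<open>c * P\<close> the exponent is simply weakened to -1.\<close>

lemma contraction_start:
  fixes \<alpha> \<xi> C0 k s P c :: real
  assumes \<alpha>: "1 < \<alpha>" and \<xi>: "0 < \<xi>" "\<xi> < 1" and C0: "1 \<le> C0" and k: "1 \<le> k" and s: "1 \<le> s"
    and P: "1 \<le> P" and c: "1 \<le> c"
    and T: "\<alpha> * C0 * c * P * (k * s powr \<xi>) \<le> \<alpha> ^ T"
  obtains J where "J \<le> T" "C0 * k \<le> \<alpha> ^ J" "(\<alpha> powr (- (1 / \<xi>))) ^ (T - J) \<le> 1 / (c * P * s)"
proof -
  define J where "J = (LEAST j. C0 * k \<le> \<alpha> ^ j)"
  obtain j where "C0 * k < \<alpha> ^ j" using real_arch_pow[OF \<alpha>] by blast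
  then have J: "C0 * k \<le> \<alpha> ^ J" unfolding J_def by (rule LeastI[OF less_imp_le])
  have Ck: "1 \<le> C0 * k" using mult_mono[of 1 C0 1 k] C0 k by simp
  have Ju: "\<alpha> ^ J \<le> \<alpha> * (C0 * k)"
  proof (cases J)
    case 0
    then show ?thesis using mult_mono[of 1 \<alpha> 1 "C0 * k"] \<alpha> Ck by simp
  next
    case (Suc i)
    then have "\<not> C0 * k \<le> \<alpha> ^ i" unfolding J_def using not_less_Least by (metis lessI)
    then show ?thesis using Suc \<alpha> by simp
  qed
  have cP: "1 \<le> c * P" using mult_mono[of 1 c 1 P] c P by simp
  have sx: "1 \<le> s powr \<xi>" using s \<xi> by (simp add: ge_one_powr_ge_zero)
  have cPs: "1 \<le> c * P * s powr \<xi>" using mult_mono[OF cP sx] cP by simp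
  have T': "\<alpha> * (C0 * k) * (c * P * s powr \<xi>) \<le> \<alpha> ^ T" using T by (simp add: mult_ac)
  have "\<alpha> ^ J \<le> \<alpha> * (C0 * k) * 1" using Ju by simp
  also have "\<dots> \<le> \<alpha> * (C0 * k) * (c * P * s powr \<xi>)" using cPs \<alpha> Ck by (intro mult_left_mono) auto
  finally have "\<alpha> ^ J \<le> \<alpha> ^ T" using T' by linarith
  then have JT: "J \<le> T" using \<alpha> power_increasing_iff by blast
  have "\<alpha> ^ J * (c * P * s powr \<xi>) \<le> \<alpha> ^ T"
    using mult_right_mono[OF Ju, of "c * P * s powr \<xi>"] cPs T' by linarith
  also have "\<alpha> ^ T = \<alpha> ^ J * \<alpha> ^ (T - J)" using JT by (simp flip: power_add)
  finally have le: "c * P * s powr \<xi> \<le> \<alpha> ^ (T - J)" using \<alpha> by simp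
  have "(\<alpha> powr (- (1 / \<xi>))) ^ (T - J) = (\<alpha> ^ (T - J)) powr (- (1 / \<xi>))"
    using \<alpha> by (simp add: powr_powr mult.commute flip: powr_realpow)
  also have "\<dots> \<le> (c * P * s powr \<xi>) powr (- (1 / \<xi>))"
    using le cPs \<xi> by (intro powr_mono2') auto
  also have "\<dots> = (c * P) powr (- (1 / \<xi>)) * s powr (- 1)"
    using cP s \<xi> by (simp add: powr_mult powr_powr)
  also have "\<dots> \<le> (c * P) powr (- 1) * s powr (- 1)"
    using cP \<xi> by (intro mult_right_mono powr_mono) auto
  also have "\<dots> = 1 / (c * P * s)" using cP s by (simp add: powr_minus_divide)
  finally show ?thesis using that JT J by blast
qed

lemma threshold_general:
  fixes \<alpha> C e Dx DH \<epsilon> :: real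
  assumes \<alpha>: "1 < \<alpha>" and C: "1 \<le> C" and \<epsilon>: "0 < \<epsilon>"
    and e: "e \<le> C * (real (T + 1))\<^sup>2 * (Dx + DH) / \<alpha> ^ T"
    and T: "2 * C * (real (T + 1))\<^sup>2 * (max Dx DH / \<epsilon>) \<le> \<alpha> ^ T"
  shows "e \<le> \<epsilon>"
proof -
  have "2 * C * (real (T + 1))\<^sup>2 * (max Dx DH / \<epsilon>) * \<epsilon> \<le> \<alpha> ^ T * \<epsilon>"
    using \<epsilon> T by (intro mult_right_mono) auto
  moreover have "max Dx DH / \<epsilon> * \<epsilon> = max Dx DH" using \<epsilon> by simp
  ultimately have "2 * C * (real (T + 1))\<^sup>2 * max Dx DH \<le> \<alpha> ^ T * \<epsilon>" by (simp only: mult.assoc)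
  moreover have "C * (real (T + 1))\<^sup>2 * (Dx + DH) \<le> C * (real (T + 1))\<^sup>2 * (2 * max Dx DH)"
    using C by (intro mult_left_mono) auto
  ultimately have "C * (real (T + 1))\<^sup>2 * (Dx + DH) \<le> \<epsilon> * \<alpha> ^ T" by (simp add: mult_ac)
  then have "C * (real (T + 1))\<^sup>2 * (Dx + DH) / \<alpha> ^ T \<le> \<epsilon>" using \<alpha> by (simp add: pos_divide_le_eq)
  then show ?thesis using e by linarith
qed

text \<open>Two thirds of \<epsilon> are used. The \<open>Dx\<close> part of the gap at
  \<open>J\<close> is contracted to one third, with \<open>s\<close> the factor by which
  \<open>Dx / k\<close> exceeds \<epsilon>. The \<open>DH\<close> part shrinks by at least
  1/\<alpha> per epoch, so it has the same order as the accumulated noise; the summand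
  \<open>DH / \<epsilon>\<close> of the hypothesis makes both together at most another
  third.\<close>

lemma threshold_strongly_convex:
  fixes \<alpha> C P Dx DH \<epsilon> :: real and E :: "nat \<Rightarrow> real"
  assumes \<alpha>: "1 < \<alpha>" and \<xi>: "0 < \<xi>" "\<xi> < 1" and C: "1 \<le> C" and C0: "1 \<le> C0" and C1: "0 \<le> C1"
    and \<epsilon>: "0 < \<epsilon>" and D: "0 \<le> Dx" "0 \<le> DH" and k: "1 \<le> k"
    and P: "(real (T + 1))\<^sup>2 \<le> P"
    and E: "\<And>J. J \<le> T \<Longrightarrow> C0 * k \<le> \<alpha> ^ J \<Longrightarrow>
      E T \<le> (\<alpha> powr (- (1 / \<xi>))) ^ (T - J) * (C * (real (J + 1))\<^sup>2 * (Dx + DH) / \<alpha> ^ J)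
        + C1 * (real (T + 1))\<^sup>2 * DH / \<alpha> ^ T"
    and T: "\<alpha> * C0 * (3 * (C + C1)) * P * (k * star_pow (Dx / (\<epsilon> * k)) \<xi> + DH / \<epsilon>) \<le> \<alpha> ^ T"
  shows "E T \<le> \<epsilon>"
proof -
  define c where "c = 3 * (C + C1)"
  define s where "s = max (Dx / (\<epsilon> * k)) 1"
  have c: "1 \<le> c" using C C1 by (simp add: c_def)
  have s: "1 \<le> s" by (simp add: s_def)
  have P1: "1 \<le> P" using P by (smt (verit) of_nat_0_le_iff of_nat_1 of_nat_add one_le_power)
  have f0: "0 \<le> \<alpha> * C0 * c * P" using \<alpha> C0 c P1 by simp
  have T': "\<alpha> * C0 * c * P * (k * s powr \<xi>) + \<alpha> * C0 * c * P * (DH / \<epsilon>) \<le> \<alpha> ^ T"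
    using T by (simp add: c_def s_def star_pow_def distrib_left)
  have "0 \<le> \<alpha> * C0 * c * P * (DH / \<epsilon>)" using f0 D \<epsilon> by simp
  then have "\<alpha> * C0 * c * P * (k * s powr \<xi>) \<le> \<alpha> ^ T" using T' by linarith
  then obtain J where J: "J \<le> T" "C0 * k \<le> \<alpha> ^ J" and aJ: "(\<alpha> powr (- (1 / \<xi>))) ^ (T - J) \<le> 1 / (c * P * s)"
    using contraction_start[OF \<alpha> \<xi> C0 k s P1 c] by blast
  let ?a = "\<alpha> powr (- (1 / \<xi>))"
  have a0: "0 < ?a" using \<alpha> by simp
  have "(real (J + 1))\<^sup>2 \<le> (real (T + 1))\<^sup>2" using J by (intro power_mono) auto
  then have J2: "(real (J + 1))\<^sup>2 \<le> P" using P by linarith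
  have kJ: "k \<le> \<alpha> ^ J" using mult_right_mono[OF C0, of k] J k by linarith
  have 1: "?a ^ (T - J) * (C * (real (J + 1))\<^sup>2 * Dx / \<alpha> ^ J) \<le> \<epsilon> / 3"
  proof -
    have "?a ^ (T - J) * (C * (real (J + 1))\<^sup>2 * Dx / \<alpha> ^ J) \<le> 1 / (c * P * s) * (C * P * Dx / k)"
      using aJ J2 kJ C D k c P1 s \<alpha> by (intro mult_mono frac_le mult_right_mono mult_left_mono) auto
    also have "\<dots> = C / c * (Dx / (k * s))" using P1 by simp
    also have "\<dots> \<le> 1 / 3 * \<epsilon>"
    proof (intro mult_mono)
      show "C / c \<le> 1 / 3" using C C1 by (simp add: c_def field_simps)
      have "Dx / (\<epsilon> * k) \<le> s" by (simp add: s_def)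
      then show "Dx / (k * s) \<le> \<epsilon>" using \<epsilon> k s by (simp add: field_simps)
    qed (use D k s in auto)
    finally show ?thesis by simp
  qed
  have cPD: "(C + C1) * P * DH / \<alpha> ^ T \<le> \<epsilon> / 3"
  proof -
    have "1 * (c * P * (DH / \<epsilon>)) \<le> \<alpha> * C0 * (c * P * (DH / \<epsilon>))"
      using mult_mono[of 1 \<alpha> 1 C0] \<alpha> C0 c P1 D \<epsilon> by (intro mult_right_mono) auto
    moreover have "0 \<le> \<alpha> * C0 * c * P * (k * s powr \<xi>)" using f0 k by simp
    ultimately have "c * P * (DH / \<epsilon>) \<le> \<alpha> ^ T" using T' by (simp only: mult.assoc mult_1_left)
    then show ?thesis using \<alpha> \<epsilon> by (simp add: c_def field_simps)
  qed
  have 2: "?a ^ (T - J) * (C * (real (J + 1))\<^sup>2 * DH / \<alpha> ^ J) \<le> C * P * DH / \<alpha> ^ T"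
  proof -
    have "?a \<le> \<alpha> powr (- 1)" using \<alpha> \<xi> by (intro powr_mono) auto
    then have "?a \<le> 1 / \<alpha>" using \<alpha> by (simp add: powr_minus_divide)
    then have "?a ^ (T - J) \<le> (1 / \<alpha>) ^ (T - J)" using a0 by (intro power_mono) auto
    then have "?a ^ (T - J) * (C * (real (J + 1))\<^sup>2 * DH / \<alpha> ^ J) \<le> (1 / \<alpha>) ^ (T - J) * (C * P * DH / \<alpha> ^ J)"
      using J2 C D \<alpha> by (intro mult_mono divide_right_mono mult_right_mono mult_left_mono) auto
    also have "\<dots> = C * P * DH / (\<alpha> ^ (T - J) * \<alpha> ^ J)" by (simp add: power_one_over)
    also have "\<alpha> ^ (T - J) * \<alpha> ^ J = \<alpha> ^ T" using J by (simp flip: power_add)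
    finally show ?thesis .
  qed
  have 3: "C1 * (real (T + 1))\<^sup>2 * DH / \<alpha> ^ T \<le> C1 * P * DH / \<alpha> ^ T"
    using P C1 D \<alpha> by (intro divide_right_mono mult_right_mono mult_left_mono) auto
  have "E T \<le> ?a ^ (T - J) * (C * (real (J + 1))\<^sup>2 * (Dx + DH) / \<alpha> ^ J) + C1 * (real (T + 1))\<^sup>2 * DH / \<alpha> ^ T"
    by (rule E[OF J])
  also have "\<dots> = ?a ^ (T - J) * (C * (real (J + 1))\<^sup>2 * Dx / \<alpha> ^ J)
     + ?a ^ (T - J) * (C * (real (J + 1))\<^sup>2 * DH / \<alpha> ^ J) + C1 * (real (T + 1))\<^sup>2 * DH / \<alpha> ^ T"
    by (simp add: distrib_left add_divide_distrib)
  also have "\<dots> \<le> \<epsilon> / 3 + C * P * DH / \<alpha> ^ T + C1 * P * DH / \<alpha> ^ T" using 1 2 3 by linarith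
  also have "\<dots> = \<epsilon> / 3 + (C + C1) * P * DH / \<alpha> ^ T" by (simp add: distrib_right add_divide_distrib)
  also have "\<dots> \<le> \<epsilon> / 3 + \<epsilon> / 3" using cPD by simp
  finally show ?thesis using \<epsilon> by simp
qed

text \<open>Once full gradients are used there is no variance term, which is the previous lemma with
  \<open>DH = 0\<close> and \<open>D\<close> in place of \<open>Dx\<close>.\<close>

lemma threshold_full_batch:
  fixes \<alpha> C P Dx DH \<epsilon> :: real and E :: "nat \<Rightarrow> real"
  assumes \<alpha>: "1 < \<alpha>" and \<xi>: "0 < \<xi>" "\<xi> < 1" and C: "1 \<le> C" and C0: "1 \<le> C0"
    and \<epsilon>: "0 < \<epsilon>" and D: "0 \<le> Dx" "0 \<le> DH" and k: "1 \<le> k"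
    and P: "(real (T + 1))\<^sup>2 \<le> P"
    and E: "\<And>J. J \<le> T \<Longrightarrow> C0 * k \<le> \<alpha> ^ J \<Longrightarrow>
      E T \<le> (\<alpha> powr (- (1 / \<xi>))) ^ (T - J) * (C * (real (J + 1))\<^sup>2 * (Dx + DH) / \<alpha> ^ J)"
    and T: "\<alpha> * C0 * (6 * C) * P * (k * star_pow (max Dx DH / (\<epsilon> * k)) \<xi>) \<le> \<alpha> ^ T"
  shows "E T \<le> \<epsilon>"
\<comment> \<open>\<open>C\<close> is doubled because \<open>Dx + DH \<le> 2 * max Dx DH\<close>;
  hence the 6 in place of 3 in the hypothesis.\<close>
proof (rule threshold_strongly_convex[where C = "2 * C" and ?C1.0 = 0 and DH = 0 and Dx = "max Dx DH"
      and k = k and P = P and ?C0.0 = C0, OF \<alpha> \<xi>])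
  fix J assume J: "J \<le> T" "C0 * k \<le> \<alpha> ^ J"
  have "(\<alpha> powr (- (1 / \<xi>))) ^ (T - J) * (C * (real (J + 1))\<^sup>2 * (Dx + DH) / \<alpha> ^ J)
    \<le> (\<alpha> powr (- (1 / \<xi>))) ^ (T - J) * (C * (real (J + 1))\<^sup>2 * (2 * max Dx DH) / \<alpha> ^ J)"
    using C \<alpha> by (intro mult_left_mono divide_right_mono) auto
  then show "E T \<le> (\<alpha> powr (- (1 / \<xi>))) ^ (T - J) * (2 * C * (real (J + 1))\<^sup>2 * (max Dx DH + 0) / \<alpha> ^ J)
     + 0 * (real (T + 1))\<^sup>2 * 0 / \<alpha> ^ T"
    using E[OF J] by (simp add: mult_ac)
qed (use assms in \<open>auto simp: max_def\<close>)

section \<open>Expected gap over the initial distribution\<close>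

context finite_sum_problem
begin

text \<open>Monotonicity of the nonnegative integral holds without measurability, so a pointwise
  comparison with an affine function of the squared initial distance suffices, and that function has
  a known integral.\<close>

lemma expected_gap_le:
  assumes D0: "prob_space D0" "sets D0 = sets (restrict_space borel (Rd d))"
    and int: "integrable D0 (\<lambda>x. (norm (x - xs))\<^sup>2)" and uv: "0 \<le> u" "0 \<le> v"
    and le: "\<And>x0. x0 \<in> Rd d \<Longrightarrow>
      (\<integral>\<^sup>+p. ennreal (gap (fst p)) \<partial>measure_pmf (scsg d n fs \<eta> b m B x0 T))
        \<le> ennreal (u * (L * (norm (x0 - xs))\<^sup>2) + v)"
  shows "expected_gap d n fs xs \<eta> b m B D0 T \<le> ennreal (u * (L * (\<integral>x. (norm (x - xs))\<^sup>2 \<partial>D0)) + v)"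
proof -
  interpret prob_space D0 by (rule D0)
  have sp: "space D0 = Rd d" using sets_eq_imp_space_eq[OF D0(2)] by (simp add: space_restrict_space)
  have "expected_gap d n fs xs \<eta> b m B D0 T \<le> (\<integral>\<^sup>+x0. ennreal (u * (L * (norm (x0 - xs))\<^sup>2) + v) \<partial>D0)"
    unfolding expected_gap_def using le
    by (intro nn_integral_mono) (simp add: sp case_prod_beta' gap_def)
  also have "\<dots> = ennreal (\<integral>x. u * (L * (norm (x - xs))\<^sup>2) + v \<partial>D0)"
    using int uv L by (intro nn_integral_eq_integral) auto
  also have "(\<integral>x. u * (L * (norm (x - xs))\<^sup>2) + v \<partial>D0) = u * (L * (\<integral>x. (norm (x - xs))\<^sup>2 \<partial>D0)) + v"
    using int by (simp add: prob_space)
  finally show ?thesis .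
qed

text \<open>The lower and upper quadratic bounds on the gap are compared at one point other than
  \<open>xs\<close>; positive dimension supplies it.\<close>

lemma condition_number_ge_1:
  assumes "A2 d n fs \<mu> xs" "0 < \<mu>" "0 < d"
  shows "1 \<le> L / \<mu>"
proof -
  define x where "x = xs + unit_vec 0"
  have u: "unit_vec 0 \<in> Rd d" using assms by (simp add: Rd_def unit_vec.rep_eq)
  then have x: "x \<in> Rd d" unfolding x_def by (intro subspace_add subspace_Rd xs)
  have "unit_vec 0 \<noteq> 0"
    by (metis unit_vec.rep_eq zero_fsvec.rep_eq zero_neq_one)
  then have p: "0 < (norm (x - xs))\<^sup>2" by (simp add: x_def)
  have "\<mu> / 2 * (norm (x - xs))\<^sup>2 \<le> gap x" using assms(1) x by (simp add: A2_def gap_def)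
  then have "\<mu> / 2 * (norm (x - xs))\<^sup>2 \<le> L / 2 * (norm (x - xs))\<^sup>2" using gap_le[OF x] by linarith
  then have "\<mu> \<le> L" using p by simp
  then show ?thesis using assms by simp
qed

text \<open>In dimension 0 this gives \<open>D = 0\<close>, so no \<epsilon> satisfies
  \<open>0 < \<epsilon> \<le> D\<close>. It disposes of the case in which the condition number need
  not be at least 1.\<close>

lemma trivial_in_dimension_0:
  assumes "d = 0" "space D0 = Rd d"
  shows "(\<integral>x. (norm (x - xs))\<^sup>2 \<partial>D0) = 0" "grad_variance d n fs xs = 0"
proof -
  have Z: "x = 0" if "x \<in> Rd d" for x
    using that assms(1) by (intro coord_inject[THEN iffD1]) (simp add: Rd_def zero_fsvec.rep_eq fun_eq_iff)
  have "(\<integral>x. (norm (x - xs))\<^sup>2 \<partial>D0) = (\<integral>x. 0 \<partial>D0)"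
    using Z[OF xs] Z assms(2) by (intro Bochner_Integration.integral_cong) auto
  then show "(\<integral>x. (norm (x - xs))\<^sup>2 \<partial>D0) = 0" by simp
  show "grad_variance d n fs xs = 0"
    using Z[OF gradient_Rd[OF _ xs]] by (simp add: grad_variance_def)
qed

end

section \<open>The geometric schedule\<close>

definition batch_size :: "real \<Rightarrow> real \<Rightarrow> nat \<Rightarrow> nat \<Rightarrow> nat" where
  "batch_size B\<^sub>0 \<alpha> n j = nat \<lceil>min (B\<^sub>0 * \<alpha> ^ (2 * j)) (real n)\<rceil>"

lemma batch_size_le: "batch_size B\<^sub>0 \<alpha> n j \<le> n"
  unfolding batch_size_def by (auto simp: nat_le_iff ceiling_le_iff)

lemma batch_size_ge: "min (B\<^sub>0 * \<alpha> ^ (2 * j)) (real n) \<le> real (batch_size B\<^sub>0 \<alpha> n j)"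
  unfolding batch_size_def by (simp only: real_nat_ceiling_ge)

lemma batch_size_ge_1:
  assumes "0 < B\<^sub>0" "0 < \<alpha>" "1 \<le> n"
  shows "1 \<le> batch_size B\<^sub>0 \<alpha> n j"
proof -
  have "0 < min (B\<^sub>0 * \<alpha> ^ (2 * j)) (real n)" using assms by simp
  then have "0 < real (batch_size B\<^sub>0 \<alpha> n j)" using batch_size_ge[of B\<^sub>0 \<alpha> j n] by linarith
  then show ?thesis by simp
qed

lemma batch_size_less_n: "batch_size B\<^sub>0 \<alpha> n j < n \<Longrightarrow> B\<^sub>0 * \<alpha> ^ (2 * j) \<le> real (batch_size B\<^sub>0 \<alpha> n j)"
  using batch_size_ge[of B\<^sub>0 \<alpha> j n] by auto

lemma batch_size_eq_n: "real n \<le> B\<^sub>0 * \<alpha> ^ (2 * j) \<Longrightarrow> batch_size B\<^sub>0 \<alpha> n j = n"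
  using batch_size_ge[of B\<^sub>0 \<alpha> j n] batch_size_le[of B\<^sub>0 \<alpha> n j] by auto

lemma batch_size_le_power:
  assumes "0 < B\<^sub>0" "1 < \<alpha>"
  shows "real (batch_size B\<^sub>0 \<alpha> n j) \<le> (B\<^sub>0 + 1) * (\<alpha>\<^sup>2) ^ j"
proof -
  have "0 \<le> min (B\<^sub>0 * \<alpha> ^ (2 * j)) (real n)" using assms by simp
  then have "real (batch_size B\<^sub>0 \<alpha> n j) \<le> min (B\<^sub>0 * \<alpha> ^ (2 * j)) (real n) + 1"
    unfolding batch_size_def by linarith
  also have "\<dots> \<le> B\<^sub>0 * \<alpha> ^ (2 * j) + \<alpha> ^ (2 * j)" using assms by (intro add_mono) auto
  finally show ?thesis by (simp add: power_mult distrib_right)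
qed

text \<open>The batch sizes are summed in two ways: as a geometric series whose ratio is the square
  of \<alpha>, and as at most \<open>n\<close> per epoch, with
  \<open>ln (\<alpha> ^ T) / ln \<alpha>\<close> epochs.\<close>

lemma schedule_cost:
  fixes \<alpha> m\<^sub>0 B\<^sub>0 :: real
  assumes \<alpha>: "1 < \<alpha>" and m: "0 < m\<^sub>0" and B: "0 < B\<^sub>0"
  obtains C where "0 < C"
    "\<And>n T. (\<Sum>j<T. m\<^sub>0 * \<alpha> ^ Suc j + real (batch_size B\<^sub>0 \<alpha> n (Suc j)))
       \<le> C * min ((\<alpha> ^ T)\<^sup>2) (\<alpha> ^ T + real n * ln (\<alpha> ^ T))"
proof -
  define C where "C = m\<^sub>0 * (\<alpha> / (\<alpha> - 1)) + (B\<^sub>0 + 1) * (\<alpha>\<^sup>2 / (\<alpha>\<^sup>2 - 1)) + 1 / ln \<alpha>"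
  have \<alpha>2: "1 < \<alpha>\<^sup>2" using \<alpha> by (simp add: one_less_power)
  have pos: "0 < m\<^sub>0 * (\<alpha> / (\<alpha> - 1))" "0 < (B\<^sub>0 + 1) * (\<alpha>\<^sup>2 / (\<alpha>\<^sup>2 - 1))" "0 < 1 / ln \<alpha>"
    using assms \<alpha>2 by simp_all
  show ?thesis
  proof (rule that[of C])
    show "0 < C" unfolding C_def by (intro add_pos_pos pos)
    fix n T
    let ?A = "\<alpha> ^ T"
    have A: "1 \<le> ?A" using \<alpha> by simp
    have AA: "?A \<le> ?A\<^sup>2" using mult_left_mono[OF A, of ?A] A by (simp add: power2_eq_square)
    have "(\<Sum>j<T. m\<^sub>0 * \<alpha> ^ Suc j) = m\<^sub>0 * (\<Sum>j<T. \<alpha> ^ Suc j)" by (simp add: sum_distrib_left)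
    also have "\<dots> \<le> m\<^sub>0 * (\<alpha> / (\<alpha> - 1) * ?A)" using m by (intro mult_left_mono geometric_sum_le \<alpha>) auto
    finally have 1: "(\<Sum>j<T. m\<^sub>0 * \<alpha> ^ Suc j) \<le> m\<^sub>0 * (\<alpha> / (\<alpha> - 1)) * ?A" by simp
    have "(\<Sum>j<T. real (batch_size B\<^sub>0 \<alpha> n (Suc j))) \<le> (\<Sum>j<T. (B\<^sub>0 + 1) * (\<alpha>\<^sup>2) ^ Suc j)"
      by (intro sum_mono batch_size_le_power B \<alpha>)
    also have "\<dots> = (B\<^sub>0 + 1) * (\<Sum>j<T. (\<alpha>\<^sup>2) ^ Suc j)" by (simp add: sum_distrib_left)
    also have "\<dots> \<le> (B\<^sub>0 + 1) * (\<alpha>\<^sup>2 / (\<alpha>\<^sup>2 - 1) * (\<alpha>\<^sup>2) ^ T)"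
      using B by (intro mult_left_mono geometric_sum_le \<alpha>2) auto
    finally have 2: "(\<Sum>j<T. real (batch_size B\<^sub>0 \<alpha> n (Suc j))) \<le> (B\<^sub>0 + 1) * (\<alpha>\<^sup>2 / (\<alpha>\<^sup>2 - 1)) * ?A\<^sup>2"
      by (simp add: power_mult[symmetric] mult_ac)
    have "(\<Sum>j<T. real (batch_size B\<^sub>0 \<alpha> n (Suc j))) \<le> (\<Sum>j<T. real n)"
      by (intro sum_mono) (simp add: batch_size_le)
    also have "\<dots> = 1 / ln \<alpha> * (real n * ln ?A)" using \<alpha> by (simp add: ln_realpow)
    finally have 3: "(\<Sum>j<T. real (batch_size B\<^sub>0 \<alpha> n (Suc j))) \<le> 1 / ln \<alpha> * (real n * ln ?A)" .
    have lnA: "0 \<le> real n * ln ?A" using A by simp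
    have "m\<^sub>0 * (\<alpha> / (\<alpha> - 1)) * ?A + (B\<^sub>0 + 1) * (\<alpha>\<^sup>2 / (\<alpha>\<^sup>2 - 1)) * ?A\<^sup>2 \<le> C * ?A\<^sup>2"
    proof -
      have "m\<^sub>0 * (\<alpha> / (\<alpha> - 1)) * ?A \<le> m\<^sub>0 * (\<alpha> / (\<alpha> - 1)) * ?A\<^sup>2"
        using pos by (intro mult_left_mono AA) auto
      moreover have "0 \<le> 1 / ln \<alpha> * ?A\<^sup>2" using pos by simp
      ultimately show ?thesis unfolding C_def distrib_right by linarith
    qed
    moreover have "m\<^sub>0 * (\<alpha> / (\<alpha> - 1)) * ?A + 1 / ln \<alpha> * (real n * ln ?A) \<le> C * (?A + real n * ln ?A)"
    proof -
      have "m\<^sub>0 * (\<alpha> / (\<alpha> - 1)) * ?A \<le> C * ?A" using pos A by (intro mult_right_mono) (auto simp: C_def)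
      moreover have "1 / ln \<alpha> * (real n * ln ?A) \<le> C * (real n * ln ?A)"
        using pos lnA by (intro mult_right_mono) (auto simp: C_def)
      ultimately show ?thesis unfolding distrib_left by linarith
    qed
    ultimately show "(\<Sum>j<T. m\<^sub>0 * \<alpha> ^ Suc j + real (batch_size B\<^sub>0 \<alpha> n (Suc j)))
       \<le> C * min (?A\<^sup>2) (?A + real n * ln ?A)"
      using 1 2 3 unfolding sum.distrib by (auto simp: min_def)
  qed
qed

context finite_sum_problem
begin

text \<open>Here \<open>4 * Gam \<alpha> \<xi>\<close> becomes
  \<open>\<alpha> powr (- (1 / \<xi>))\<close>, Young's weight is set to
  \<open>1 / real (j + 2)\<close>, and \<open>8 / 3 = 5 / 6 * 4 * (4 / 5)\<close> matches the
  coefficients of \<open>descent\<close>.\<close>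

lemma schedule_descent:
  assumes \<alpha>: "1 < \<alpha>" and \<xi>: "0 < \<xi>" "\<xi> < 1" and m: "0 < m\<^sub>0" and B: "0 < B\<^sub>0" and b: "1 \<le> b" "b \<le> n"
    and \<eta>: "0 < \<eta>" and \<rho>: "\<rho> = \<eta> * L" and m\<^sub>0: "real b / Gam \<alpha> \<xi> \<le> m\<^sub>0"
    and small: "2 * \<rho> \<le> 1 - Gam \<alpha> \<xi>" "\<rho> \<le> Gam \<alpha> \<xi> * real b" and x0: "x0 \<in> Rd d"
  obtains F X where
    "descent \<alpha> (\<alpha> powr (- (1 / \<xi>))) (4 / 5 * \<rho> * m\<^sub>0) (real b) (5 * \<rho>\<^sup>2 * (m\<^sub>0\<^sup>2 / B\<^sub>0) / real b)
       (grad_variance d n fs xs / L) (\<lambda>j. batch_size B\<^sub>0 \<alpha> n (Suc j) \<noteq> n) F X"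
    "F 0 \<le> X 0 / 2" "X 0 = L * (norm (x0 - xs))\<^sup>2"
    "\<And>j. (\<integral>\<^sup>+p. ennreal (gap (fst p)) \<partial>measure_pmf (scsg d n fs (\<lambda>_. \<eta>) (\<lambda>_. b)
       (\<lambda>j. m\<^sub>0 * \<alpha> ^ j) (batch_size B\<^sub>0 \<alpha> n) x0 j)) = ennreal (F j)"
    "\<And>\<mu> j. A2 d n fs \<mu> xs \<Longrightarrow> 0 < \<mu> \<Longrightarrow> X j \<le> 2 * (L / \<mu>) * F j"
proof -
  let ?G = "Gam \<alpha> \<xi>"
  let ?P = "scsg d n fs (\<lambda>_. \<eta>) (\<lambda>_. b) (\<lambda>j. m\<^sub>0 * \<alpha> ^ j) (batch_size B\<^sub>0 \<alpha> n) x0"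
  have "1 \<le> \<alpha> powr (1 / \<xi>)" using \<alpha> \<xi> by (simp add: ge_one_powr_ge_zero)
  then have "1 / \<alpha> powr (1 / \<xi>) \<le> 1" by (simp add: divide_le_eq_1)
  then have G: "0 < ?G" "4 * ?G \<le> 1" "4 * ?G = \<alpha> powr (- (1 / \<xi>))"
    using \<alpha> by (auto simp: Gam_def powr_minus_divide)
  have "4 * real b \<le> m\<^sub>0"
  proof -
    have "4 * ?G * real b \<le> 1 * real b" using G by (intro mult_right_mono) auto
    then have "4 * real b \<le> real b / ?G" using G by (simp add: field_simps)
    then show ?thesis using m\<^sub>0 by linarith
  qed
  then have mj: "4 * real b \<le> m\<^sub>0 * \<alpha> ^ j" for j
  proof -
    have "m\<^sub>0 * 1 \<le> m\<^sub>0 * \<alpha> ^ j" using m \<alpha> by (intro mult_left_mono) auto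
    with \<open>4 * real b \<le> m\<^sub>0\<close> show ?thesis by linarith
  qed
  \<comment> \<open>Below the cap \<open>n\<close> the batch sizes grow at least as fast as the
    squared loop sizes, so one constant bounds the ratio in every epoch.\<close>
  have mQ: "(m\<^sub>0 * \<alpha> ^ j)\<^sup>2 \<le> m\<^sub>0\<^sup>2 / B\<^sub>0 * real (batch_size B\<^sub>0 \<alpha> n j)" if "batch_size B\<^sub>0 \<alpha> n j < n" for j
  proof -
    have "(m\<^sub>0 * \<alpha> ^ j)\<^sup>2 = m\<^sub>0\<^sup>2 / B\<^sub>0 * (B\<^sub>0 * \<alpha> ^ (2 * j))"
      using B by (simp add: power_mult_distrib power_mult[symmetric] mult.commute)
    also have "\<dots> \<le> m\<^sub>0\<^sup>2 / B\<^sub>0 * real (batch_size B\<^sub>0 \<alpha> n j)"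
      using batch_size_less_n[OF that] B by (intro mult_left_mono) auto
    finally show ?thesis .
  qed
  have n1: "1 \<le> n" using b by simp
  have B1: "1 \<le> batch_size B\<^sub>0 \<alpha> n j" for j using batch_size_ge_1 B \<alpha> n1 by simp
  have \<rho>1: "2 * \<rho> \<le> 1" using small G by linarith
  obtain F X where F: "\<And>j. 0 \<le> F j" "\<And>j. 0 \<le> X j"
    "\<And>j. (\<integral>\<^sup>+p. ennreal (gap (fst p)) \<partial>measure_pmf (?P j)) = ennreal (F j)"
    "\<And>j. (\<integral>\<^sup>+p. ennreal (L * (norm (fst p - xs))\<^sup>2) \<partial>measure_pmf (?P j)) = ennreal (X j)"
    "X 0 = L * (norm (x0 - xs))\<^sup>2" "F 0 = gap x0"
    and rec: "\<And>j c. 0 < c \<Longrightarrow> c \<le> 1 \<Longrightarrow>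
      4 / 5 * \<rho> * (m\<^sub>0 * \<alpha> ^ Suc j) * F (Suc j) + real b * (1 - c) * X (Suc j)
      \<le> real b * X j + 8 / 3 * ?G * \<rho> * (m\<^sub>0 * \<alpha> ^ Suc j) * F j + (if batch_size B\<^sub>0 \<alpha> n (Suc j) = n then 0 else
              5 * \<rho>\<^sup>2 * (m\<^sub>0\<^sup>2 / B\<^sub>0) / real b / c * (2 * F j + grad_variance d n fs xs / L))"
    by (rule run_recursion[where m = "\<lambda>j. m\<^sub>0 * \<alpha> ^ j" and B = "batch_size B\<^sub>0 \<alpha> n" and Q = "m\<^sub>0\<^sup>2 / B\<^sub>0",
          OF x0 b B1 batch_size_le \<eta> \<rho> G(1) small(2) G(2) \<rho>1 mj mQ]) (use B in auto)
  show ?thesis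
  proof (rule that[of F X])
    show "descent \<alpha> (\<alpha> powr (- (1 / \<xi>))) (4 / 5 * \<rho> * m\<^sub>0) (real b) (5 * \<rho>\<^sup>2 * (m\<^sub>0\<^sup>2 / B\<^sub>0) / real b)
       (grad_variance d n fs xs / L) (\<lambda>j. batch_size B\<^sub>0 \<alpha> n (Suc j) \<noteq> n) F X"
      unfolding descent_def G(3)[symmetric]
    proof (intro conjI allI)
      fix j
      have c: "1 - 1 / real (j + 2) = real (j + 1) / real (j + 2)" by (simp add: field_simps)
      have "4 / 5 * \<rho> * m\<^sub>0 * \<alpha> ^ Suc j * F (Suc j) + real b * (real (j + 1) / real (j + 2)) * X (Suc j)
        = 4 / 5 * \<rho> * (m\<^sub>0 * \<alpha> ^ Suc j) * F (Suc j) + real b * (1 - 1 / real (j + 2)) * X (Suc j)"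
        unfolding c by (simp only: mult.assoc)
      also have "\<dots> \<le> real b * X j + 8 / 3 * ?G * \<rho> * (m\<^sub>0 * \<alpha> ^ Suc j) * F j + (if batch_size B\<^sub>0 \<alpha> n (Suc j) = n then 0 else
              5 * \<rho>\<^sup>2 * (m\<^sub>0\<^sup>2 / B\<^sub>0) / real b / (1 / real (j + 2)) * (2 * F j + grad_variance d n fs xs / L))"
        by (rule rec) auto
      also have "\<dots> = real b * X j + 5 / 6 * (4 * ?G) * (4 / 5 * \<rho> * m\<^sub>0) * \<alpha> ^ Suc j * F j +
          (if batch_size B\<^sub>0 \<alpha> n (Suc j) \<noteq> n then 5 * \<rho>\<^sup>2 * (m\<^sub>0\<^sup>2 / B\<^sub>0) / real b * real (j + 2) *
             (2 * F j + grad_variance d n fs xs / L) else 0)"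
        by simp
      finally show "4 / 5 * \<rho> * m\<^sub>0 * \<alpha> ^ Suc j * F (Suc j) + real b * (real (j + 1) / real (j + 2)) * X (Suc j)
        \<le> real b * X j + 5 / 6 * (4 * ?G) * (4 / 5 * \<rho> * m\<^sub>0) * \<alpha> ^ Suc j * F j +
          (if batch_size B\<^sub>0 \<alpha> n (Suc j) \<noteq> n then 5 * \<rho>\<^sup>2 * (m\<^sub>0\<^sup>2 / B\<^sub>0) / real b * real (j + 2) *
             (2 * F j + grad_variance d n fs xs / L) else 0)" .
    qed (use F grad_variance_nonneg L in auto)
    show "F 0 \<le> X 0 / 2" using gap_le[OF x0] F(5,6) by simp
    fix \<mu> j assume A2: "A2 d n fs \<mu> xs" and \<mu>: "0 < \<mu>"
    have "ennreal (X j) \<le> (\<integral>\<^sup>+p. ennreal (2 * (L / \<mu>)) * ennreal (gap (fst p)) \<partial>measure_pmf (?P j))"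
      unfolding F(4)[symmetric]
    proof (intro nn_integral_mono_AE, unfold AE_measure_pmf_iff, intro ballI)
      fix p assume "p \<in> set_pmf (?P j)"
      with set_scsg[where B = "batch_size B\<^sub>0 \<alpha> n", OF x0 b(2) batch_size_le]
      have p: "fst p \<in> Rd d" .
      have "\<mu> / 2 * (norm (fst p - xs))\<^sup>2 \<le> gap (fst p)" using A2 p by (simp add: A2_def gap_def)
      then have "2 * (L / \<mu>) * (\<mu> / 2 * (norm (fst p - xs))\<^sup>2) \<le> 2 * (L / \<mu>) * gap (fst p)"
        using L \<mu> by (intro mult_left_mono) auto
      then have "L * (norm (fst p - xs))\<^sup>2 \<le> 2 * (L / \<mu>) * gap (fst p)" using \<mu> by simp
      then show "ennreal (L * (norm (fst p - xs))\<^sup>2) \<le> ennreal (2 * (L / \<mu>)) * ennreal (gap (fst p))"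
        using L \<mu> gap_nonneg[OF p] by (simp add: ennreal_mult'[symmetric] ennreal_leI)
    qed
    also have "\<dots> = ennreal (2 * (L / \<mu>)) * ennreal (F j)"
      by (simp add: nn_integral_cmult F(3))
    also have "\<dots> = ennreal (2 * (L / \<mu>) * F j)" using L \<mu> F(1) by (intro ennreal_mult[symmetric]) auto
    finally show "X j \<le> 2 * (L / \<mu>) * F j" using L \<mu> F(1)[of j] by (subst (asm) ennreal_le_iff) auto
  qed (use F in auto)
qed

end

text \<open>The constants precede the quantification over problems, which is the uniformity that
  O-notation asserts. This is possible because the coefficients of the scalar recursion involve only
  the algorithm parameters and \<rho>; the problem enters through \<open>H\<close>,
  \<open>F\<close>, \<open>X\<close> and the set of noisy epochs.\<close>

lemma scsg_gap_bounds:
  fixes \<alpha> \<xi> m\<^sub>0 B\<^sub>0 \<rho> :: real and b :: nat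
  assumes \<alpha>: "1 < \<alpha>" and \<xi>: "0 < \<xi>" "\<xi> < 1" and m: "0 < m\<^sub>0" and B: "0 < B\<^sub>0" and b: "1 \<le> b"
    and \<rho>: "0 < \<rho>" and m\<^sub>0: "real b / Gam \<alpha> \<xi> \<le> m\<^sub>0"
    and small: "2 * \<rho> \<le> 1 - Gam \<alpha> \<xi>" "\<rho> \<le> Gam \<alpha> \<xi> * real b"
  obtains C C0 C1 :: real where "1 \<le> C" "1 \<le> C0" "0 \<le> C1"
    "\<And>d n fs L xs \<eta> D0 Dx DH. finite_sum_problem d n fs L xs \<Longrightarrow> 0 < \<eta> \<Longrightarrow> \<eta> * L = \<rho> \<Longrightarrow> b \<le> n \<Longrightarrow>
      prob_space D0 \<Longrightarrow> sets D0 = sets (restrict_space borel (Rd d)) \<Longrightarrow>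
      integrable D0 (\<lambda>x. (norm (x - xs))\<^sup>2) \<Longrightarrow>
      Dx = L * (\<integral>x. (norm (x - xs))\<^sup>2 \<partial>D0) \<Longrightarrow> DH = grad_variance d n fs xs / L \<Longrightarrow>
      \<exists>E :: nat \<Rightarrow> real. (\<forall>T. 0 \<le> E T \<and> expected_gap d n fs xs (\<lambda>_. \<eta>) (\<lambda>_. b) (\<lambda>j. m\<^sub>0 * \<alpha> ^ j)
             (batch_size B\<^sub>0 \<alpha> n) D0 T = ennreal (E T) \<and>
           E T \<le> C * (real (T + 1))\<^sup>2 * (Dx + DH) / \<alpha> ^ T) \<and>
        (\<forall>\<mu> J T. A2 d n fs \<mu> xs \<and> 0 < \<mu> \<and> 1 \<le> L / \<mu> \<and> J \<le> T \<longrightarrow>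
           (C0 * (L / \<mu>) \<le> \<alpha> ^ J \<longrightarrow>
              E T \<le> (\<alpha> powr (- (1 / \<xi>))) ^ (T - J) * (C * (real (J + 1))\<^sup>2 * (Dx + DH) / \<alpha> ^ J)
                     + C1 * (real (T + 1))\<^sup>2 * DH / \<alpha> ^ T) \<and>
           (C0 * (sqrt (real n) + L / \<mu>) \<le> \<alpha> ^ J \<longrightarrow>
              E T \<le> (\<alpha> powr (- (1 / \<xi>))) ^ (T - J) * (C * (real (J + 1))\<^sup>2 * (Dx + DH) / \<alpha> ^ J)))"
proof -
  define a where "a = \<alpha> powr (- (1 / \<xi>))"
  have a0: "0 < a" using \<alpha> by (simp add: a_def)
  have "a * \<alpha> = \<alpha> powr (1 - 1 / \<xi>)" using \<alpha> by (simp add: a_def powr_diff powr_minus_divide)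
  also have "\<dots> \<le> \<alpha> powr 0" using \<alpha> \<xi> by (intro powr_mono) auto
  finally have a1: "a * \<alpha> \<le> 1" using \<alpha> by simp
  define w where "w = 4 / 5 * \<rho> * m\<^sub>0"
  define K where "K = 5 * \<rho>\<^sup>2 * (m\<^sub>0\<^sup>2 / B\<^sub>0) / real b"
  have w: "0 < w" and K: "0 \<le> K" using \<rho> m B by (simp_all add: w_def K_def)
  obtain C where C: "1 \<le> C" and growth: "\<And>H N F X T. descent \<alpha> a w (real b) K H N F X \<Longrightarrow> F 0 \<le> X 0 / 2 \<Longrightarrow>
       F T \<le> C * (real (T + 1))\<^sup>2 * (X 0 + H) / \<alpha> ^ T"
    using descent_growth[OF \<alpha> a0 a1 w _ K, of "real b"] by auto
  obtain C0' C1 where C0': "1 \<le> C0'" and C1: "0 \<le> C1" and contraction: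
    "\<And>H N F X \<kappa> J T. descent \<alpha> a w (real b) K H N F X \<Longrightarrow> 1 \<le> \<kappa> \<Longrightarrow> (\<And>j. X j \<le> 2 * \<kappa> * F j) \<Longrightarrow>
       C0' * \<kappa> \<le> \<alpha> ^ J \<Longrightarrow> J \<le> T \<Longrightarrow>
       F T \<le> a ^ (T - J) * F J + (if \<forall>j\<ge>J. \<not> N j then 0 else C1 * (real (T + 1))\<^sup>2 * H / \<alpha> ^ T)"
    using descent_contraction[OF \<alpha> a0 a1 w _ K, of "real b"] by auto
  \<comment> \<open>The second entry turns \<open>C0 * sqrt (real n) \<le> \<alpha> ^ J\<close> into
    \<open>real n \<le> B\<^sub>0 * \<alpha> ^ (2 * J)\<close>, so that all later batches are
    full.\<close>
  define C0 where "C0 = max C0' (1 / sqrt B\<^sub>0)"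
  show ?thesis
  proof (rule that[of C C0 C1, folded a_def])
    show "1 \<le> C0" using C0' by (simp add: C0_def)
    fix d n fs L xs \<eta> Dx DH and D0 :: "fsvec measure"
    assume fsp: "finite_sum_problem d n fs L xs" and \<eta>: "0 < \<eta>" and \<eta>L: "\<eta> * L = \<rho>" and bn: "b \<le> n"
      and D0: "prob_space D0" "sets D0 = sets (restrict_space borel (Rd d))"
      and int: "integrable D0 (\<lambda>x. (norm (x - xs))\<^sup>2)"
      and Dx: "Dx = L * (\<integral>x. (norm (x - xs))\<^sup>2 \<partial>D0)" and DH: "DH = grad_variance d n fs xs / L"
    interpret finite_sum_problem d n fs L xs by (rule fsp)
    have DH0: "0 \<le> DH" using grad_variance_nonneg L by (simp add: DH)
    have Dx0: "0 \<le> Dx" using L by (simp add: Dx)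
    let ?N = "\<lambda>j. batch_size B\<^sub>0 \<alpha> n (Suc j) \<noteq> n"
    let ?gap = "expected_gap d n fs xs (\<lambda>_. \<eta>) (\<lambda>_. b) (\<lambda>j. m\<^sub>0 * \<alpha> ^ j) (batch_size B\<^sub>0 \<alpha> n) D0"
    have run: "\<exists>F X. descent \<alpha> a w (real b) K DH ?N F X \<and> F 0 \<le> X 0 / 2 \<and> X 0 = L * (norm (x0 - xs))\<^sup>2 \<and>
      (\<forall>j. (\<integral>\<^sup>+p. ennreal (gap (fst p)) \<partial>measure_pmf (scsg d n fs (\<lambda>_. \<eta>) (\<lambda>_. b)
         (\<lambda>j. m\<^sub>0 * \<alpha> ^ j) (batch_size B\<^sub>0 \<alpha> n) x0 j)) = ennreal (F j)) \<and>
      (\<forall>\<mu> j. A2 d n fs \<mu> xs \<longrightarrow> 0 < \<mu> \<longrightarrow> X j \<le> 2 * (L / \<mu>) * F j)" if "x0 \<in> Rd d" for x0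
      by (rule schedule_descent[OF \<alpha> \<xi> m B b bn \<eta> \<eta>L[symmetric] m\<^sub>0 small that, folded a_def w_def K_def DH]) blast
    have all: "?gap T \<le> ennreal (C * (real (T + 1))\<^sup>2 * (Dx + DH) / \<alpha> ^ T)" for T
    proof -
      let ?u = "C * (real (T + 1))\<^sup>2 / \<alpha> ^ T"
      have "?gap T \<le> ennreal (?u * (L * (\<integral>x. (norm (x - xs))\<^sup>2 \<partial>D0)) + ?u * DH)"
      proof (rule expected_gap_le[OF D0 int])
        fix x0 assume "x0 \<in> Rd d"
        from run[OF this] obtain F X where FX: "descent \<alpha> a w (real b) K DH ?N F X" "F 0 \<le> X 0 / 2"
            "X 0 = L * (norm (x0 - xs))\<^sup>2" and gap: "\<And>j. (\<integral>\<^sup>+p. ennreal (gap (fst p)) \<partial>measure_pmf (scsg d n fs (\<lambda>_. \<eta>) (\<lambda>_. b)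
         (\<lambda>j. m\<^sub>0 * \<alpha> ^ j) (batch_size B\<^sub>0 \<alpha> n) x0 j)) = ennreal (F j)" by blast
        have "F T \<le> ?u * (L * (norm (x0 - xs))\<^sup>2) + ?u * DH"
          using growth[OF FX(1,2), of T] by (simp add: FX(3) distrib_left add_divide_distrib)
        then show "(\<integral>\<^sup>+p. ennreal (gap (fst p)) \<partial>measure_pmf (scsg d n fs (\<lambda>_. \<eta>) (\<lambda>_. b)
         (\<lambda>j. m\<^sub>0 * \<alpha> ^ j) (batch_size B\<^sub>0 \<alpha> n) x0 T)) \<le> ennreal (?u * (L * (norm (x0 - xs))\<^sup>2) + ?u * DH)"
          unfolding gap by (rule ennreal_leI)
      qed (use C \<alpha> DH0 in auto)
      then show ?thesis by (simp add: Dx[symmetric] distrib_left add_divide_distrib)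
    qed
    have sc: "?gap T \<le> ennreal (a ^ (T - J) * (C * (real (J + 1))\<^sup>2 * (Dx + DH) / \<alpha> ^ J)
        + (if \<forall>j\<ge>J. \<not> ?N j then 0 else C1 * (real (T + 1))\<^sup>2 * DH / \<alpha> ^ T))"
      if \<mu>: "A2 d n fs \<mu> xs" "0 < \<mu>" "1 \<le> L / \<mu>" and J: "J \<le> T" "C0' * (L / \<mu>) \<le> \<alpha> ^ J" for \<mu> J T
    proof -
      let ?u = "a ^ (T - J) * (C * (real (J + 1))\<^sup>2 / \<alpha> ^ J)"
      let ?v = "if \<forall>j\<ge>J. \<not> ?N j then 0 else C1 * (real (T + 1))\<^sup>2 * DH / \<alpha> ^ T"
      have u0: "0 \<le> ?u" and v0: "0 \<le> ?v" using C C1 \<alpha> DH0 a0 by auto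
      have "?gap T \<le> ennreal (?u * (L * (\<integral>x. (norm (x - xs))\<^sup>2 \<partial>D0)) + (?u * DH + ?v))"
      proof (rule expected_gap_le[OF D0 int])
        fix x0 assume "x0 \<in> Rd d"
        from run[OF this] obtain F X where FX: "descent \<alpha> a w (real b) K DH ?N F X" "F 0 \<le> X 0 / 2"
            "X 0 = L * (norm (x0 - xs))\<^sup>2" and gap: "\<And>j. (\<integral>\<^sup>+p. ennreal (gap (fst p)) \<partial>measure_pmf (scsg d n fs (\<lambda>_. \<eta>) (\<lambda>_. b)
         (\<lambda>j. m\<^sub>0 * \<alpha> ^ j) (batch_size B\<^sub>0 \<alpha> n) x0 j)) = ennreal (F j)"
            and XF: "\<And>j. X j \<le> 2 * (L / \<mu>) * F j" using \<mu> by blast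
        have "F T \<le> a ^ (T - J) * F J + ?v"
          by (rule contraction[OF FX(1) \<mu>(3) XF J(2,1)])
        also have "\<dots> \<le> a ^ (T - J) * (C * (real (J + 1))\<^sup>2 * (X 0 + DH) / \<alpha> ^ J) + ?v"
          using a0 growth[OF FX(1,2), of J] by (intro add_right_mono mult_left_mono) auto
        also have "\<dots> = ?u * (L * (norm (x0 - xs))\<^sup>2) + (?u * DH + ?v)"
          unfolding FX(3) by (simp only: distrib_left add_divide_distrib times_divide_eq_right times_divide_eq_left mult.assoc add.assoc)
        finally show "(\<integral>\<^sup>+p. ennreal (gap (fst p)) \<partial>measure_pmf (scsg d n fs (\<lambda>_. \<eta>) (\<lambda>_. b)
         (\<lambda>j. m\<^sub>0 * \<alpha> ^ j) (batch_size B\<^sub>0 \<alpha> n) x0 T)) \<le> ennreal (?u * (L * (norm (x0 - xs))\<^sup>2) + (?u * DH + ?v))"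
          unfolding gap by (rule ennreal_leI)
      next
        show "0 \<le> ?u * DH + ?v" by (rule add_nonneg_nonneg[OF mult_nonneg_nonneg[OF u0 DH0] v0])
      qed (rule u0)
      also have "?u * (L * (\<integral>x. (norm (x - xs))\<^sup>2 \<partial>D0)) + (?u * DH + ?v)
          = a ^ (T - J) * (C * (real (J + 1))\<^sup>2 * (Dx + DH) / \<alpha> ^ J) + ?v"
        unfolding Dx[symmetric]
        by (simp only: distrib_left add_divide_distrib times_divide_eq_right times_divide_eq_left mult.assoc add.assoc)
      finally show ?thesis .
    qed
    define E where "E T = enn2real (?gap T)" for T
    have le: "E T \<le> r" if "?gap T \<le> ennreal r" "0 \<le> r" for T r
      using that unfolding E_def by (rule enn2real_leI[rotated])
    have E: "0 \<le> E T" "?gap T = ennreal (E T)" for T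
      using all[of T] by (auto simp: E_def ennreal_enn2real_if top_unique)
    have C0: "C0' \<le> C0" "1 / sqrt B\<^sub>0 \<le> C0" by (auto simp: C0_def)
    show "\<exists>E. (\<forall>T. 0 \<le> E T \<and> ?gap T = ennreal (E T) \<and>
           E T \<le> C * (real (T + 1))\<^sup>2 * (Dx + DH) / \<alpha> ^ T) \<and>
        (\<forall>\<mu> J T. A2 d n fs \<mu> xs \<and> 0 < \<mu> \<and> 1 \<le> L / \<mu> \<and> J \<le> T \<longrightarrow>
           (C0 * (L / \<mu>) \<le> \<alpha> ^ J \<longrightarrow>
              E T \<le> a ^ (T - J) * (C * (real (J + 1))\<^sup>2 * (Dx + DH) / \<alpha> ^ J)
                     + C1 * (real (T + 1))\<^sup>2 * DH / \<alpha> ^ T) \<and>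
           (C0 * (sqrt (real n) + L / \<mu>) \<le> \<alpha> ^ J \<longrightarrow>
              E T \<le> a ^ (T - J) * (C * (real (J + 1))\<^sup>2 * (Dx + DH) / \<alpha> ^ J)))"
    proof (rule exI[of _ E], intro conjI allI impI)
      fix T
      show "E T \<le> C * (real (T + 1))\<^sup>2 * (Dx + DH) / \<alpha> ^ T"
        using C Dx0 DH0 \<alpha> by (intro le all) auto
      show "0 \<le> E T" "?gap T = ennreal (E T)" by (rule E)+
    next
      fix \<mu> :: real and J T :: nat
      assume \<mu>: "A2 d n fs \<mu> xs \<and> 0 < \<mu> \<and> 1 \<le> L / \<mu> \<and> J \<le> T"
      have k0: "0 \<le> L / \<mu>" using \<mu> by linarith
      have main0: "0 \<le> a ^ (T - J) * (C * (real (J + 1))\<^sup>2 * (Dx + DH) / \<alpha> ^ J)"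
        and noise0: "0 \<le> C1 * (real (T + 1))\<^sup>2 * DH / \<alpha> ^ T"
        using a0 C C1 Dx0 DH0 \<alpha> by auto
      {
        assume J: "C0 * (L / \<mu>) \<le> \<alpha> ^ J"
        have "C0' * (L / \<mu>) \<le> C0 * (L / \<mu>)" using C0 k0 by (intro mult_right_mono) auto
        with J have "C0' * (L / \<mu>) \<le> \<alpha> ^ J" by linarith
        then have "E T \<le> a ^ (T - J) * (C * (real (J + 1))\<^sup>2 * (Dx + DH) / \<alpha> ^ J)
          + (if \<forall>j\<ge>J. \<not> ?N j then 0 else C1 * (real (T + 1))\<^sup>2 * DH / \<alpha> ^ T)"
          using main0 noise0 \<mu> by (intro le sc) auto
        then show "E T \<le> a ^ (T - J) * (C * (real (J + 1))\<^sup>2 * (Dx + DH) / \<alpha> ^ J)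
                     + C1 * (real (T + 1))\<^sup>2 * DH / \<alpha> ^ T"
          using noise0 by (auto split: if_splits)
      }
      {
        assume J: "C0 * (sqrt (real n) + L / \<mu>) \<le> \<alpha> ^ J"
        have "C0' * (L / \<mu>) \<le> C0 * (sqrt (real n) + L / \<mu>)" using C0 C0' k0 by (intro mult_mono) auto
        with J have J': "C0' * (L / \<mu>) \<le> \<alpha> ^ J" by linarith
        have "\<not> ?N j" if "J \<le> j" for j
        proof -
          have "1 / sqrt B\<^sub>0 * sqrt (real n) \<le> C0 * (sqrt (real n) + L / \<mu>)"
            using C0 C0' k0 B by (intro mult_mono) auto
          also have "\<dots> \<le> \<alpha> ^ J" by (rule J)
          also have "\<dots> \<le> \<alpha> ^ Suc j" using that \<alpha> by (intro power_increasing) auto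
          finally have "sqrt (real n) \<le> sqrt B\<^sub>0 * \<alpha> ^ Suc j" using B by (simp add: field_simps)
          then have "(sqrt (real n))\<^sup>2 \<le> (sqrt B\<^sub>0 * \<alpha> ^ Suc j)\<^sup>2" by (intro power_mono) auto
          then have "real n \<le> B\<^sub>0 * \<alpha> ^ (2 * Suc j)"
            using B by (simp only: power_mult_distrib real_sqrt_pow2 less_imp_le of_nat_0_le_iff power_mult[symmetric] mult.commute)
          then show ?thesis using batch_size_eq_n by blast
        qed
        then show "E T \<le> a ^ (T - J) * (C * (real (J + 1))\<^sup>2 * (Dx + DH) / \<alpha> ^ J)"
          using sc[OF _ _ _ _ J', of T] \<mu> main0 le by simp
      }
    qed
  qed (use C C1 in auto)
qed

section \<open>Complexity\<close>

text \<open>By minimality accuracy fails at some \<open>T\<close> not before the predecessor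
  \<open>t\<close> of the least epoch. There \<open>\<alpha> ^ T < R\<close>, so the least epoch
  overshoots \<open>R\<close> by at most one factor \<alpha>.\<close>

lemma least_exponent_le:
  fixes \<alpha> R \<epsilon> :: real and E :: "nat \<Rightarrow> real"
  assumes \<alpha>: "1 < \<alpha>" and R: "1 \<le> R" and E: "\<And>T. R \<le> \<alpha> ^ T \<Longrightarrow> E T \<le> \<epsilon>"
  shows "\<alpha> ^ (LEAST T'. \<forall>T\<ge>T'. E T \<le> \<epsilon>) \<le> \<alpha> * R"
proof (cases "LEAST T'. \<forall>T\<ge>T'. E T \<le> \<epsilon>")
  case 0
  then show ?thesis using mult_mono[of 1 \<alpha> 1 R] \<alpha> R by simp
next
  case (Suc t)
  have "\<not> (\<forall>T\<ge>t. E T \<le> \<epsilon>)"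
    by (rule not_less_Least) (simp only: Suc lessI)
  then obtain T where "t \<le> T" "\<not> E T \<le> \<epsilon>" by blast
  then have "\<alpha> ^ T < R" using E by (meson not_le)
  moreover have "\<alpha> ^ t \<le> \<alpha> ^ T" using \<open>t \<le> T\<close> \<alpha> by (intro power_increasing) auto
  ultimately have "\<alpha> ^ t \<le> R" by linarith
  then show ?thesis using Suc \<alpha> by simp
qed

lemma eventually_accurate:
  fixes \<alpha> R \<epsilon> :: real and E :: "nat \<Rightarrow> real"
  assumes \<alpha>: "1 < \<alpha>" and E: "\<And>T. R \<le> \<alpha> ^ T \<Longrightarrow> E T \<le> \<epsilon>"
  shows "\<exists>T'. \<forall>T\<ge>T'. E T \<le> \<epsilon>"
proof -
  obtain T' where T': "R < \<alpha> ^ T'" using real_arch_pow[OF \<alpha>] by blast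
  have "E T \<le> \<epsilon>" if "T' \<le> T" for T
  proof (rule E)
    have "\<alpha> ^ T' \<le> \<alpha> ^ T" using that \<alpha> by (intro power_increasing) auto
    then show "R \<le> \<alpha> ^ T" using T' by linarith
  qed
  then show ?thesis by blast
qed

text \<open>The expected cost of \<open>T\<close> epochs is the same for every starting point, so
  integrating over the probability measure \<open>D0\<close> does not change it.\<close>

lemma scsg_complexity_eq:
  assumes gap: "\<And>T. expected_gap d n fs xs (\<lambda>_. \<eta>) (\<lambda>_. b) m B D0 T = ennreal (E T)"
    and "0 \<le> \<epsilon>" and ex: "\<exists>T'. \<forall>T\<ge>T'. E T \<le> \<epsilon>"
    and "prob_space D0" and m: "\<And>j. 0 < m j" and b: "1 \<le> b"
  shows "scsg_complexity d n fs xs (\<lambda>_. \<eta>) (\<lambda>_. b) m B D0 \<epsilon>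
    = ennreal (\<Sum>j<(LEAST T'. \<forall>T\<ge>T'. E T \<le> \<epsilon>). m (Suc j) + real (B (Suc j)))"
proof -
  interpret prob_space D0 by fact
  have iff: "ennreal (E T) \<le> ennreal \<epsilon> \<longleftrightarrow> E T \<le> \<epsilon>" for T
    using \<open>0 \<le> \<epsilon>\<close> by (cases "0 \<le> E T") (auto simp: ennreal_neg)
  have "expected_cost d n fs (\<lambda>_. \<eta>) (\<lambda>_. b) m B D0 T = ennreal (\<Sum>j<T. m (Suc j) + real (B (Suc j)))" for T
    unfolding expected_cost_def
    by (simp add: case_prod_beta' expected_cost_run[OF m b] emeasure_space_1 del: sum_ennreal)
  then show ?thesis using ex unfolding scsg_complexity_def gap iff Let_def by simp
qed

lemma le_mult_Min:
  fixes y c :: ennreal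
  assumes "finite S" "S \<noteq> {}" "\<And>x. x \<in> S \<Longrightarrow> y \<le> c * x"
  shows "y \<le> c * Min S"
  using assms Min_in by blast

lemma ennreal_le_at_kappa:
  assumes "0 < c" "0 \<le> \<mu>" and "0 < \<mu> \<Longrightarrow> y \<le> c * t (L / \<mu>)" 
  shows "ennreal y \<le> ennreal c * at_kappa L \<mu> t"
proof (cases "\<mu> = 0")
  case True
  then show ?thesis using assms by (simp add: at_kappa_def ennreal_mult_top)
next
  case False
  then show ?thesis using assms
    by (simp add: at_kappa_def ennreal_mult'[symmetric] ennreal_leI)
qed

text \<open>Keeps the term \<open>n * ln A\<close> of the cost within one logarithm of
  \<open>n\<close>.\<close>

lemma ln_le_of_quadratic_log_bound:
  fixes A c l r :: real
  assumes "1 \<le> A" "1 \<le> c" "1 \<le> r" and l: "l = 1 + ln r" and A: "A \<le> c * l\<^sup>2 * r"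
  shows "ln A \<le> (ln c + 3) * l"
proof -
  have l1: "1 \<le> l" using assms by simp
  have "ln A \<le> ln (c * l\<^sup>2 * r)" using assms A l1 by (subst ln_le_cancel_iff) auto
  also have "\<dots> = ln c + 2 * ln l + ln r"
  proof -
    have "0 < c" "0 < l" "0 < r" using assms(2,3) l1 by auto
    then show ?thesis by (simp add: ln_mult ln_realpow)
  qed
  also have "\<dots> \<le> ln c * l + 2 * l + l"
  proof (intro add_mono)
    show "ln c \<le> ln c * l" using mult_left_mono[OF l1, of "ln c"] assms by simp
    show "2 * ln l \<le> 2 * l" using ln_le_minus_one[of l] l1 by simp
    show "ln r \<le> l" by (simp add: l)
  qed
  finally show ?thesis by (simp add: algebra_simps)
qed

theorem theorem4p4:
  fixes \<alpha> \<xi> m\<^sub>0 B\<^sub>0 \<rho> :: real and b :: nat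
  assumes "\<alpha> > 1" and "m\<^sub>0 > 0" and "0 < \<xi>" and "\<xi> < 1" and "b \<ge> 1" and "\<rho> > 0"
    and "m\<^sub>0 \<ge> real b / Gam \<alpha> \<xi>"
    and "2 * \<rho> \<le> Min {1 - Gam \<alpha> \<xi>, 2 * Gam \<alpha> \<xi> * real b, (Gam \<alpha> \<xi>)\<^sup>2 * real b * B\<^sub>0 / m\<^sub>0}"
  shows "\<exists>C p. 0 < C \<and>
    (\<forall>(d::nat) (n::nat) (fs :: nat \<Rightarrow> fsvec \<Rightarrow> real) (L::real) (\<mu>::real) (\<eta>::real)
      (xs::fsvec) (D0 :: fsvec measure).
      A1 d n fs L \<and> A2 d n fs \<mu> xs \<and> is_reference_minimizer d n fs xs \<and>
      0 < L \<and> 0 < \<eta> \<and> \<eta> * L = \<rho> \<and> b \<le> n \<and> B\<^sub>0 < real n \<and>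
      prob_space D0 \<and> sets D0 = sets (restrict_space borel (Rd d)) \<and>
      integrable D0 (\<lambda>x. (norm (x - xs))\<^sup>2) \<longrightarrow>
      (let D\<^sub>x = L * (\<integral>x. (norm (x - xs))\<^sup>2 \<partial>D0);
           D\<^sub>H = grad_variance d n fs xs / L;
           D = max D\<^sub>x D\<^sub>H;
           E_comp = scsg_complexity d n fs xs (\<lambda>_. \<eta>) (\<lambda>_. b) (\<lambda>j. m\<^sub>0 * \<alpha> ^ j)
                      (\<lambda>j. nat \<lceil>min (B\<^sub>0 * \<alpha> ^ (2 * j)) (real n)\<rceil>) D0
       in \<exists>A :: real \<Rightarrow> real. \<forall>\<epsilon>. 0 < \<epsilon> \<and> \<epsilon> \<le> D \<longrightarrow>
            1 \<le> A \<epsilon> \<and>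
            E_comp \<epsilon> \<le> ennreal (C * min ((A \<epsilon>)\<^sup>2) (A \<epsilon> + real n * ln (A \<epsilon>))) \<and>
            ennreal (A \<epsilon>) \<le> ennreal (C * polylog p n (D / \<epsilon>)) * rate_A n L \<mu> D\<^sub>x D\<^sub>H \<xi> \<epsilon> \<and>
            E_comp \<epsilon> \<le> ennreal (C * polylog p n (D / \<epsilon>)) * rate_comp n L \<mu> D\<^sub>x D\<^sub>H \<xi> \<epsilon>))"
proof -
  note \<alpha> = assms(1) and m = assms(2) and \<xi> = assms(3,4) and b = assms(5) and \<rho> = assms(6)
  have G0: "0 < Gam \<alpha> \<xi>" using \<alpha> by (simp add: Gam_def)
  have small: "2 * \<rho> \<le> 1 - Gam \<alpha> \<xi>" "\<rho> \<le> Gam \<alpha> \<xi> * real b"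
    and "2 * \<rho> \<le> (Gam \<alpha> \<xi>)\<^sup>2 * real b * B\<^sub>0 / m\<^sub>0"
    using assms(8) by auto
  then have pos: "0 < (Gam \<alpha> \<xi>)\<^sup>2 * real b * B\<^sub>0 / m\<^sub>0" using \<rho> by linarith
  \<comment> \<open>Positivity is implicit in the statement, through \<rho> > 0 and the third entry
    of the minimum.\<close>
  have B: "0 < B\<^sub>0"
  proof (rule ccontr)
    assume "\<not> 0 < B\<^sub>0"
    then have "(Gam \<alpha> \<xi>)\<^sup>2 * real b * B\<^sub>0 / m\<^sub>0 \<le> 0"
      using m by (intro divide_nonpos_pos mult_nonneg_nonpos) auto
    then show False using pos by linarith
  qed
  obtain C C0 C1 :: real where C: "1 \<le> C" "1 \<le> C0" "0 \<le> C1" and bounds: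
    "\<And>d n fs L xs \<eta> D0 Dx DH. finite_sum_problem d n fs L xs \<Longrightarrow> 0 < \<eta> \<Longrightarrow> \<eta> * L = \<rho> \<Longrightarrow> b \<le> n \<Longrightarrow>
      prob_space D0 \<Longrightarrow> sets D0 = sets (restrict_space borel (Rd d)) \<Longrightarrow>
      integrable D0 (\<lambda>x. (norm (x - xs))\<^sup>2) \<Longrightarrow>
      Dx = L * (\<integral>x. (norm (x - xs))\<^sup>2 \<partial>D0) \<Longrightarrow> DH = grad_variance d n fs xs / L \<Longrightarrow>
      \<exists>E :: nat \<Rightarrow> real. (\<forall>T. 0 \<le> E T \<and> expected_gap d n fs xs (\<lambda>_. \<eta>) (\<lambda>_. b) (\<lambda>j. m\<^sub>0 * \<alpha> ^ j)
             (batch_size B\<^sub>0 \<alpha> n) D0 T = ennreal (E T) \<and>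
           E T \<le> C * (real (T + 1))\<^sup>2 * (Dx + DH) / \<alpha> ^ T) \<and>
        (\<forall>\<mu> J T. A2 d n fs \<mu> xs \<and> 0 < \<mu> \<and> 1 \<le> L / \<mu> \<and> J \<le> T \<longrightarrow>
           (C0 * (L / \<mu>) \<le> \<alpha> ^ J \<longrightarrow>
              E T \<le> (\<alpha> powr (- (1 / \<xi>))) ^ (T - J) * (C * (real (J + 1))\<^sup>2 * (Dx + DH) / \<alpha> ^ J)
                     + C1 * (real (T + 1))\<^sup>2 * DH / \<alpha> ^ T) \<and>
           (C0 * (sqrt (real n) + L / \<mu>) \<le> \<alpha> ^ J \<longrightarrow>
              E T \<le> (\<alpha> powr (- (1 / \<xi>))) ^ (T - J) * (C * (real (J + 1))\<^sup>2 * (Dx + DH) / \<alpha> ^ J)))"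
    by (rule scsg_gap_bounds[OF \<alpha> \<xi> m B b \<rho> assms(7) small]) (rule that, assumption+)
  obtain C2 where C2: "1 \<le> C2" and dich: "\<And>r T. 1 \<le> r \<Longrightarrow>
      (real (T + 1))\<^sup>2 \<le> C2 * (1 + ln r)\<^sup>2 \<or> 2 * C * (real (T + 1))\<^sup>2 * r \<le> \<alpha> ^ T"
    using quadratic_or_exponential[OF \<alpha> C(1)] by auto
  obtain C3 where C3: "0 < C3" and cost: "\<And>n T. (\<Sum>j<T. m\<^sub>0 * \<alpha> ^ Suc j + real (batch_size B\<^sub>0 \<alpha> n (Suc j)))
       \<le> C3 * min ((\<alpha> ^ T)\<^sup>2) (\<alpha> ^ T + real n * ln (\<alpha> ^ T))"
    using schedule_cost[OF \<alpha> m B] by auto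
  \<comment> \<open>Dominates the constants of all three accuracy thresholds.\<close>
  define C4 where "C4 = \<alpha> * C0 * (6 * (C + C1))"
  have aC0: "1 \<le> \<alpha> * C0" using mult_mono[of 1 \<alpha> 1 C0] \<alpha> C by simp
  have C4: "2 * C \<le> C4" "\<alpha> * C0 * (3 * (C + C1)) \<le> C4" "\<alpha> * C0 * (6 * C) \<le> C4"
  proof -
    show "\<alpha> * C0 * (3 * (C + C1)) \<le> C4" "\<alpha> * C0 * (6 * C) \<le> C4"
      unfolding C4_def using aC0 C by (auto intro!: mult_left_mono)
    have "1 * (6 * (C + C1)) \<le> C4" unfolding C4_def using aC0 C by (intro mult_right_mono) auto
    then show "2 * C \<le> C4" using C by simp
  qed
  define c where "c = \<alpha> * (C4 * C2)"
  have C4': "1 \<le> C4 * C2" using mult_mono[of 1 C4 1 C2] C4(1) C C2 by simp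
  have c1: "1 \<le> c" using mult_mono[of 1 \<alpha> 1 "C4 * C2"] C4' \<alpha> by (simp add: c_def)
  have lnc: "0 \<le> ln c" using c1 by simp
  \<comment> \<open>One summand per estimate to be absorbed: the schedule cost, the bound on
    \<open>A\<close>, the cost involving \<open>n\<close>, and the squared rates, where the 2 comes
    from the square of a sum.\<close>
  define Cf where "Cf = C3 + c + C3 * (c + ln c + 3) + 2 * C3 * c\<^sup>2"
  have "0 \<le> C3 * (c + ln c + 3)" "0 \<le> 2 * C3 * c\<^sup>2" using C3 c1 lnc by simp_all
  then have Cf: "0 < Cf" "C3 \<le> Cf" "c \<le> Cf" "C3 * (c + ln c + 3) \<le> Cf" "2 * C3 * c\<^sup>2 \<le> Cf"
    using C3 c1 unfolding Cf_def by linarith+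
  show ?thesis
  \<comment> \<open>The power is 4 because the bound on \<open>A\<close> carries the square of
    \<open>l\<close> and the cost is quadratic in \<open>A\<close>.\<close>
  proof (rule exI[of _ Cf], rule exI[of _ 4], intro conjI Cf(1) allI impI, elim conjE)
    fix d n fs L \<mu> \<eta> xs and D0 :: "fsvec measure"
    assume A1: "A1 d n fs L" and A2: "A2 d n fs \<mu> xs" and xs: "is_reference_minimizer d n fs xs"
      and L: "0 < L" and \<eta>: "0 < \<eta>" "\<eta> * L = \<rho>" and bn: "b \<le> n"
      and D0: "prob_space D0" "sets D0 = sets (restrict_space borel (Rd d))"
      and int: "integrable D0 (\<lambda>x. (norm (x - xs))\<^sup>2)"
    have n1: "1 \<le> n" using b bn by simp
    interpret finite_sum_problem d n fs L xs
      using A1 xs L n1 by unfold_locales (auto simp: is_reference_minimizer_def)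
    define Dx where "Dx = L * (\<integral>x. (norm (x - xs))\<^sup>2 \<partial>D0)"
    define DH where "DH = grad_variance d n fs xs / L"
    let ?comp = "scsg_complexity d n fs xs (\<lambda>_. \<eta>) (\<lambda>_. b) (\<lambda>j. m\<^sub>0 * \<alpha> ^ j) (batch_size B\<^sub>0 \<alpha> n) D0"
    have Dx0: "0 \<le> Dx" and DH0: "0 \<le> DH" using L grad_variance_nonneg by (simp_all add: Dx_def DH_def)
    have \<mu>0: "0 \<le> \<mu>" using A2 by (simp add: A2_def)
    obtain E :: "nat \<Rightarrow> real" where E: "\<And>T. 0 \<le> E T"
        "\<And>T. expected_gap d n fs xs (\<lambda>_. \<eta>) (\<lambda>_. b) (\<lambda>j. m\<^sub>0 * \<alpha> ^ j) (batch_size B\<^sub>0 \<alpha> n) D0 T = ennreal (E T)"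
        "\<And>T. E T \<le> C * (real (T + 1))\<^sup>2 * (Dx + DH) / \<alpha> ^ T"
      and Esc: "\<And>J T. 0 < \<mu> \<Longrightarrow> 1 \<le> L / \<mu> \<Longrightarrow> J \<le> T \<Longrightarrow> C0 * (L / \<mu>) \<le> \<alpha> ^ J \<Longrightarrow>
              E T \<le> (\<alpha> powr (- (1 / \<xi>))) ^ (T - J) * (C * (real (J + 1))\<^sup>2 * (Dx + DH) / \<alpha> ^ J)
                     + C1 * (real (T + 1))\<^sup>2 * DH / \<alpha> ^ T"
      and Efb: "\<And>J T. 0 < \<mu> \<Longrightarrow> 1 \<le> L / \<mu> \<Longrightarrow> J \<le> T \<Longrightarrow> C0 * (sqrt (real n) + L / \<mu>) \<le> \<alpha> ^ J \<Longrightarrow>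
              E T \<le> (\<alpha> powr (- (1 / \<xi>))) ^ (T - J) * (C * (real (J + 1))\<^sup>2 * (Dx + DH) / \<alpha> ^ J)"
      using bounds[OF finite_sum_problem_axioms \<eta> bn D0 int Dx_def DH_def] A2 by blast
    \<comment> \<open>The growth factor of the loop sizes after the last required epoch, so the
      schedule bounds the cost through \<open>A\<close> directly.\<close>
    define A where "A \<epsilon> = \<alpha> ^ (LEAST T'. \<forall>T\<ge>T'. E T \<le> \<epsilon>)" for \<epsilon>
    have "1 \<le> A \<epsilon> \<and>
            ?comp \<epsilon> \<le> ennreal (Cf * min ((A \<epsilon>)\<^sup>2) (A \<epsilon> + real n * ln (A \<epsilon>))) \<and>
            ennreal (A \<epsilon>) \<le> ennreal (Cf * polylog 4 n (max Dx DH / \<epsilon>)) * rate_A n L \<mu> Dx DH \<xi> \<epsilon> \<and>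
            ?comp \<epsilon> \<le> ennreal (Cf * polylog 4 n (max Dx DH / \<epsilon>)) * rate_comp n L \<mu> Dx DH \<xi> \<epsilon>"
      if \<epsilon>: "0 < \<epsilon>" "\<epsilon> \<le> max Dx DH" for \<epsilon>
    proof -
      define r where "r = max Dx DH / \<epsilon>"
      define l where "l = 1 + ln r"
      have r1: "1 \<le> r" using \<epsilon> by (simp add: r_def)
      have l1: "1 \<le> l" using r1 by (simp add: l_def)
      have l2: "1 \<le> l\<^sup>2" using l1 by (simp add: one_le_power)
      have d0: "0 < d"
      proof (rule ccontr)
        assume "\<not> 0 < d"
        moreover have "space D0 = Rd d"
          using sets_eq_imp_space_eq[OF D0(2)] by (simp add: space_restrict_space)
        ultimately have "Dx = 0" "DH = 0"
          using trivial_in_dimension_0[of D0] by (simp_all add: Dx_def DH_def)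
        then show False using \<epsilon> by simp
      qed
      define \<kappa> where "\<kappa> = L / \<mu>"
      define s where "s = star_pow (Dx / (\<epsilon> * \<kappa>)) \<xi>"
      have \<kappa>: "1 \<le> \<kappa>" if "0 < \<mu>" using condition_number_ge_1[OF A2 that d0] by (simp add: \<kappa>_def)
      have star1: "1 \<le> star_pow x \<xi>" for x using \<xi> by (simp add: star_pow_def ge_one_powr_ge_zero)

      define R where "R = C4 * C2 * l\<^sup>2"
      have R: "1 \<le> R" using mult_mono[OF C4' l2] C4' by (simp add: R_def)
      \<comment> \<open>By the dichotomy it is enough to treat logarithmically many epochs: in the
        other case the general bound already gives accuracy \<epsilon>. Each threshold may thus
        replace (T + 1)^2 by \<open>C2 * l\<^sup>2\<close>.\<close>
      have ER: "E T \<le> \<epsilon>" if small_case: "(real (T + 1))\<^sup>2 \<le> C2 * l\<^sup>2 \<Longrightarrow> E T \<le> \<epsilon>" for T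
        using dich[OF r1, of T] small_case threshold_general[OF \<alpha> C(1) \<epsilon>(1) E(3), of T]
        unfolding r_def[symmetric] l_def[symmetric] by blast
      have P0: "0 \<le> C2 * l\<^sup>2" using C2 l2 by simp

      have T1: "E T \<le> \<epsilon>" if T: "R * r \<le> \<alpha> ^ T" for T
      proof (rule ER, rule threshold_general[OF \<alpha> C(1) \<epsilon>(1) E(3)])
        assume P: "(real (T + 1))\<^sup>2 \<le> C2 * l\<^sup>2"
        have "2 * C * (real (T + 1))\<^sup>2 * r \<le> C4 * (C2 * l\<^sup>2) * r"
          using C4(1) P r1 C by (intro mult_right_mono mult_mono) auto
        then show "2 * C * (real (T + 1))\<^sup>2 * (max Dx DH / \<epsilon>) \<le> \<alpha> ^ T"
          using T by (simp add: R_def r_def mult.assoc)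
      qed
      have T2: "E T \<le> \<epsilon>" if \<mu>: "0 < \<mu>" and T: "R * (\<kappa> * s + DH / \<epsilon>) \<le> \<alpha> ^ T" for T
      proof (rule ER, rule threshold_strongly_convex[OF \<alpha> \<xi> C \<epsilon>(1) Dx0 DH0 \<kappa>[OF \<mu>], where T = T and P = "C2 * l\<^sup>2"])
        have "\<alpha> * C0 * (3 * (C + C1)) * (C2 * l\<^sup>2) * (\<kappa> * s + DH / \<epsilon>) \<le> C4 * (C2 * l\<^sup>2) * (\<kappa> * s + DH / \<epsilon>)"
          using C4(2) P0 \<kappa>[OF \<mu>] star1 DH0 \<epsilon>
          by (intro mult_right_mono) (auto simp: s_def intro!: add_nonneg_nonneg mult_nonneg_nonneg order_trans[OF zero_le_one star1])
        then show "\<alpha> * C0 * (3 * (C + C1)) * (C2 * l\<^sup>2) * (\<kappa> * star_pow (Dx / (\<epsilon> * \<kappa>)) \<xi> + DH / \<epsilon>) \<le> \<alpha> ^ T"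
          using T by (simp add: R_def s_def mult.assoc)
      qed (use Esc[OF \<mu>] \<kappa>[OF \<mu>] in \<open>auto simp: \<kappa>_def\<close>)
      have T3: "E T \<le> \<epsilon>" if \<mu>: "0 < \<mu>" and T: "R * kterm n (max Dx DH) \<epsilon> \<xi> \<kappa> \<le> \<alpha> ^ T" for T
      proof -
        let ?k = "sqrt (real n) + \<kappa>"
        have k1: "1 \<le> ?k" using \<kappa>[OF \<mu>] real_sqrt_ge_zero[of "real n"] by linarith
        show ?thesis
        proof (rule ER, rule threshold_full_batch[OF \<alpha> \<xi> C(1,2) \<epsilon>(1) Dx0 DH0 k1, where T = T and P = "C2 * l\<^sup>2"])
          let ?t = "?k * star_pow (max Dx DH / (\<epsilon> * ?k)) \<xi>"
          have "0 \<le> ?t" using k1 star1[of "max Dx DH / (\<epsilon> * ?k)"] by (intro mult_nonneg_nonneg) auto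
          then have "\<alpha> * C0 * (6 * C) * (C2 * l\<^sup>2) * ?t \<le> C4 * (C2 * l\<^sup>2) * ?t"
            using C4(3) P0 by (intro mult_right_mono) auto
          then show "\<alpha> * C0 * (6 * C) * (C2 * l\<^sup>2) * ?t \<le> \<alpha> ^ T"
            using T by (simp add: R_def kterm_def Let_def mult.assoc)
        qed (use Efb[OF \<mu>] \<kappa>[OF \<mu>] in \<open>auto simp: \<kappa>_def\<close>)
      qed

      have cR: "\<alpha> * R = c * l\<^sup>2" by (simp add: c_def R_def)
      have A_le: "A \<epsilon> \<le> c * l\<^sup>2 * x" if "1 \<le> x" "\<And>T. R * x \<le> \<alpha> ^ T \<Longrightarrow> E T \<le> \<epsilon>" for x
      proof -
        have "1 \<le> R * x" using mult_mono[OF R that(1)] R by simp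
        from least_exponent_le[OF \<alpha> this that(2)] show ?thesis
          by (simp add: A_def mult.assoc[symmetric] cR)
      qed
      have A1: "A \<epsilon> \<le> c * l\<^sup>2 * r" by (rule A_le[OF r1 T1])
      have x2: "1 \<le> \<kappa> * s + DH / \<epsilon>" if "0 < \<mu>"
      proof -
        have "1 * 1 \<le> \<kappa> * s" using \<kappa>[OF that] star1 by (intro mult_mono) (auto simp: s_def)
        moreover have "0 \<le> DH / \<epsilon>" using DH0 \<epsilon> by simp
        ultimately show ?thesis by linarith
      qed
      have A2': "A \<epsilon> \<le> c * l\<^sup>2 * (\<kappa> * s + DH / \<epsilon>)" if "0 < \<mu>" by (rule A_le[OF x2[OF that] T2[OF that]])
      have x3: "1 \<le> kterm n (max Dx DH) \<epsilon> \<xi> \<kappa>" if "0 < \<mu>"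
      proof -
        let ?k = "sqrt (real n) + \<kappa>"
        have "1 \<le> ?k" using \<kappa>[OF that] real_sqrt_ge_zero[of "real n"] by linarith
        then have "1 * 1 \<le> ?k * star_pow (max Dx DH / (\<epsilon> * ?k)) \<xi>"
          using star1 by (intro mult_mono) auto
        then show ?thesis by (simp add: kterm_def Let_def)
      qed
      have A3: "A \<epsilon> \<le> c * l\<^sup>2 * kterm n (max Dx DH) \<epsilon> \<xi> \<kappa>" if "0 < \<mu>" by (rule A_le[OF x3[OF that] T3[OF that]])
      have A0: "1 \<le> A \<epsilon>" using \<alpha> by (simp add: A_def)

      define p where "p = polylog 4 n r"
      have "1 + ln r \<le> 1 + ln (real n) + ln r" using n1 by simp
      then have "l ^ 4 \<le> p" using l1 unfolding p_def polylog_def l_def[symmetric] by (intro power_mono) auto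
      moreover have "(l\<^sup>2)\<^sup>2 = l ^ 4" by simp
      moreover have "l\<^sup>2 \<le> (l\<^sup>2)\<^sup>2" using mult_left_mono[OF l2, of "l\<^sup>2"] by (simp add: power2_eq_square)
      ultimately have p: "l\<^sup>2 \<le> p" "(l\<^sup>2)\<^sup>2 \<le> p" "1 \<le> p" using l2 by linarith+
      have Cp: "0 < Cf * p" using Cf p by simp
      have "c * l\<^sup>2 \<le> Cf * p" using Cf p l2 c1 by (intro mult_mono) auto
      then have cp: "c * l\<^sup>2 * x \<le> Cf * p * x" if "1 \<le> x" for x using that by (intro mult_right_mono) auto

      have rate_A: "ennreal (A \<epsilon>) \<le> ennreal (Cf * p) * rate_A n L \<mu> Dx DH \<xi> \<epsilon>"
        unfolding rate_A_def Let_def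
      proof (rule le_mult_Min)
        fix x assume "x \<in> {ennreal (max Dx DH / \<epsilon>), at_kappa L \<mu> (\<lambda>\<kappa>. \<kappa> * star_pow (Dx / (\<epsilon> * \<kappa>)) \<xi> + DH / \<epsilon>),
           at_kappa L \<mu> (\<lambda>\<kappa>. kterm n (max Dx DH) \<epsilon> \<xi> \<kappa>)}"
        then consider "x = ennreal r" | "x = at_kappa L \<mu> (\<lambda>\<kappa>. \<kappa> * star_pow (Dx / (\<epsilon> * \<kappa>)) \<xi> + DH / \<epsilon>)"
          | "x = at_kappa L \<mu> (\<lambda>\<kappa>. kterm n (max Dx DH) \<epsilon> \<xi> \<kappa>)" by (auto simp: r_def)
        then show "ennreal (A \<epsilon>) \<le> ennreal (Cf * p) * x"
        proof cases
          case 1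
          have "A \<epsilon> \<le> Cf * p * r" using A1 cp[OF r1] by linarith
          then show ?thesis unfolding 1 using Cp by (simp add: ennreal_mult'[symmetric] ennreal_leI)
        next
          case 2
          show ?thesis unfolding 2
            by (rule ennreal_le_at_kappa[OF Cp \<mu>0], fold \<kappa>_def)
               (rule order_trans[OF A2' cp[OF x2], unfolded s_def])
        next
          case 3
          show ?thesis unfolding 3
            by (rule ennreal_le_at_kappa[OF Cp \<mu>0], fold \<kappa>_def)
               (rule order_trans[OF A3 cp[OF x3]])
        qed
      qed auto

      define cst where "cst = (\<Sum>j<(LEAST T'. \<forall>T\<ge>T'. E T \<le> \<epsilon>). m\<^sub>0 * \<alpha> ^ Suc j + real (batch_size B\<^sub>0 \<alpha> n (Suc j)))"
      have comp: "?comp \<epsilon> = ennreal cst"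
        unfolding cst_def
        by (rule scsg_complexity_eq[OF E(2) _ eventually_accurate[OF \<alpha> T1] D0(1) _ b]) (use \<epsilon> m \<alpha> in auto)
      have cst: "cst \<le> C3 * min ((A \<epsilon>)\<^sup>2) (A \<epsilon> + real n * ln (A \<epsilon>))"
        unfolding cst_def A_def by (rule cost)
      have lnA0: "0 \<le> real n * ln (A \<epsilon>)" using A0 by simp
      have min0: "0 \<le> min ((A \<epsilon>)\<^sup>2) (A \<epsilon> + real n * ln (A \<epsilon>))" using lnA0 A0 by simp
      have cst_min: "cst \<le> Cf * min ((A \<epsilon>)\<^sup>2) (A \<epsilon> + real n * ln (A \<epsilon>))"
        using cst mult_right_mono[OF Cf(2) min0] by linarith
      have cst_sq: "cst \<le> C3 * c\<^sup>2 * p * x\<^sup>2" if "1 \<le> x" "A \<epsilon> \<le> c * l\<^sup>2 * x" for x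
      proof -
        have "(A \<epsilon>)\<^sup>2 \<le> (c * l\<^sup>2 * x)\<^sup>2" using A0 that by (intro power_mono) auto
        also have "\<dots> = c\<^sup>2 * x\<^sup>2 * (l\<^sup>2)\<^sup>2" by (simp add: power_mult_distrib)
        also have "\<dots> \<le> c\<^sup>2 * x\<^sup>2 * p" using p by (intro mult_left_mono) auto
        finally have "C3 * (A \<epsilon>)\<^sup>2 \<le> C3 * (c\<^sup>2 * x\<^sup>2 * p)" using C3 by (intro mult_left_mono) auto
        moreover have "C3 * min ((A \<epsilon>)\<^sup>2) (A \<epsilon> + real n * ln (A \<epsilon>)) \<le> C3 * (A \<epsilon>)\<^sup>2"
          using C3 by (intro mult_left_mono) auto
        ultimately show ?thesis using cst by (simp add: mult_ac)
      qed
      \<comment> \<open>The crude bound \<open>A1\<close> controls \<open>ln (A \<epsilon>)\<close>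
        whichever rate \<open>x\<close> is being proved.\<close>
      have cst_n: "cst \<le> Cf * p * (real n + x)" if "1 \<le> x" "A \<epsilon> \<le> c * l\<^sup>2 * x" for x
      proof -
        have "ln (A \<epsilon>) \<le> (ln c + 3) * l" by (rule ln_le_of_quadratic_log_bound[OF A0 c1 r1 l_def A1])
        also have "\<dots> \<le> (ln c + 3) * l\<^sup>2"
          using lnc l1 mult_left_mono[OF l1, of l] by (intro mult_left_mono) (auto simp: power2_eq_square)
        finally have "real n * ln (A \<epsilon>) \<le> real n * ((ln c + 3) * l\<^sup>2)" by (intro mult_left_mono) auto
        moreover have "c * l\<^sup>2 * x \<le> (c + ln c + 3) * l\<^sup>2 * x"
          using lnc that l2 by (intro mult_right_mono) auto
        moreover have "real n * ((ln c + 3) * l\<^sup>2) \<le> real n * ((c + ln c + 3) * l\<^sup>2)"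
          using c1 l2 by (intro mult_left_mono mult_right_mono) auto
        moreover have "(c + ln c + 3) * l\<^sup>2 * (real n + x)
            = real n * ((c + ln c + 3) * l\<^sup>2) + (c + ln c + 3) * l\<^sup>2 * x"
          by (simp add: algebra_simps)
        ultimately have "A \<epsilon> + real n * ln (A \<epsilon>) \<le> (c + ln c + 3) * l\<^sup>2 * (real n + x)"
          using that by linarith
        then have "C3 * (A \<epsilon> + real n * ln (A \<epsilon>)) \<le> C3 * ((c + ln c + 3) * l\<^sup>2 * (real n + x))"
          using C3 by (intro mult_left_mono) auto
        moreover have "C3 * min ((A \<epsilon>)\<^sup>2) (A \<epsilon> + real n * ln (A \<epsilon>)) \<le> C3 * (A \<epsilon> + real n * ln (A \<epsilon>))"
          using C3 by (intro mult_left_mono) auto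
        moreover have "(C3 * (c + ln c + 3)) * l\<^sup>2 * (real n + x) \<le> Cf * p * (real n + x)"
          using Cf p that l2 by (intro mult_right_mono mult_mono) auto
        ultimately show ?thesis using cst by (simp add: mult.assoc)
      qed
      have sq: "C3 * c\<^sup>2 * p * y \<le> Cf * p * z" if "y \<le> 2 * z" "0 \<le> z" for y z
      proof -
        have "C3 * c\<^sup>2 * p * y \<le> C3 * c\<^sup>2 * p * (2 * z)" using that C3 p by (intro mult_left_mono) auto
        also have "\<dots> = 2 * C3 * c\<^sup>2 * (p * z)" by simp
        also have "\<dots> \<le> Cf * (p * z)" using Cf(5) p that by (intro mult_right_mono) auto
        finally show ?thesis by simp
      qed
      have rate_comp: "ennreal cst \<le> ennreal (Cf * p) * rate_comp n L \<mu> Dx DH \<xi> \<epsilon>"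
        unfolding rate_comp_def Let_def
      proof (rule le_mult_Min)
        fix x assume "x \<in> {ennreal ((max Dx DH)\<^sup>2 / \<epsilon>\<^sup>2),
           at_kappa L \<mu> (\<lambda>\<kappa>. DH\<^sup>2 / \<epsilon>\<^sup>2 + \<kappa>\<^sup>2 * star_pow (Dx / (\<epsilon> * \<kappa>)) (2 * \<xi>)),
           ennreal (real n + max Dx DH / \<epsilon>), at_kappa L \<mu> (\<lambda>\<kappa>. real n + kterm n (max Dx DH) \<epsilon> \<xi> \<kappa>)}"
        then consider "x = ennreal (r\<^sup>2)"
          | "x = at_kappa L \<mu> (\<lambda>\<kappa>. DH\<^sup>2 / \<epsilon>\<^sup>2 + \<kappa>\<^sup>2 * star_pow (Dx / (\<epsilon> * \<kappa>)) (2 * \<xi>))"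
          | "x = ennreal (real n + r)" | "x = at_kappa L \<mu> (\<lambda>\<kappa>. real n + kterm n (max Dx DH) \<epsilon> \<xi> \<kappa>)"
          by (auto simp: r_def power_divide)
        then show "ennreal cst \<le> ennreal (Cf * p) * x"
        proof cases
          case 1
          have "cst \<le> Cf * p * r\<^sup>2" using cst_sq[OF r1 A1] sq[of "r\<^sup>2" "r\<^sup>2"] by simp
          then show ?thesis unfolding 1 using Cp by (simp add: ennreal_mult'[symmetric] ennreal_leI)
        next
          case 2
          have "cst \<le> Cf * p * (DH\<^sup>2 / \<epsilon>\<^sup>2 + \<kappa>\<^sup>2 * star_pow (Dx / (\<epsilon> * \<kappa>)) (2 * \<xi>))" if \<mu>: "0 < \<mu>"
          proof -
            have s2: "star_pow (Dx / (\<epsilon> * \<kappa>)) (2 * \<xi>) = s\<^sup>2"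
              by (simp add: s_def star_pow_def power2_eq_square flip: powr_add)
            have "cst \<le> C3 * c\<^sup>2 * p * (\<kappa> * s + DH / \<epsilon>)\<^sup>2" by (rule cst_sq[OF x2[OF \<mu>] A2'[OF \<mu>]])
            also have "\<dots> \<le> Cf * p * ((DH / \<epsilon>)\<^sup>2 + (\<kappa> * s)\<^sup>2)"
            proof (rule sq)
              have "(u + v)\<^sup>2 \<le> 2 * (v\<^sup>2 + u\<^sup>2)" for u v :: real
                using sum_squares_bound[of u v] by (simp add: power2_sum)
              then show "(\<kappa> * s + DH / \<epsilon>)\<^sup>2 \<le> 2 * ((DH / \<epsilon>)\<^sup>2 + (\<kappa> * s)\<^sup>2)" .
            qed simp
            finally show ?thesis by (simp add: s2 power_divide power_mult_distrib)
          qed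
          then show ?thesis unfolding 2 by (intro ennreal_le_at_kappa[OF Cp \<mu>0], fold \<kappa>_def)
        next
          case 3
          show ?thesis unfolding 3 using cst_n[OF r1 A1] Cp
            by (simp add: ennreal_mult'[symmetric] ennreal_leI del: ennreal_plus)
        next
          case 4
          show ?thesis unfolding 4
            by (rule ennreal_le_at_kappa[OF Cp \<mu>0], fold \<kappa>_def) (rule cst_n[OF x3 A3])
        qed
      qed auto
      show ?thesis
        using A0 cst_min rate_A rate_comp unfolding comp p_def r_def by (auto intro: ennreal_leI)
    qed
    note main = this
    have schedule: "(\<lambda>j. nat \<lceil>min (B\<^sub>0 * \<alpha> ^ (2 * j)) (real n)\<rceil>) = batch_size B\<^sub>0 \<alpha> n"
      by (simp add: batch_size_def fun_eq_iff)
    show "let D\<^sub>x = L * (\<integral>x. (norm (x - xs))\<^sup>2 \<partial>D0);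
           D\<^sub>H = grad_variance d n fs xs / L;
           D = max D\<^sub>x D\<^sub>H;
           E_comp = scsg_complexity d n fs xs (\<lambda>_. \<eta>) (\<lambda>_. b) (\<lambda>j. m\<^sub>0 * \<alpha> ^ j)
                      (\<lambda>j. nat \<lceil>min (B\<^sub>0 * \<alpha> ^ (2 * j)) (real n)\<rceil>) D0
       in \<exists>A :: real \<Rightarrow> real. \<forall>\<epsilon>. 0 < \<epsilon> \<and> \<epsilon> \<le> D \<longrightarrow>
            1 \<le> A \<epsilon> \<and>
            E_comp \<epsilon> \<le> ennreal (Cf * min ((A \<epsilon>)\<^sup>2) (A \<epsilon> + real n * ln (A \<epsilon>))) \<and>
            ennreal (A \<epsilon>) \<le> ennreal (Cf * polylog 4 n (D / \<epsilon>)) * rate_A n L \<mu> D\<^sub>x D\<^sub>H \<xi> \<epsilon> \<and>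
            E_comp \<epsilon> \<le> ennreal (Cf * polylog 4 n (D / \<epsilon>)) * rate_comp n L \<mu> D\<^sub>x D\<^sub>H \<xi> \<epsilon>"
      unfolding Let_def schedule Dx_def[symmetric] DH_def[symmetric]
      by (rule exI[of _ A], intro allI impI, elim conjE, rule main, assumption+)
  qed
qed

end
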